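(* Let $n\ge 2$, let $1<\rho<n$, and let $\Omega:\mathbb{S}^{n-1}\to\mathbb{R}$ satisfy $\Omega\in L^1(\mathbb{S}^{n-1})$, $\int_{\mathbb{S}^{n-1}}\Omega\,d\sigma=0$ and $\Omega\in L^\rho(\mathbb{S}^{n-1})$. Let $1\le\delta<+\infty$ and let $\omega$ be an $A_\delta$-weight on $\mathbb{R}^n$ satisfying the lower Ahlfors condition with index $1<\mathbf{d}<+\infty$: for some constant $c_0>0$, $$c_0\, r^{\mathbf{d}}\le\omega(B(x,r))\quad\text{for all } r>0,\ x\in\mathbb{R}^n.$$ Let $\mathfrak{s}$ be a real number with $1<\overline{\rho}=\frac{\rho n}{\rho n+\rho-n}\le\mathfrak{s}<n$ and $1<\mathfrak{s}\delta<\mathbf{d}$. In each item below, $C_{\Omega,\omega}>0$ denotes a constant independent of $f$ (it may depend on $\Omega$, $\omega$, $n$ and all the indices). 1) Let $f:\mathbb{R}^n\to\mathbb{R}$ be a regular function such that $\|\nabla f\|_{L^{\mathfrak{q}}(\omega)}<+\infty$ with $1<\mathfrak{q}<+\infty$. If $\frac{r}{\mathfrak{s}\delta}\left(1-\frac{\mathfrak{q}}{\mathbf{d}}\right)>1$ and $r\left(1-\frac{\mathfrak{q}}{\mathbf{d}}\right)=\mathfrak{q}$ for some index $1<r<+\infty$, then $$\|T^*_\Omega(f)\|_{L^r(\omega)}\le C_{\Omega,\omega}\,\|\nabla f\|_{L^{\mathfrak{q}}(\omega)}.$$ 2) Let $f:\mathbb{R}^n\to\mathbb{R}$ be a regular function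 such that $\nabla f\in L^\sigma(\omega)$ with $1<\sigma<+\infty$ and $\nabla f\in\mathcal{M}^{\mathfrak{s}\delta,\mathfrak{q}}(\omega)$ with $\mathfrak{s}\delta\le\mathfrak{q}<\mathbf{d}$. If $1<r<+\infty$ is such that $\frac{r}{\mathfrak{s}\delta}\left(1-\frac{\mathfrak{q}}{\mathbf{d}}\right)>1$ and $r\left(1-\frac{\mathfrak{q}}{\mathbf{d}}\right)=\sigma$, then $$\|T^*_\Omega(f)\|_{L^r(\omega)}\le C_{\Omega,\omega}\,\|\nabla f\|_{L^\sigma(\omega)}^{1-\frac{\mathfrak{q}}{\mathbf{d}}}\,\|\nabla f\|_{\mathcal{M}^{\mathfrak{s}\delta,\mathfrak{q}}(\omega)}^{\frac{\mathfrak{q}}{\mathbf{d}}}.$$ 3) Let $1<\mathfrak{q}<+\infty$ satisfy $\mathfrak{s}\delta\le\mathfrak{q}<\mathbf{d}$, and let $1<\mathfrak{a}\le\mathfrak{b}<+\infty$ satisfy $1<\frac{\mathfrak{a}}{\mathfrak{s}\delta}\left(1-\frac{\mathfrak{q}}{\mathbf{d}}\right)\le\frac{\mathfrak{b}}{\mathfrak{s}\delta}\left(1-\frac{\mathfrak{q}}{\mathbf{d}}\right)$. If $f:\mathbb{R}^n\to\mathbb{R}$ is a regular function such that $\nabla f\in\mathcal{M}^{\mathfrak{a}(1-\frac{\mathfrak{q}}{\mathbf{d}}),\,\mathfrak{b}(1-\frac{\mathfrak{q}}{\mathbf{d}})}(\omega)$ and $\nabla f\in\mathcal{M}^{\mathfrak{s}\delta,\mathfrak{q}}(\omega)$,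 then $$\|T^*_\Omega(f)\|_{\mathcal{M}^{\mathfrak{a},\mathfrak{b}}(\omega)}\le C_{\Omega,\omega}\,\|\nabla f\|_{\mathcal{M}^{\mathfrak{a}(1-\frac{\mathfrak{q}}{\mathbf{d}}),\,\mathfrak{b}(1-\frac{\mathfrak{q}}{\mathbf{d}})}(\omega)}^{1-\frac{\mathfrak{q}}{\mathbf{d}}}\,\|\nabla f\|_{\mathcal{M}^{\mathfrak{s}\delta,\mathfrak{q}}(\omega)}^{\frac{\mathfrak{q}}{\mathbf{d}}}.$$
   Context: "Regular function" is used in the informal sense of a sufficiently smooth function; no more specific class is prescribed in the statement. In $\int_{\mathbb{S}^{n-1}}\Omega\,d\sigma$, $\sigma$ is the surface measure on the unit sphere $\mathbb{S}^{n-1}$ (in item 2 the letter $\sigma$ denotes instead an exponent); $B(x,r)$ is the open ball of center $x$ and radius $r$. Maximal rough singular integral operator: $$T^*_{\Omega}(f)(x)=\sup_{t>0}\left|\int_{\{|y|>t\}}\frac{\Omega(y/|y|)}{|y|^n}f(x-y)\,dy\right|.$$ A weight is a locally integrable function $\omega:\mathbb{R}^n\to(0,+\infty)$; for measurable $A\subset\mathbb{R}^n$, $\omega(A)=\int_A\omega(x)\,dx$. For $1<\delta<+\infty$, $\omega\in A_\delta$ means $$[\omega]_{A_\delta}=\sup_B\left(\frac{1}{|B|}\int_B\omega(x)\,dx\right)\left(\frac{1}{|B|}\int_B\omega(x)^{-\frac{1}{\delta-1}}dx\right)^{\delta-1}<+\infty,$$ and $\omega\in A_1$ means $$[\omega]_{A_1}=\sup_B\left(\frac{1}{|B|}\int_B\omega(x)\,dx\right)\|\omega^{-1}\|_{L^\infty(B)}<+\infty,$$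 the suprema being over all balls $B\subset\mathbb{R}^n$. Weighted Lebesgue space: for $1\le p<+\infty$, $L^p(\omega)$ is the set of measurable functions $g$ with $\|g\|_{L^p(\omega)}=\left(\int_{\mathbb{R}^n}|g(x)|^p\,\omega(x)\,dx\right)^{1/p}<+\infty$. Weighted Morrey space: for $1\le p\le q<+\infty$, $\mathcal{M}^{p,q}(\omega)$ is the set of measurable functions $g$ with $$\|g\|_{\mathcal{M}^{p,q}(\omega)}=\sup_{x\in\mathbb{R}^n,\ r>0}\left(\frac{1}{\omega(B(x,r))^{1-\frac{p}{q}}}\int_{B(x,r)}|g(y)|^p\,\omega(y)\,dy\right)^{\frac1p}<+\infty;$$ for the vector-valued function $\nabla f$, $|\nabla f|$ is the Euclidean norm. *)

theory Defs
  imports "HOL-Analysis.Analysis" "HOL-Probability.Essential_Supremum"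
begin

text \<open>Real powers on the extended half-line; only used with exponents \<open>a \<ge> 0\<close>, and with \<open>a = 0\<close>
  only at finite nonzero \<open>x\<close> (in the Morrey norm with \<open>p = q\<close>).\<close>

definition epowr :: "ennreal \<Rightarrow> real \<Rightarrow> ennreal" where
  "epowr x a = (if x = \<infinity> then \<infinity> else ennreal (enn2real x powr a))"

text \<open>Surface measure on the unit sphere, defined as the normalised cone measure
  \<open>\<sigma>(A) = n |{x. 0 < |x| < 1 \<and> x/|x| \<in> A}|\<close> and completed, so that Lebesgue measurable
  functions on the sphere are admitted. Its total mass is \<open>n |B(0,1)|\<close>.\<close>

definition surface_measure :: "(real ^ 'n) measure" where
  "surface_measure = completion (scale_measure (of_nat CARD('n))
     (distr (restrict_space lborel (ball 0 1 - {0})) (restrict_space borel (sphere 0 1)) sgn))"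

definition grad :: "(real ^ 'n \<Rightarrow> real) \<Rightarrow> real ^ 'n \<Rightarrow> real ^ 'n" where
  "grad f x = (THE D. GDERIV f x :> D)"

text \<open>Regular means of class \<open>C\<^sup>1\<close>, so that every smoother class is covered.
  No decay or integrability of \<open>f\<close> itself is included.\<close>

definition regular_function :: "(real ^ 'n \<Rightarrow> real) \<Rightarrow> bool" where
  "regular_function f \<longleftrightarrow> f differentiable_on UNIV \<and> continuous_on UNIV (grad f)"

abbreviation grad_size :: "(real ^ 'n \<Rightarrow> real) \<Rightarrow> real ^ 'n \<Rightarrow> ennreal" where
  "grad_size f \<equiv> (\<lambda>x. ennreal (norm (grad f x)))"

text \<open>Here \<open>sgn y = y/|y|\<close>. The truncated integrals are Lebesgue integrals. For fixed \<open>x\<close> and for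
  \<open>\<Omega>\<close> integrable on the sphere, \<open>f\<close> continuous, they converge absolutely either for all \<open>t > 0\<close>
  or for none; in the latter case the library's convention makes them (and the supremum) zero.\<close>

definition max_rough_op ::
  "(real ^ 'n \<Rightarrow> real) \<Rightarrow> (real ^ 'n \<Rightarrow> real) \<Rightarrow> real ^ 'n \<Rightarrow> ennreal" where
  "max_rough_op \<Omega> f x =
     (SUP t\<in>{0<..}. ennreal \<bar>LINT y:{y. norm y > t}|lebesgue.
        \<Omega> (sgn y) / norm y ^ CARD('n) * f (x - y)\<bar>)"

definition weight :: "(real ^ 'n \<Rightarrow> real) \<Rightarrow> bool" where
  "weight \<omega> \<longleftrightarrow> (\<forall>x. 0 < \<omega> x) \<and> (\<forall>K. compact K \<longrightarrow> \<omega> absolutely_integrable_on K)"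

definition wmeas :: "(real ^ 'n \<Rightarrow> real) \<Rightarrow> (real ^ 'n) set \<Rightarrow> ennreal" where
  "wmeas \<omega> A = (\<integral>\<^sup>+y\<in>A. ennreal (\<omega> y) \<partial>lebesgue)"

definition ball_avg :: "(real ^ 'n \<Rightarrow> real) \<Rightarrow> real ^ 'n \<Rightarrow> real \<Rightarrow> ennreal" where
  "ball_avg g x r = (\<integral>\<^sup>+y\<in>ball x r. ennreal (g y) \<partial>lebesgue) / emeasure lebesgue (ball x r)"

definition muckenhoupt_const :: "real \<Rightarrow> (real ^ 'n \<Rightarrow> real) \<Rightarrow> ennreal" where
  "muckenhoupt_const \<delta> \<omega> =
     (SUP x. SUP r\<in>{0<..}.
        if \<delta> = 1
        then ball_avg \<omega> x r *
             esssup (restrict_space lebesgue (ball x r)) (\<lambda>y. ennreal (inverse (\<omega> y)))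
        else ball_avg \<omega> x r *
             epowr (ball_avg (\<lambda>y. \<omega> y powr (- 1 / (\<delta> - 1))) x r) (\<delta> - 1))"

definition A_weight :: "real \<Rightarrow> (real ^ 'n \<Rightarrow> real) \<Rightarrow> bool" where
  "A_weight \<delta> \<omega> \<longleftrightarrow> weight \<omega> \<and> muckenhoupt_const \<delta> \<omega> < \<infinity>"

definition lower_Ahlfors :: "real \<Rightarrow> (real ^ 'n \<Rightarrow> real) \<Rightarrow> bool" where
  "lower_Ahlfors d \<omega> \<longleftrightarrow>
     (\<exists>c\<^sub>0>0. \<forall>r>0. \<forall>x. ennreal (c\<^sub>0 * r powr d) \<le> wmeas \<omega> (ball x r))"

text \<open>The norms act on extended nonnegative functions \<open>g\<close>, since the maximal operator may take
  the value \<open>\<infinity>\<close>; a real or vector valued function enters through its pointwise norm.\<close>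

definition Lp_norm :: "real \<Rightarrow> (real ^ 'n \<Rightarrow> real) \<Rightarrow> (real ^ 'n \<Rightarrow> ennreal) \<Rightarrow> ennreal" where
  "Lp_norm p \<omega> g = epowr (\<integral>\<^sup>+y. epowr (g y) p * ennreal (\<omega> y) \<partial>lebesgue) (1 / p)"

definition morrey_norm ::
  "real \<Rightarrow> real \<Rightarrow> (real ^ 'n \<Rightarrow> real) \<Rightarrow> (real ^ 'n \<Rightarrow> ennreal) \<Rightarrow> ennreal" where
  "morrey_norm p q \<omega> g =
     (SUP x. SUP r\<in>{0<..}.
        epowr ((\<integral>\<^sup>+y\<in>ball x r. epowr (g y) p * ennreal (\<omega> y) \<partial>lebesgue)
               / epowr (wmeas \<omega> (ball x r)) (1 - p / q)) (1 / p))"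

end

theory Submission
  imports Defs
begin

text \<open>Let \<open>p = s \<delta>\<close> and \<open>\<nu> = \<omega> dx\<close>. The \<open>A\<^sub>\<delta>\<close> condition makes \<open>\<nu>\<close> doubling and bounds the Lebesgue
  average of \<open>h\<close> over a ball by the \<open>\<nu>\<close>-average of \<open>h\<^sup>\<delta>\<close> to the power \<open>1/\<delta>\<close>. Cut the truncated
  integral into dyadic shells of radius \<open>r\<^sub>k = t 2\<^sup>k\<close>. As \<open>\<Omega>\<close> has mean zero, the Poincare inequality in
  Riesz potential form and the Hardy--Littlewood--Sobolev inequality for \<open>|\<Omega>|\<close> bound the piece on
  each shell by \<open>r\<^sub>k\<close> times the \<open>s\<close>-mean of \<open>|\<nabla>f|\<close> over \<open>B(x, 3 r\<^sub>k)\<close>, hence by \<open>r\<^sub>k\<close> times its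
  \<open>p\<close>-mean with respect to \<open>\<nu>\<close>. With \<open>M\<close> the maximal function of \<open>\<nu>\<close>, that mean is at most
  \<open>M(|\<nabla>f|\<^sup>p)\<^bsup>1/p\<^esup>\<close> and, by lower Ahlfors regularity, at most a constant times \<open>r\<^sub>k\<^bsup>-d/q\<^esup>\<close> times the
  Morrey norm. Since \<open>q < d\<close>, summing the smaller of the two bounds over \<open>k\<close> dominates \<open>T\<^sup>*f\<close> by
  \<open>M(|\<nabla>f|\<^sup>p)\<^bsup>(1 - q/d)/p\<^esup>\<close> times the Morrey norm to the power \<open>q/d\<close>, and the three estimates follow
  from the boundedness of \<open>M\<close> on Lebesgue and Morrey spaces over \<open>\<nu>\<close>. The same summation for Lebesgue
  measure with exponent \<open>1\<close> is Hedberg's proof of the Hardy--Littlewood--Sobolev inequality.\<close>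

subsection \<open>Powers and integrals of extended nonnegative functions\<close>

text \<open>The supremum over truncations costs nothing because the dyadic sum is bounded uniformly
  in its starting radius \<open>t\<close>; no cancellation between different shells is used. Inside
  one shell the mean zero of \<Omega> is indispensable: nothing is known about the size of
  \<open>f\<close>, so only differences of its values may appear. The exponent \<open>s\<close> may
  lie above the endpoint because the sphere has finite measure: \<Omega> also lies in the Lebesgue
  space of the smaller exponent \<rho>' with 1/s = 1 - 1/\<rho>' + 1/n, for which \<open>s\<close>
  is the endpoint, and s < n is exactly what keeps \<rho>' > 1. The Riesz potential of |\<Omega>|
  does not involve \<open>f\<close>, so the Hardy--Littlewood--Sobolev inequality is needed only as
  a finiteness statement. A technical obstacle is measurability: \<Omega> and \<omega> are only
  Lebesgue measurable. Both get Borel representatives, and the maximal operator is never treated as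
  a measurable function, only compared with a Borel majorant.\<close>

lemma epowr_ennreal [simp]: "0 \<le> x \<Longrightarrow> epowr (ennreal x) a = ennreal (x powr a)"
  by (simp add: epowr_def)

lemma epowr_top [simp]: "epowr top a = top" "epowr \<infinity> a = \<infinity>"
  by (simp_all add: epowr_def)

lemma epowr_zero [simp]: "epowr 0 a = 0"
  by (simp add: epowr_def)

lemma epowr_eq_0_iff [simp]: "epowr x a = 0 \<longleftrightarrow> x = 0"
  by (cases x) auto

lemma epowr_eq_top_iff [simp]: "epowr x a = top \<longleftrightarrow> x = top"
  by (cases x) auto

lemma epowr_one [simp]: "epowr x 1 = x"
  by (cases x) auto

lemma one_epowr [simp]: "epowr 1 a = 1"
  by (simp add: epowr_def)

lemma epowr_mono: "0 \<le> a \<Longrightarrow> x \<le> y \<Longrightarrow> epowr x a \<le> epowr y a"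
  by (cases x; cases y) (auto intro!: ennreal_leI powr_mono2 simp: top_unique)

lemma epowr_mult:
  assumes "0 < a"
  shows "epowr (x * y) a = epowr x a * epowr y a"
proof (cases "x = top \<or> y = top")
  case True
  then show ?thesis by (cases "x = 0"; cases "y = 0") (auto simp: ennreal_mult_top ennreal_top_mult)
next
  case False
  then obtain u v where "x = ennreal u" "0 \<le> u" "y = ennreal v" "0 \<le> v"
    by (cases x; cases y) auto
  then show ?thesis by (simp add: ennreal_mult[symmetric] powr_mult)
qed

text \<open>Holds for exponents of either sign because \<open>epowr\<close> fixes 0 and
  \<open>top\<close> whatever the exponent; the same convention makes \<open>epowr_add\<close>
  unconditional.\<close>

lemma epowr_epowr: "epowr (epowr x a) b = epowr x (a * b)"
  by (cases x) (auto simp: powr_powr)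

lemma epowr_add: "epowr x (a + b) = epowr x a * epowr x b"
  by (cases x) (auto simp: powr_add ennreal_mult)

lemma epowr_minus: "epowr (inverse x) a = inverse (epowr x a)"
proof (cases x)
  case (real r)
  show ?thesis
  proof (cases "r = 0")
    case False
    with real show ?thesis by (simp add: inverse_ennreal powr_minus inverse_powr)
  qed (use real in simp)
qed simp

lemma epowr_divide: "0 < a \<Longrightarrow> epowr (x / y) a = epowr x a / epowr y a"
  by (simp add: divide_ennreal_def epowr_mult epowr_minus)

lemma borel_measurable_epowr [measurable]:
  assumes [measurable]: "f \<in> borel_measurable M"
  shows "(\<lambda>x. epowr (f x) a) \<in> borel_measurable M"
  unfolding epowr_def by measurable

text \<open>Comparing the sum with twice the maximum avoids convexity, so one constant serves every
  positive exponent.\<close>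

lemma epowr_add_le:
  assumes "0 < p"
  shows "epowr (x + y) p \<le> ennreal (2 powr p) * (epowr x p + epowr y p)"
proof -
  have 2: "epowr 2 p = ennreal (2 powr p)"
    using epowr_ennreal[of 2 p] by simp
  have "epowr (x + y) p \<le> epowr (2 * max x y) p"
    using assms by (intro epowr_mono) (auto simp: mult_2 intro: add_mono)
  also have "\<dots> = ennreal (2 powr p) * epowr (max x y) p"
    using assms by (simp add: epowr_mult 2)
  also have "\<dots> \<le> ennreal (2 powr p) * (epowr x p + epowr y p)"
    by (intro mult_left_mono) (auto simp: max_def)
  finally show ?thesis .
qed

lemma sets_borel_ball [measurable]: "ball x r \<in> sets borel"
  by simp

section \<open>Young's and Hoelder's inequalities\<close>

lemma conjugate_exponent_gt_1:
  fixes p q :: real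
  assumes "1 < p" "1 / p + 1 / q = 1"
  shows "1 < q"
proof -
  have "0 < 1 / p" "1 / p < 1" using assms(1) by auto
  with assms(2) have "0 < 1 / q" "1 / q < 1" by linarith+
  then show ?thesis by (simp add: divide_less_eq_1 split: if_splits)
qed

lemma ennreal_young:
  assumes "1 < p" and q: "1 / p + 1 / q = 1"
  shows "x * y \<le> ennreal (1 / p) * epowr x p + ennreal (1 / q) * epowr y q"
proof -
  have "q > 1" by (rule conjugate_exponent_gt_1[OF assms])
  show ?thesis
  proof (cases "x = top \<or> y = top")
    case True
    then have "ennreal (1 / p) * epowr x p + ennreal (1 / q) * epowr y q = top"
      using \<open>1 < p\<close> \<open>q > 1\<close> by (auto simp: ennreal_mult_top)
    then show ?thesis by (metis top_greatest)
  next
    case False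
    then obtain a b where ab: "x = ennreal a" "0 \<le> a" "y = ennreal b" "0 \<le> b"
      by (cases x; cases y) auto
    have "a * b \<le> a powr p / p + b powr q / q"
      using assms ab \<open>q > 1\<close> by (intro Youngs_inequality) auto
    then have "ennreal (a * b) \<le> ennreal (1 / p * a powr p + 1 / q * b powr q)"
      by (intro ennreal_leI) simp
    also have "\<dots> = ennreal (1 / p) * ennreal (a powr p) + ennreal (1 / q) * ennreal (b powr q)"
      using \<open>1 < p\<close> \<open>q > 1\<close> by (subst ennreal_plus) (auto simp: ennreal_mult simp del: times_divide_eq_left)
    finally show ?thesis using ab by (simp add: ennreal_mult)
  qed
qed

lemma nn_integral_holder_aux:
  assumes "1 < p" and q: "1 / p + 1 / q = 1"
    and [measurable]: "f \<in> borel_measurable M" "g \<in> borel_measurable M"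
    and 1: "(\<integral>\<^sup>+x. epowr (f x) p \<partial>M) \<le> 1" "(\<integral>\<^sup>+x. epowr (g x) q \<partial>M) \<le> 1"
  shows "(\<integral>\<^sup>+x. f x * g x \<partial>M) \<le> 1"
proof -
  have "q > 0" using conjugate_exponent_gt_1[OF assms(1,2)] by simp
  have "(\<integral>\<^sup>+x. f x * g x \<partial>M) \<le>
      (\<integral>\<^sup>+x. ennreal (1 / p) * epowr (f x) p + ennreal (1 / q) * epowr (g x) q \<partial>M)"
    by (intro nn_integral_mono ennreal_young assms)
  also have "\<dots> = ennreal (1 / p) * (\<integral>\<^sup>+x. epowr (f x) p \<partial>M) + ennreal (1 / q) * (\<integral>\<^sup>+x. epowr (g x) q \<partial>M)"
    by (simp add: nn_integral_add nn_integral_cmult)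
  also have "\<dots> \<le> ennreal (1 / p) * 1 + ennreal (1 / q) * 1"
    by (intro add_mono mult_left_mono 1) auto
  also have "\<dots> = 1"
    using q \<open>1 < p\<close> \<open>q > 0\<close> by (simp add: ennreal_plus[symmetric] del: ennreal_plus)
  finally show ?thesis .
qed

text \<open>Dividing by the two norms reduces to the normalised case above. If one norm vanishes, so
  does the product almost everywhere; if one is infinite and the other nonzero, the right side is
  infinite.\<close>

lemma nn_integral_holder:
  assumes "1 < p" and q: "1 / p + 1 / q = 1"
    and [measurable]: "f \<in> borel_measurable M" "g \<in> borel_measurable M"
  shows "(\<integral>\<^sup>+x. f x * g x \<partial>M) \<le>
    epowr (\<integral>\<^sup>+x. epowr (f x) p \<partial>M) (1 / p) * epowr (\<integral>\<^sup>+x. epowr (g x) q \<partial>M) (1 / q)"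
proof -
  have q0: "q > 0" using conjugate_exponent_gt_1[OF assms(1,2)] by simp
  define F where "F = (\<integral>\<^sup>+x. epowr (f x) p \<partial>M)"
  define G where "G = (\<integral>\<^sup>+x. epowr (g x) q \<partial>M)"
  consider "F = 0" | "G = 0" | "F \<noteq> 0" "G \<noteq> 0" "F = top \<or> G = top"
    | "F \<noteq> 0" "G \<noteq> 0" "F \<noteq> top" "G \<noteq> top" by blast
  then show ?thesis
  proof cases
    case 1
    then have "AE x in M. f x = 0"
      unfolding F_def by (subst (asm) nn_integral_0_iff_AE) auto
    then have "(\<integral>\<^sup>+x. f x * g x \<partial>M) = (\<integral>\<^sup>+x. 0 \<partial>M)"
      by (intro nn_integral_cong_AE) auto
    then show ?thesis by simp
  next
    case 2
    then have "AE x in M. g x = 0"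
      unfolding G_def by (subst (asm) nn_integral_0_iff_AE) auto
    then have "(\<integral>\<^sup>+x. f x * g x \<partial>M) = (\<integral>\<^sup>+x. 0 \<partial>M)"
      by (intro nn_integral_cong_AE) auto
    then show ?thesis by simp
  next
    case 3
    then have "epowr F (1 / p) * epowr G (1 / q) = top"
      by (auto simp: ennreal_mult_eq_top_iff)
    then show ?thesis unfolding F_def G_def by simp
  next
    case 4
    define a where "a = epowr F (1 / p)"
    define b where "b = epowr G (1 / q)"
    have ab: "a \<noteq> 0" "b \<noteq> 0" "a \<noteq> top" "b \<noteq> top"
      using 4 by (auto simp: a_def b_def)
    have "(\<integral>\<^sup>+x. (f x / a) * (g x / b) \<partial>M) \<le> 1"
    proof (rule nn_integral_holder_aux[OF assms(1,2)])
      have "(\<integral>\<^sup>+x. epowr (f x / a) p \<partial>M) = F / epowr a p"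
        using assms(1) by (simp add: epowr_divide nn_integral_divide F_def)
      also have "\<dots> \<le> 1"
        using assms(1) 4 by (simp add: a_def epowr_epowr less_top)
      finally show "(\<integral>\<^sup>+x. epowr (f x / a) p \<partial>M) \<le> 1" .
      have "(\<integral>\<^sup>+x. epowr (g x / b) q \<partial>M) = G / epowr b q"
        using q0 by (simp add: epowr_divide nn_integral_divide G_def)
      also have "\<dots> \<le> 1"
        using q0 4 by (simp add: b_def epowr_epowr less_top)
      finally show "(\<integral>\<^sup>+x. epowr (g x / b) q \<partial>M) \<le> 1" .
    qed auto
    then have "(a * b) * (\<integral>\<^sup>+x. (f x / a) * (g x / b) \<partial>M) \<le> (a * b) * 1"
      by (rule mult_left_mono) auto
    also have "(a * b) * (\<integral>\<^sup>+x. (f x / a) * (g x / b) \<partial>M) = (\<integral>\<^sup>+x. (a * (f x / a)) * (b * (g x / b)) \<partial>M)"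
      by (subst nn_integral_cmult[symmetric]) (auto simp: ac_simps)
    also have "\<dots> = (\<integral>\<^sup>+x. f x * g x \<partial>M)"
    proof -
      have "a * (z / a) = z" "b * (z / b) = z" for z
        using ab by (simp_all add: ennreal_times_divide mult.commute[of _ z] mult_divide_eq_ennreal)
      then show ?thesis by simp
    qed
    finally show ?thesis by (simp add: a_def b_def F_def G_def)
  qed
qed

text \<open>Hoelder against the constant 1 with exponent q/p, whose conjugate is q/(q - p). It will
  be applied on balls.\<close>

lemma nn_integral_holder_finite:
  assumes "0 < p" "p < q" and [measurable]: "f \<in> borel_measurable M"
  shows "(\<integral>\<^sup>+x. epowr (f x) p \<partial>M) \<le>
    epowr (\<integral>\<^sup>+x. epowr (f x) q \<partial>M) (p / q) * epowr (emeasure M (space M)) (1 - p / q)"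
proof -
  have "(\<integral>\<^sup>+x. epowr (f x) p * 1 \<partial>M) \<le>
    epowr (\<integral>\<^sup>+x. epowr (epowr (f x) p) (q / p) \<partial>M) (1 / (q / p)) *
    epowr (\<integral>\<^sup>+x. epowr 1 (q / (q - p)) \<partial>M) (1 / (q / (q - p)))"
    using assms by (intro nn_integral_holder) (auto simp: field_simps)
  then show ?thesis using assms by (simp add: epowr_epowr diff_divide_distrib)
qed

section \<open>Layer-cake formula\<close>

lemma nn_integral_powr_Icc:
  assumes "0 < p" "0 \<le> a"
  shows "(\<integral>\<^sup>+t\<in>{0..a}. ennreal (p * t powr (p - 1)) \<partial>lborel) = ennreal (a powr p)"
proof (rule nn_integral_has_integral_lebesgue')
  show "((\<lambda>t. p * t powr (p - 1)) has_integral (a powr p)) {0..a}"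
    using has_integral_mult_right[OF has_integral_powr_from_0[of "p - 1" a], of p] assms by simp
qed (use assms in auto)

lemma epowr_layer_cake:
  assumes "0 < p"
  shows "epowr x p = (\<integral>\<^sup>+t. ennreal (p * t powr (p - 1)) * indicator {t. 0 < t \<and> ennreal t < x} t \<partial>lborel)"
    (is "_ = ?I")
proof (cases x)
  case (real a)
  have "?I
      = (\<integral>\<^sup>+t\<in>{0..a}. ennreal (p * t powr (p - 1)) \<partial>lborel)"
  \<comment> \<open>The open interval from 0 to \<open>a\<close> and \<open>{0..a}\<close> differ
    only in the endpoints.\<close>
  proof (rule nn_integral_cong_AE)
    have "AE t in lborel. t \<noteq> a" by (rule AE_lborel_singleton)
    moreover have "AE t in lborel. t \<noteq> (0::real)" by (rule AE_lborel_singleton)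
    ultimately show "AE t in lborel. ennreal (p * t powr (p - 1)) * indicator {t. 0 < t \<and> ennreal t < x} t
      = ennreal (p * t powr (p - 1)) * indicator {0..a} t"
      by eventually_elim (use real in \<open>auto simp: indicator_def ennreal_less_iff\<close>)
  qed
  then show ?thesis
    using nn_integral_powr_Icc[OF assms] real by simp
next
  case top
  have "ennreal (real n) \<le> ?I" for n
  proof -
    \<comment> \<open>The right endpoint is chosen so that the integral is exactly \<open>n\<close>;
      letting \<open>n\<close> grow forces the full integral to be infinite.\<close>
    have "ennreal (real n) = (\<integral>\<^sup>+t\<in>{0..real n powr (1 / p)}. ennreal (p * t powr (p - 1)) \<partial>lborel)"
      using assms by (subst nn_integral_powr_Icc) (auto simp: powr_powr)
    also have "\<dots> \<le> ?I"
    proof (rule nn_integral_mono_AE)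
      have "AE t in lborel. t \<noteq> (0::real)" by (rule AE_lborel_singleton)
      then show "AE t in lborel. ennreal (p * t powr (p - 1)) * indicator {0..real n powr (1 / p)} t
        \<le> ennreal (p * t powr (p - 1)) * indicator {t. 0 < t \<and> ennreal t < x} t"
        by eventually_elim (auto simp: indicator_def top)
    qed
    finally show ?thesis .
  qed
  then have "?I = top"
    by (metis ennreal_Ex_less_of_nat ennreal_of_nat_eq_real_of_nat linorder_not_less top.not_eq_extremum)
  then show ?thesis using top by simp
qed

subsection \<open>The maximal function of a doubling measure\<close>

text \<open>The dilation factor 5 is that of the Vitali covering lemma. Lower regularity has two
  uses: it bounds the radii of balls with a large average, as that lemma demands, and it gives the
  decay in the radius behind the potential estimate.\<close>

locale doubling_measure =
  fixes \<nu> :: "'a::euclidean_space measure" and D d c :: real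
  assumes sets_nu [measurable_cong, simp]: "sets \<nu> = sets borel"
    and emeasure_ball_finite: "emeasure \<nu> (ball x r) < top"
    and doubling: "0 < r \<Longrightarrow> emeasure \<nu> (ball x (5 * r)) \<le> ennreal D * emeasure \<nu> (ball x r)"
    and lower_regular: "0 < r \<Longrightarrow> ennreal (c * r powr d) \<le> emeasure \<nu> (ball x r)"
    and D_pos: "0 < D" and d_pos: "0 < d" and c_pos: "0 < c"
begin

lemma space_nu [simp]: "space \<nu> = UNIV"
  using sets_eq_imp_space_eq[OF sets_nu] by simp

lemma emeasure_ball_pos: "0 < r \<Longrightarrow> 0 < emeasure \<nu> (ball x r)"
  using lower_regular[of r x] c_pos by (auto simp: order.strict_trans2[rotated])

lemma emeasure_ball_cases:
  assumes "0 < r"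
  obtains m where "emeasure \<nu> (ball x r) = ennreal m" "0 < m"
  using emeasure_ball_pos[OF assms, of x] emeasure_ball_finite[of x r]
  by (cases "emeasure \<nu> (ball x r)") auto

sublocale sigma_finite_measure \<nu>
proof
  show "\<exists>A. countable A \<and> A \<subseteq> sets \<nu> \<and> \<Union>A = space \<nu> \<and> (\<forall>a\<in>A. emeasure \<nu> a \<noteq> \<infinity>)"
  proof (intro exI[of _ "range (\<lambda>n::nat. ball 0 (real n))"] conjI ballI)
    show "\<Union> (range (\<lambda>n. ball (0::'a) (real n))) = space \<nu>"
      using reals_Archimedean2 by (auto simp: dist_norm)
  qed (auto simp: less_imp_neq[OF emeasure_ball_finite])
qed

definition average :: "('a \<Rightarrow> ennreal) \<Rightarrow> 'a \<Rightarrow> real \<Rightarrow> ennreal" where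
  "average g x r = (\<integral>\<^sup>+y\<in>ball x r. g y \<partial>\<nu>) / emeasure \<nu> (ball x r)"

text \<open>The supremum runs over all balls containing \<open>x\<close>, not only those centred
  there. Superlevel sets are then unions of open balls, so the function is Borel without any
  assumption on \<open>g\<close>.\<close>

definition maximal :: "('a \<Rightarrow> ennreal) \<Rightarrow> 'a \<Rightarrow> ennreal" where
  "maximal g x = (SUP (z, r)\<in>{(z, r). 0 < r \<and> x \<in> ball z r}. average g z r)"

lemma average_le_maximal: "0 < r \<Longrightarrow> x \<in> ball z r \<Longrightarrow> average g z r \<le> maximal g x"
  unfolding maximal_def by (rule SUP_upper2[of "(z, r)"]) auto

lemma maximal_le: "(\<And>z r. 0 < r \<Longrightarrow> x \<in> ball z r \<Longrightarrow> average g z r \<le> a) \<Longrightarrow> maximal g x \<le> a"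
  unfolding maximal_def by (rule SUP_least) auto

lemma maximal_superlevel:
  "{x. a < maximal g x} = (\<Union>(z, r)\<in>{(z, r). 0 < r \<and> a < average g z r}. ball z r)"
  by (auto simp: maximal_def less_SUP_iff) blast

lemma borel_measurable_maximal [measurable]: "maximal g \<in> borel_measurable borel"
proof (rule borel_measurableI_greater)
  fix a show "{x \<in> space borel. a < maximal g x} \<in> sets borel"
    using maximal_superlevel[of a g] by (auto intro!: borel_open)
qed

lemma average_times_emeasure:
  assumes "0 < r"
  shows "average g z r * emeasure \<nu> (ball z r) = (\<integral>\<^sup>+y\<in>ball z r. g y \<partial>\<nu>)"
  using emeasure_ball_pos[OF assms, of z] emeasure_ball_finite[of z r]
  by (simp add: average_def ennreal_divide_times ennreal_times_divide mult_divide_eq_ennreal)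

lemma average_le_iff:
  assumes "0 < r"
  shows "average g z r \<le> t \<longleftrightarrow> (\<integral>\<^sup>+y\<in>ball z r. g y \<partial>\<nu>) \<le> t * emeasure \<nu> (ball z r)"
proof
  assume "average g z r \<le> t"
  then show "(\<integral>\<^sup>+y\<in>ball z r. g y \<partial>\<nu>) \<le> t * emeasure \<nu> (ball z r)"
    unfolding average_times_emeasure[OF assms, symmetric] by (rule mult_right_mono) simp
next
  assume "(\<integral>\<^sup>+y\<in>ball z r. g y \<partial>\<nu>) \<le> t * emeasure \<nu> (ball z r)"
  then have "average g z r \<le> t * emeasure \<nu> (ball z r) / emeasure \<nu> (ball z r)"
    unfolding average_def by (rule divide_right_mono_ennreal)
  then show "average g z r \<le> t"
    using emeasure_ball_pos[OF assms, of z] emeasure_ball_finite[of z r]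
    by (simp add: mult_divide_eq_ennreal)
qed

lemma less_average_iff:
  assumes "0 < r"
  shows "t < average g z r \<longleftrightarrow> t * emeasure \<nu> (ball z r) < (\<integral>\<^sup>+y\<in>ball z r. g y \<partial>\<nu>)"
  using average_le_iff[OF assms, of g z t] by (simp add: not_le[symmetric])

text \<open>On each disjoint ball of a Vitali subfamily the integral of \<open>g\<close> is at least
  \<open>t\<close> times the measure, and doubling pays for the fivefold dilates, which cover the
  superlevel set.\<close>

lemma maximal_weak_type:
  assumes [measurable]: "g \<in> borel_measurable borel" and "0 < t"
  shows "ennreal t * emeasure \<nu> {x. ennreal t < maximal g x} \<le> ennreal D * (\<integral>\<^sup>+x. g x \<partial>\<nu>)"
proof (cases "(\<integral>\<^sup>+x. g x \<partial>\<nu>)")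
  case top
  then show ?thesis using D_pos by (simp add: ennreal_mult_top)
next
  case (real G)
  define K where "K = {(z, r). 0 < r \<and> ennreal t < average g z r}"
  have K: "ennreal t * emeasure \<nu> (ball z r) \<le> (\<integral>\<^sup>+y\<in>ball z r. g y \<partial>\<nu>)" "0 < r" if "(z, r) \<in> K" for z r
    using that less_average_iff[of r t g z] by (auto simp: K_def)
  \<comment> \<open>A ball in \<open>K\<close> has measure at most G/t, and lower regularity turns
    this into the bound on its radius that the covering lemma requires.\<close>
  have bound: "0 < snd i \<and> snd i \<le> (G / (t * c)) powr (1 / d)" if "i \<in> K" for i
  proof -
    obtain z r where i: "i = (z, r)" by (cases i)
    with that have r: "0 < r" by (simp add: K_def)
    have "ennreal t * ennreal (c * r powr d) \<le> ennreal t * emeasure \<nu> (ball z r)"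
      by (intro mult_left_mono lower_regular r) auto
    also have "\<dots> \<le> (\<integral>\<^sup>+y\<in>ball z r. g y \<partial>\<nu>)" using K that i by auto
    also have "\<dots> \<le> (\<integral>\<^sup>+y. g y \<partial>\<nu>)" by (intro nn_integral_mono) (auto simp: indicator_def)
    finally have "ennreal (t * (c * r powr d)) \<le> ennreal G"
      using real \<open>0 < t\<close> c_pos by (simp add: ennreal_mult)
    then have "t * (c * r powr d) \<le> G" using real by simp
    then have "r powr d \<le> G / (t * c)" using \<open>0 < t\<close> c_pos by (simp add: field_simps)
    then have "(r powr d) powr (1 / d) \<le> (G / (t * c)) powr (1 / d)"
      using d_pos by (intro powr_mono2) auto
    then show ?thesis using r d_pos i by (simp add: powr_powr)
  qed
  obtain C where C: "countable C" "C \<subseteq> K"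
    "pairwise (\<lambda>i j. disjnt (ball (fst i) (snd i)) (ball (fst j) (snd j))) C"
    "{x. ennreal t < maximal g x} \<subseteq> (\<Union>i\<in>C. ball (fst i) (5 * snd i))"
  proof (rule Vitali_covering_lemma_balls[where S = "{x. ennreal t < maximal g x}" and K = K and a = fst and r = snd])
    show "{x. ennreal t < maximal g x} \<subseteq> (\<Union>i\<in>K. ball (fst i) (snd i))"
      by (auto simp: maximal_superlevel K_def)
  qed (use bound in auto)
  \<comment> \<open>\<open>C\<close> may be finite or infinite. Indexing by all naturals, with empty
    sets outside \<open>I\<close>, lets countable sums treat both cases; \<open>b n k\<close> is the
    \<open>k\<close>-fold dilate of the \<open>n\<close>-th ball.\<close>
  define I where "I = to_nat_on C ` C"
  define b where "b n k = (if n \<in> I then ball (fst (from_nat_into C n)) (k * snd (from_nat_into C n)) else {})" for n :: nat and k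
  have enum: "from_nat_into C n \<in> C" if "n \<in> I" for n
    using that C(1) by (auto simp: I_def)
  have disj: "disjoint_family (\<lambda>n. b n 1)"
  proof (unfold disjoint_family_on_def, intro ballI impI)
    fix m n :: nat assume "m \<noteq> n"
    show "b m 1 \<inter> b n 1 = {}"
    proof (cases "m \<in> I \<and> n \<in> I")
      case True
      then have "from_nat_into C m \<noteq> from_nat_into C n"
        using \<open>m \<noteq> n\<close> C(1) by (auto simp: I_def)
      then show ?thesis
        using pairwiseD[OF C(3) enum[of m] enum[of n]] True by (simp add: b_def disjnt_def)
    qed (auto simp: b_def)
  qed
  have b [measurable]: "b n k \<in> sets borel" for n k by (auto simp: b_def)
  have "{x. ennreal t < maximal g x} \<subseteq> (\<Union>n. b n 5)"
  proof
    fix x assume "x \<in> {x. ennreal t < maximal g x}"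
    then obtain i where "i \<in> C" "x \<in> ball (fst i) (5 * snd i)" using C(4) by auto
    then have "x \<in> b (to_nat_on C i) 5" using C(1) by (auto simp: b_def I_def)
    then show "x \<in> (\<Union>n. b n 5)" by blast
  qed
  then have "ennreal t * emeasure \<nu> {x. ennreal t < maximal g x} \<le> ennreal t * (\<Sum>n. emeasure \<nu> (b n 5))"
    by (intro mult_left_mono order_trans[OF emeasure_mono emeasure_subadditive_countably]) auto
  also have "\<dots> = (\<Sum>n. ennreal t * emeasure \<nu> (b n 5))" by simp
  also have "\<dots> \<le> (\<Sum>n. ennreal D * (\<integral>\<^sup>+x\<in>b n 1. g x \<partial>\<nu>))"
  proof (intro suminf_le summableI)
    fix n
    show "ennreal t * emeasure \<nu> (b n 5) \<le> ennreal D * (\<integral>\<^sup>+x\<in>b n 1. g x \<partial>\<nu>)"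
    proof (cases "n \<in> I")
      case True
      define z r where "z = fst (from_nat_into C n)" and "r = snd (from_nat_into C n)"
      have zr: "(z, r) \<in> K" using enum[OF True] C(2) by (auto simp: z_def r_def)
      have "ennreal t * emeasure \<nu> (ball z (5 * r)) \<le> ennreal t * (ennreal D * emeasure \<nu> (ball z r))"
        by (intro mult_left_mono doubling K(2)[OF zr]) auto
      also have "\<dots> = ennreal D * (ennreal t * emeasure \<nu> (ball z r))" by (simp add: ac_simps)
      also have "\<dots> \<le> ennreal D * (\<integral>\<^sup>+x\<in>ball z r. g x \<partial>\<nu>)"
        by (intro mult_left_mono K(1)[OF zr]) auto
      finally show ?thesis using True by (simp add: b_def z_def r_def)
    qed (simp add: b_def)
  qed
  also have "\<dots> = ennreal D * (\<integral>\<^sup>+x\<in>(\<Union>n. b n 1). g x \<partial>\<nu>)"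
    by (subst nn_integral_disjoint_family) (auto simp: disj)
  also have "\<dots> \<le> ennreal D * (\<integral>\<^sup>+x. g x \<partial>\<nu>)"
    by (intro mult_left_mono nn_integral_mono) (auto simp: indicator_def)
  finally show ?thesis .
qed

section \<open>From weak type to strong type\<close>

lemma average_add:
  assumes [measurable]: "g \<in> borel_measurable borel" "h \<in> borel_measurable borel"
  shows "average (\<lambda>x. g x + h x) z r = average g z r + average h z r"
proof -
  have "(\<integral>\<^sup>+y. g y * indicator (ball z r) y + h y * indicator (ball z r) y \<partial>\<nu>)
      = (\<integral>\<^sup>+y\<in>ball z r. g y \<partial>\<nu>) + (\<integral>\<^sup>+y\<in>ball z r. h y \<partial>\<nu>)"
    by (intro nn_integral_add; measurable)
  then show ?thesis
    unfolding average_def distrib_right by (simp add: add_divide_distrib_ennreal)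
qed

lemma average_mono: "(\<And>x. x \<in> ball z r \<Longrightarrow> g x \<le> h x) \<Longrightarrow> average g z r \<le> average h z r"
  unfolding average_def by (intro divide_right_mono_ennreal nn_integral_mono) (auto simp: indicator_def)

lemma average_const: "0 < r \<Longrightarrow> average (\<lambda>_. a) z r = a"
  using emeasure_ball_pos[of r z] emeasure_ball_finite[of z r]
  by (simp add: average_def nn_integral_cmult_indicator mult_divide_eq_ennreal)

lemma maximal_mono: "(\<And>x. g x \<le> h x) \<Longrightarrow> maximal g x \<le> maximal h x"
  by (intro maximal_le order_trans[OF average_mono average_le_maximal])

lemma maximal_add_le:
  assumes "g \<in> borel_measurable borel" "h \<in> borel_measurable borel"
  shows "maximal (\<lambda>x. g x + h x) x \<le> maximal g x + maximal h x"
  by (intro maximal_le) (auto simp: average_add[OF assms] intro!: add_mono average_le_maximal)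

lemma maximal_const_le: "maximal (\<lambda>_. a) x \<le> a"
  by (intro maximal_le) (simp add: average_const)

text \<open>Where \<open>g\<close> is at most t/2 it contributes at most t/2 to the maximal
  function, so only the part of \<open>g\<close> above t/2 can push it beyond \<open>t\<close>. The
  weak type bound for that part at level t/2 produces the factor 2.\<close>

lemma maximal_weak_type_truncated:
  assumes [measurable]: "g \<in> borel_measurable borel" and "0 < t"
  shows "ennreal t * emeasure \<nu> {x. ennreal t < maximal g x}
    \<le> ennreal (2 * D) * (\<integral>\<^sup>+x. g x * indicator {x. ennreal t < 2 * g x} x \<partial>\<nu>)"
proof -
  define h where "h x = g x * indicator {x. ennreal t < 2 * g x} x" for x
  have h [measurable]: "h \<in> borel_measurable borel" by (simp add: h_def [abs_def])
  have gh: "g x \<le> h x + ennreal (t / 2)" for x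
  proof (cases "ennreal t < 2 * g x")
    case False
    then have "2 * g x \<le> ennreal t" by simp
    then have "g x \<le> ennreal (t / 2)"
      using \<open>0 < t\<close> by (cases "g x") (auto simp: ennreal_mult_top top_unique ennreal_numeral[symmetric] ennreal_mult[symmetric] simp del: ennreal_numeral)
    then show ?thesis by (simp add: add_increasing)
  qed (simp add: h_def)
  have "maximal g x \<le> maximal h x + ennreal (t / 2)" for x
  proof -
    have "maximal g x \<le> maximal (\<lambda>x. h x + ennreal (t / 2)) x"
      by (rule maximal_mono) (rule gh)
    also have "\<dots> \<le> maximal h x + maximal (\<lambda>_. ennreal (t / 2)) x"
      by (rule maximal_add_le) auto
    also have "\<dots> \<le> maximal h x + ennreal (t / 2)"
      by (intro add_left_mono maximal_const_le)
    finally show ?thesis .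
  qed
  then have sub: "{x. ennreal t < maximal g x} \<subseteq> {x. ennreal (t / 2) < maximal h x}"
  proof safe
    fix x assume le: "\<And>x. maximal g x \<le> maximal h x + ennreal (t / 2)" and *: "ennreal t < maximal g x"
    show "ennreal (t / 2) < maximal h x"
    proof (rule ccontr)
      assume "\<not> ?thesis"
      then have "maximal h x + ennreal (t / 2) \<le> ennreal (t / 2) + ennreal (t / 2)"
        by (intro add_right_mono) simp
      also have "\<dots> = ennreal t" using \<open>0 < t\<close> by (simp add: ennreal_plus[symmetric] del: ennreal_plus)
      finally show False using le[of x] * by simp
    qed
  qed
  have "ennreal t * emeasure \<nu> {x. ennreal t < maximal g x}
      \<le> (2 * ennreal (t / 2)) * emeasure \<nu> {x. ennreal (t / 2) < maximal h x}"
  proof (intro mult_mono emeasure_mono sub)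
    show "ennreal t \<le> 2 * ennreal (t / 2)"
      using \<open>0 < t\<close> by (simp add: ennreal_numeral[symmetric] ennreal_mult[symmetric] del: ennreal_numeral)
    have "{x \<in> space borel. ennreal (t / 2) < maximal h x} \<in> sets borel" by measurable
    then show "{x. ennreal (t / 2) < maximal h x} \<in> sets \<nu>" by simp
  qed auto
  also have "\<dots> \<le> 2 * (ennreal D * (\<integral>\<^sup>+x. h x \<partial>\<nu>))"
    using maximal_weak_type[OF h, of "t / 2"] \<open>0 < t\<close> by (simp add: mult.assoc mult_left_mono)
  also have "\<dots> = ennreal (2 * D) * (\<integral>\<^sup>+x. h x \<partial>\<nu>)"
    using D_pos by (simp add: ennreal_mult mult.assoc)
  finally show ?thesis by (simp add: h_def)
qed

text \<open>Marcinkiewicz interpolation between weak type at exponent 1 and the trivial bound for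
  bounded functions, carried out by applying the layer-cake formula before and after the truncated
  weak type bound.\<close>

theorem maximal_strong_type:
  assumes "1 < p"
  obtains K where "0 < K" "\<And>g. g \<in> borel_measurable borel \<Longrightarrow>
    (\<integral>\<^sup>+x. epowr (maximal g x) p \<partial>\<nu>) \<le> ennreal K * (\<integral>\<^sup>+x. epowr (g x) p \<partial>\<nu>)"
proof
  \<comment> \<open>\<open>2 * D\<close> is the constant of the truncated weak type bound, p/(p - 1)
    renormalises the layer-cake density from exponent \<open>p\<close> to \<open>p - 1\<close>, and
    \<open>2 powr (p - 1)\<close> comes from the height \<open>2 * g x\<close>.\<close>
  define K where "K = 2 * D * (p / (p - 1)) * 2 powr (p - 1)"
  show "0 < K" using assms D_pos by (simp add: K_def)
  fix g :: "'a \<Rightarrow> ennreal" assume [measurable]: "g \<in> borel_measurable borel"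
  interpret pair_sigma_finite \<nu> lborel ..
  define P :: "real set" where "P = {0<..}"
  have [measurable]: "P \<in> sets borel" by (simp add: P_def)
  have "(\<integral>\<^sup>+x. epowr (maximal g x) p \<partial>\<nu>)
      = (\<integral>\<^sup>+x. \<integral>\<^sup>+t. ennreal (p * t powr (p - 1)) * (indicator P t * indicator {(t, x). ennreal t < maximal g x} (t, x)) \<partial>lborel \<partial>\<nu>)"
    using assms by (subst epowr_layer_cake) (auto intro!: nn_integral_cong simp: indicator_def P_def)
  also have "\<dots> = (\<integral>\<^sup>+t. \<integral>\<^sup>+x. ennreal (p * t powr (p - 1)) * (indicator P t * indicator {(t, x). ennreal t < maximal g x} (t, x)) \<partial>\<nu> \<partial>lborel)"
    by (rule Fubini'[symmetric]) (simp add: split_beta', measurable)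
  also have "\<dots> = (\<integral>\<^sup>+t. ennreal (p * t powr (p - 1)) * indicator P t * emeasure \<nu> {x. ennreal t < maximal g x} \<partial>lborel)"
  proof (rule nn_integral_cong)
    fix t :: real
    have "{x \<in> space borel. ennreal t < maximal g x} \<in> sets borel" by measurable
    then have "(\<integral>\<^sup>+x. indicator {x. ennreal t < maximal g x} x \<partial>\<nu>) = emeasure \<nu> {x. ennreal t < maximal g x}"
      by (intro nn_integral_indicator) simp
    moreover have "(\<lambda>x. indicator {(t, x). ennreal t < maximal g x} (t, x) :: ennreal) = indicator {x. ennreal t < maximal g x}"
      by (auto simp: indicator_def)
    ultimately show "(\<integral>\<^sup>+x. ennreal (p * t powr (p - 1)) * (indicator P t * indicator {(t, x). ennreal t < maximal g x} (t, x)) \<partial>\<nu>)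
      = ennreal (p * t powr (p - 1)) * indicator P t * emeasure \<nu> {x. ennreal t < maximal g x}"
      by (simp add: nn_integral_cmult mult.assoc)
  qed
  also have "\<dots> \<le> (\<integral>\<^sup>+t. ennreal (p * t powr (p - 2)) * indicator P t *
      (ennreal (2 * D) * (\<integral>\<^sup>+x. g x * indicator {x. ennreal t < 2 * g x} x \<partial>\<nu>)) \<partial>lborel)"
  proof (rule nn_integral_mono)
    fix t :: real
    show "ennreal (p * t powr (p - 1)) * indicator P t * emeasure \<nu> {x. ennreal t < maximal g x} \<le>
      ennreal (p * t powr (p - 2)) * indicator P t *
      (ennreal (2 * D) * (\<integral>\<^sup>+x. g x * indicator {x. ennreal t < 2 * g x} x \<partial>\<nu>))"
    proof (cases "t \<in> P")
      case True
      then have "0 < t" by (simp add: P_def)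
      \<comment> \<open>One factor \<open>t\<close> is split off for the weak type bound to
        absorb.\<close>
      then have "p * t powr (p - 1) = p * t powr (p - 2) * t"
        by (simp add: powr_diff power2_eq_square powr_numeral)
      then have "ennreal (p * t powr (p - 1)) = ennreal (p * t powr (p - 2)) * ennreal t"
        using \<open>0 < t\<close> assms by (simp add: ennreal_mult mult.assoc)
      then show ?thesis
        using True maximal_weak_type_truncated[of g t] \<open>0 < t\<close> by (simp add: mult.assoc mult_left_mono)
    qed simp
  qed
  also have "\<dots> = (\<integral>\<^sup>+t. \<integral>\<^sup>+x. ennreal (2 * D) * (ennreal (p * t powr (p - 2)) * (indicator P t *
      (g x * indicator {(t, x). ennreal t < 2 * g x} (t, x)))) \<partial>\<nu> \<partial>lborel)"
    by (intro nn_integral_cong) (simp add: nn_integral_cmult[symmetric] indicator_def ac_simps)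
  also have "\<dots> = (\<integral>\<^sup>+x. \<integral>\<^sup>+t. ennreal (2 * D) * (ennreal (p * t powr (p - 2)) * (indicator P t *
      (g x * indicator {(t, x). ennreal t < 2 * g x} (t, x)))) \<partial>lborel \<partial>\<nu>)"
    by (rule Fubini') (simp add: split_beta', measurable)
  also have "\<dots> = (\<integral>\<^sup>+x. ennreal K * epowr (g x) p \<partial>\<nu>)"
  proof (rule nn_integral_cong)
    \<comment> \<open>For fixed \<open>x\<close> the inner integral is again a layer-cake integral,
      now for exponent \<open>p - 1\<close> and height \<open>2 * g x\<close>; the remaining factor
      \<open>g x\<close> restores the exponent \<open>p\<close>.\<close>
    fix x
    have "(\<integral>\<^sup>+t. ennreal (2 * D) * (ennreal (p * t powr (p - 2)) * (indicator P t *
        (g x * indicator {(t, x). ennreal t < 2 * g x} (t, x)))) \<partial>lborel)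
      = (\<integral>\<^sup>+t. (ennreal (2 * D) * ennreal (p / (p - 1)) * g x) *
          (ennreal ((p - 1) * t powr (p - 1 - 1)) * indicator {t. 0 < t \<and> ennreal t < 2 * g x} t) \<partial>lborel)"
    proof (rule nn_integral_cong)
      fix t :: real
      have "ennreal (p * t powr (p - 2)) = ennreal (p / (p - 1)) * ennreal ((p - 1) * t powr (p - 1 - 1))"
        using assms by (subst ennreal_mult[symmetric]) auto
      then show "ennreal (2 * D) * (ennreal (p * t powr (p - 2)) * (indicator P t *
          (g x * indicator {(t, x). ennreal t < 2 * g x} (t, x))))
        = (ennreal (2 * D) * ennreal (p / (p - 1)) * g x) *
          (ennreal ((p - 1) * t powr (p - 1 - 1)) * indicator {t. 0 < t \<and> ennreal t < 2 * g x} t)"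
        by (auto simp: indicator_def P_def ac_simps)
    qed
    also have "\<dots> = (ennreal (2 * D) * ennreal (p / (p - 1)) * g x) * epowr (2 * g x) (p - 1)"
      using assms by (subst epowr_layer_cake[of "p - 1"]) (auto intro!: nn_integral_cmult)
    also have "epowr (2 * g x) (p - 1) = ennreal (2 powr (p - 1)) * epowr (g x) (p - 1)"
      using assms epowr_ennreal[of 2 "p - 1"] by (simp add: epowr_mult)
    also have "(ennreal (2 * D) * ennreal (p / (p - 1)) * g x) * (ennreal (2 powr (p - 1)) * epowr (g x) (p - 1))
      = (ennreal (2 * D) * ennreal (p / (p - 1)) * ennreal (2 powr (p - 1))) * (epowr (g x) 1 * epowr (g x) (p - 1))"
      by (simp add: ac_simps)
    also have "ennreal (2 * D) * ennreal (p / (p - 1)) * ennreal (2 powr (p - 1)) = ennreal K"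
      using assms D_pos by (simp add: K_def ennreal_mult'[symmetric])
    also have "epowr (g x) 1 * epowr (g x) (p - 1) = epowr (g x) p"
      by (simp add: epowr_add[symmetric] del: epowr_one)
    finally show "(\<integral>\<^sup>+t. ennreal (2 * D) * (ennreal (p * t powr (p - 2)) * (indicator P t *
        (g x * indicator {(t, x). ennreal t < 2 * g x} (t, x)))) \<partial>lborel) = ennreal K * epowr (g x) p" .
  qed
  also have "\<dots> = ennreal K * (\<integral>\<^sup>+x. epowr (g x) p \<partial>\<nu>)"
    by (simp add: nn_integral_cmult)
  finally show "(\<integral>\<^sup>+x. epowr (maximal g x) p \<partial>\<nu>) \<le> ennreal K * (\<integral>\<^sup>+x. epowr (g x) p \<partial>\<nu>)" .
qed

end

subsection \<open>Dyadic potentials\<close>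

text \<open>Radii below 1 contribute a geometric sum dominated by its last term, radii above 1 a
  decaying geometric series. What matters is that the bound depends neither on \<open>t\<close> nor
  on the number of terms.\<close>

lemma sum_min_dyadic_le:
  fixes \<eta> :: real
  assumes "1 < \<eta>"
  obtains C where "0 < C"
    "\<And>t K. 0 < t \<Longrightarrow> (\<Sum>k<K. min (t * 2 ^ k) ((t * 2 ^ k) powr (1 - \<eta>))) \<le> C"
proof -
  define \<theta> :: real where "\<theta> = 2 powr (1 - \<eta>)"
  have \<theta>: "0 < \<theta>" "\<theta> < 1" using assms by (auto simp: \<theta>_def powr_less_one)
  define A where "A = 1 / (1 - \<theta>)"
  have "0 < A" using \<theta> by (simp add: A_def)
  let ?S = "\<lambda>t K. \<Sum>k<K. min (t * 2 ^ k) ((t * 2 ^ k) powr (1 - \<eta>))"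
  have large: "?S t K \<le> A" if "1 \<le> t" for t K
  proof -
    have "?S t K \<le> (\<Sum>k<K. \<theta> ^ k)"
    proof (rule sum_mono)
      fix k
      have "(t * 2 ^ k) powr (1 - \<eta>) \<le> (2 ^ k) powr (1 - \<eta>)"
        using that assms by (intro powr_mono2') auto
      also have "\<dots> = \<theta> ^ k"
        unfolding \<theta>_def by (simp add: powr_power powr_realpow[symmetric] powr_powr mult.commute)
      finally show "min (t * 2 ^ k) ((t * 2 ^ k) powr (1 - \<eta>)) \<le> \<theta> ^ k" by simp
    qed
    also have "\<dots> \<le> (\<Sum>k. \<theta> ^ k)"
      using \<theta> by (intro sum_le_suminf summable_geometric) auto
    also have "\<dots> = A" using \<theta> by (simp add: A_def suminf_geometric)
    finally show ?thesis .
  qed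
  \<comment> \<open>The correction \<open>- t\<close> makes the induction close: peeling off the
    first term costs at most \<open>t\<close> and replaces \<open>t\<close> by \<open>2 * t\<close>.
    The range up to 2 keeps the doubled value admissible as long as t < 1; beyond that the bound
    \<open>large\<close> takes over.\<close>
  have small: "?S t K \<le> A + 2 - t" if "0 < t" "t < 2" for t K
    using that
  proof (induction K arbitrary: t)
    case 0
    then show ?case using \<open>0 < A\<close> by simp
  next
    case (Suc K)
    show ?case
    proof (cases "t < 1")
      case True
      have "?S t (Suc K) = min t (t powr (1 - \<eta>)) + ?S (2 * t) K"
        by (simp add: sum.lessThan_Suc_shift ac_simps del: sum.lessThan_Suc)
      also have "\<dots> \<le> t + (A + 2 - 2 * t)"
        using Suc.prems True by (intro add_mono Suc.IH) auto
      finally show ?thesis by simp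
    next
      case False
      then show ?thesis using large[of t "Suc K"] Suc.prems by linarith
    qed
  qed
  show ?thesis
  proof
    show "0 < A + 2" using \<open>0 < A\<close> by simp
    fix t :: real and K assume "0 < t"
    then show "?S t K \<le> A + 2"
      using small[of t K] large[of t K] by (cases "t < 1") auto
  qed
qed

text \<open>Scaling reduces to the previous sum with coefficients 1. If \<open>M\<close> or
  \<open>N\<close> vanishes, every term vanishes; if neither does and one is infinite, the right
  side is infinite.\<close>

lemma suminf_min_dyadic_le:
  fixes \<eta> :: real
  assumes "1 < \<eta>"
  obtains C where "0 < C"
    "\<And>t M N. 0 < t \<Longrightarrow> (\<Sum>k. min (ennreal (t * 2 ^ k) * M) (ennreal ((t * 2 ^ k) powr (1 - \<eta>)) * N))
      \<le> ennreal C * epowr M (1 - 1 / \<eta>) * epowr N (1 / \<eta>)"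
proof -
  obtain C where C: "0 < C"
    "\<And>t K. 0 < t \<Longrightarrow> (\<Sum>k<K. min (t * 2 ^ k) ((t * 2 ^ k) powr (1 - \<eta>))) \<le> C"
    by (rule sum_min_dyadic_le[OF assms]) blast
  show ?thesis
  proof (rule that[OF C(1)])
    fix t :: real and M N :: ennreal assume "0 < t"
    consider "M = 0 \<or> N = 0" | "M \<noteq> 0" "N \<noteq> 0" "M = top \<or> N = top"
      | "M \<noteq> 0" "N \<noteq> 0" "M \<noteq> top" "N \<noteq> top" by blast
    then show "(\<Sum>k. min (ennreal (t * 2 ^ k) * M) (ennreal ((t * 2 ^ k) powr (1 - \<eta>)) * N))
      \<le> ennreal C * epowr M (1 - 1 / \<eta>) * epowr N (1 / \<eta>)"
    proof cases
      case 1
      then show ?thesis by auto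
    next
      case 2
      then have "ennreal C * epowr M (1 - 1 / \<eta>) * epowr N (1 / \<eta>) = top"
        using C(1) by (auto simp: ennreal_mult_eq_top_iff)
      then show ?thesis by simp
    next
      case 3
      then obtain m n where mn: "M = ennreal m" "0 < m" "N = ennreal n" "0 < n"
        by (cases M; cases N) auto
      \<comment> \<open>The radius at which the two competing bounds coincide. Measured in units of
        \<tau>, both carry the common factor \<open>m * \<tau>\<close>, which is the geometric mean
        claimed.\<close>
      define \<tau> where "\<tau> = (n / m) powr (1 / \<eta>)"
      have "0 < \<tau>" using mn by (simp add: \<tau>_def)
      have n: "n = m * \<tau> powr \<eta>"
        using mn assms by (simp add: \<tau>_def powr_powr)
      have "min (ennreal (t * 2 ^ k) * M) (ennreal ((t * 2 ^ k) powr (1 - \<eta>)) * N)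
          = ennreal (m * \<tau> * min (t / \<tau> * 2 ^ k) ((t / \<tau> * 2 ^ k) powr (1 - \<eta>)))" for k
      proof -
        have "(t * 2 ^ k) powr (1 - \<eta>) * n = m * \<tau> * (t / \<tau> * 2 ^ k) powr (1 - \<eta>)"
        proof -
          have "(t * 2 ^ k) powr (1 - \<eta>) = ((t / \<tau> * 2 ^ k) * \<tau>) powr (1 - \<eta>)"
            using \<open>0 < \<tau>\<close> by simp
          also have "\<dots> = (t / \<tau> * 2 ^ k) powr (1 - \<eta>) * \<tau> powr (1 - \<eta>)"
            using \<open>0 < \<tau>\<close> \<open>0 < t\<close> by (subst powr_mult) auto
          also have "\<tau> powr (1 - \<eta>) = \<tau> / \<tau> powr \<eta>"
            using \<open>0 < \<tau>\<close> by (simp add: powr_diff)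
          finally show ?thesis using \<open>0 < \<tau>\<close> by (simp add: n)
        qed
        moreover have "t * 2 ^ k * m = m * \<tau> * (t / \<tau> * 2 ^ k)"
          using \<open>0 < \<tau>\<close> by simp
        moreover have "min (m * \<tau> * u) (m * \<tau> * v) = m * \<tau> * min u v" for u v
          using mn \<open>0 < \<tau>\<close> by (simp add: min_mult_distrib_left)
        ultimately have "min (t * 2 ^ k * m) ((t * 2 ^ k) powr (1 - \<eta>) * n)
          = m * \<tau> * min (t / \<tau> * 2 ^ k) ((t / \<tau> * 2 ^ k) powr (1 - \<eta>))"
          by (simp only:)
        moreover have "min (ennreal (t * 2 ^ k) * M) (ennreal ((t * 2 ^ k) powr (1 - \<eta>)) * N)
           = ennreal (min (t * 2 ^ k * m) ((t * 2 ^ k) powr (1 - \<eta>) * n))"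
          using mn \<open>0 < t\<close> by (auto simp add: ennreal_mult[symmetric] min_def)
        ultimately show ?thesis by simp
      qed
      then have "(\<Sum>k. min (ennreal (t * 2 ^ k) * M) (ennreal ((t * 2 ^ k) powr (1 - \<eta>)) * N))
        = (SUP K. \<Sum>k<K. ennreal (m * \<tau> * min (t / \<tau> * 2 ^ k) ((t / \<tau> * 2 ^ k) powr (1 - \<eta>))))"
        by (simp add: suminf_eq_SUP)
      also have "\<dots> \<le> ennreal (m * \<tau> * C)"
      proof (rule SUP_least)
        fix K
        have "(\<Sum>k<K. m * \<tau> * min (t / \<tau> * 2 ^ k) ((t / \<tau> * 2 ^ k) powr (1 - \<eta>))) \<le> m * \<tau> * C"
          unfolding sum_distrib_left[symmetric]
          using mn \<open>0 < \<tau>\<close> \<open>0 < t\<close> by (intro mult_left_mono C(2)) auto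
        moreover have "0 \<le> m * \<tau> * min (t / \<tau> * 2 ^ k) ((t / \<tau> * 2 ^ k) powr (1 - \<eta>))" for k
          using mn \<open>0 < \<tau>\<close> \<open>0 < t\<close> by simp
        ultimately show "(\<Sum>k<K. ennreal (m * \<tau> * min (t / \<tau> * 2 ^ k) ((t / \<tau> * 2 ^ k) powr (1 - \<eta>)))) \<le> ennreal (m * \<tau> * C)"
          by (subst sum_ennreal) (auto intro: ennreal_leI)
      qed
      also have "m * \<tau> = m powr (1 - 1 / \<eta>) * n powr (1 / \<eta>)"
        using mn by (simp add: \<tau>_def powr_divide powr_diff)
      finally show ?thesis
        using mn C(1) by (simp add: ennreal_mult ac_simps)
    qed
  qed
qed

lemma divide_le_of_le_mult_ennreal:
  fixes x y z :: ennreal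
  assumes "x \<le> z * y" "y \<noteq> 0" "y \<noteq> top"
  shows "x / y \<le> z"
  using divide_right_mono_ennreal[OF assms(1), of y] assms(2,3) by (simp add: mult_divide_eq_ennreal)

lemma le_mult_of_divide_le_ennreal:
  fixes x y z :: ennreal
  assumes "x / y \<le> z" "y \<noteq> 0" "y \<noteq> top"
  shows "x \<le> z * y"
  using mult_right_mono[OF assms(1), of y] assms(2,3)
  by (simp add: ennreal_divide_times ennreal_times_divide mult_divide_eq_ennreal)

section \<open>Morrey norms and Hedberg's pointwise bound\<close>

context doubling_measure
begin

text \<open>The counterpart of \<open>morrey_norm\<close> for an arbitrary doubling measure, since
  the estimates below are needed both for the weighted measure and for Lebesgue measure.\<close>

definition morrey :: "real \<Rightarrow> real \<Rightarrow> ('a \<Rightarrow> ennreal) \<Rightarrow> ennreal" where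
  "morrey p q g = (SUP x. SUP r\<in>{0<..}.
     epowr ((\<integral>\<^sup>+y\<in>ball x r. epowr (g y) p \<partial>\<nu>) / epowr (emeasure \<nu> (ball x r)) (1 - p / q)) (1 / p))"

text \<open>Balls have positive finite measure, so quotient and root can be cleared. This form is
  the one in which Morrey bounds are proved and used.\<close>

lemma morrey_le_iff:
  assumes "0 < p"
  shows "morrey p q g \<le> N \<longleftrightarrow>
    (\<forall>x. \<forall>r>0. (\<integral>\<^sup>+y\<in>ball x r. epowr (g y) p \<partial>\<nu>) \<le> epowr N p * epowr (emeasure \<nu> (ball x r)) (1 - p / q))"
proof -
  have "epowr (I / epowr (emeasure \<nu> (ball x r)) e) (1 / p) \<le> N
    \<longleftrightarrow> I \<le> epowr N p * epowr (emeasure \<nu> (ball x r)) e" if "0 < r" for x :: 'a and r I e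
  proof -
    have fin: "epowr (emeasure \<nu> (ball x r)) e \<noteq> 0" "epowr (emeasure \<nu> (ball x r)) e \<noteq> top"
      using emeasure_ball_pos[OF that, of x] emeasure_ball_finite[of x r] by auto
    have "epowr X (1 / p) \<le> N \<longleftrightarrow> X \<le> epowr N p" for X
      using epowr_mono[of p "epowr X (1 / p)" N] epowr_mono[of "1 / p" X "epowr N p"] assms
      by (auto simp: epowr_epowr)
    then show ?thesis
      using divide_le_of_le_mult_ennreal le_mult_of_divide_le_ennreal fin by blast
  qed
  then show ?thesis unfolding morrey_def SUP_le_iff by auto
qed

lemma morreyD:
  assumes "0 < p" "0 < r"
  shows "(\<integral>\<^sup>+y\<in>ball x r. epowr (g y) p \<partial>\<nu>) \<le> epowr (morrey p q g) p * epowr (emeasure \<nu> (ball x r)) (1 - p / q)"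
  using morrey_le_iff[of p q g "morrey p q g"] assms by blast

text \<open>After dividing by the measure \<open>m\<close> of the ball, the power -1/q of
  \<open>m\<close> is left over; the exponent being negative, the lower bound on \<open>m\<close>
  becomes an upper bound.\<close>

lemma average_powr_le_morrey:
  assumes "0 < p" "0 < q" "0 < r"
  shows "epowr (average (\<lambda>y. epowr (g y) p) x r) (1 / p) \<le> ennreal ((c * r powr d) powr (- 1 / q)) * morrey p q g"
proof -
  obtain m where m: "emeasure \<nu> (ball x r) = ennreal m" "0 < m"
    using emeasure_ball_cases[OF assms(3)] .
  have "average (\<lambda>y. epowr (g y) p) x r
      \<le> epowr (morrey p q g) p * epowr (ennreal m) (1 - p / q) / ennreal m"
    unfolding average_def m(1)[symmetric]
    by (intro divide_right_mono_ennreal morreyD assms)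
  also have "\<dots> = epowr (morrey p q g) p * (epowr (ennreal m) (1 - p / q) / ennreal m)"
    by (simp only: ennreal_times_divide)
  also have "epowr (ennreal m) (1 - p / q) / ennreal m = ennreal (m powr (- p / q))"
    using m by (simp add: divide_ennreal powr_diff powr_minus divide_inverse)
  finally have "epowr (average (\<lambda>y. epowr (g y) p) x r) (1 / p)
      \<le> epowr (epowr (morrey p q g) p * ennreal (m powr (- p / q))) (1 / p)"
    using assms by (intro epowr_mono) auto
  also have "\<dots> = morrey p q g * ennreal (m powr (- 1 / q))"
    using assms by (simp add: epowr_mult epowr_epowr powr_powr)
  also have "\<dots> \<le> morrey p q g * ennreal ((c * r powr d) powr (- 1 / q))"
  proof (intro mult_left_mono ennreal_leI powr_mono2')
    have "ennreal (c * r powr d) \<le> ennreal m"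
      using lower_regular[OF assms(3), of x] m by simp
    then show "c * r powr d \<le> m" using m(2) by simp
  qed (use assms c_pos in auto)
  finally show ?thesis by (simp add: mult.commute)
qed

text \<open>The exponents are the interpolation weights of the dyadic sum with decay rate d/q. The
  function is Borel in \<open>x\<close> whatever \<open>g\<close> is, because \<open>maximal\<close>
  is.\<close>

definition majorant :: "real \<Rightarrow> real \<Rightarrow> ('a \<Rightarrow> ennreal) \<Rightarrow> 'a \<Rightarrow> ennreal" where
  "majorant p q g x = epowr (maximal (\<lambda>y. epowr (g y) p) x) ((1 - q / d) / p) * epowr (morrey p q g) (q / d)"

lemma dyadic_potential_le:
  assumes "0 < p" "0 < q" "q < d"
  obtains C where "0 < C"
    "\<And>g x t. 0 < t \<Longrightarrow> (\<Sum>k. ennreal (t * 2 ^ k) * epowr (average (\<lambda>y. epowr (g y) p) x (t * 2 ^ k)) (1 / p))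
      \<le> ennreal C * majorant p q g x"
proof -
  \<comment> \<open>The Morrey bound multiplied by the radius r behaves like r to the power 1 - d/q,
    which decays because q < d.\<close>
  have "1 < d / q" using assms by simp
  then obtain C where C: "0 < C"
    "\<And>t M N. 0 < t \<Longrightarrow> (\<Sum>k. min (ennreal (t * 2 ^ k) * M) (ennreal ((t * 2 ^ k) powr (1 - d / q)) * N))
      \<le> ennreal C * epowr M (1 - 1 / (d / q)) * epowr N (1 / (d / q))"
    by (rule suminf_min_dyadic_le) blast
  \<comment> \<open>The part of the Morrey bound that stems from the lower regularity constant:
    \<open>(c * r powr d) powr (- 1 / q)\<close> equals \<open>a * r powr (- d / q)\<close>.\<close>
  define a where "a = c powr (- 1 / q)"
  have "0 < a" using c_pos by (simp add: a_def)
  show ?thesis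
  proof (rule that)
    show "0 < C * a powr (q / d)" using C(1) \<open>0 < a\<close> by simp
    fix g :: "'a \<Rightarrow> ennreal" and x :: 'a and t :: real assume t: "0 < t"
    define M where "M = epowr (maximal (\<lambda>y. epowr (g y) p) x) (1 / p)"
    define N where "N = ennreal a * morrey p q g"
    have "(\<Sum>k. ennreal (t * 2 ^ k) * epowr (average (\<lambda>y. epowr (g y) p) x (t * 2 ^ k)) (1 / p))
      \<le> (\<Sum>k. min (ennreal (t * 2 ^ k) * M) (ennreal ((t * 2 ^ k) powr (1 - d / q)) * N))"
    proof (intro suminf_le summableI min.boundedI)
      fix k
      define r where "r = t * 2 ^ k"
      have r: "0 < r" using t by (simp add: r_def)
      show "ennreal (t * 2 ^ k) * epowr (average (\<lambda>y. epowr (g y) p) x (t * 2 ^ k)) (1 / p) \<le> ennreal (t * 2 ^ k) * M"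
        unfolding M_def r_def[symmetric] using assms r
        by (intro mult_left_mono epowr_mono average_le_maximal) auto
      have "ennreal r * epowr (average (\<lambda>y. epowr (g y) p) x r) (1 / p)
          \<le> ennreal r * (ennreal ((c * r powr d) powr (- 1 / q)) * morrey p q g)"
        using assms r by (intro mult_left_mono average_powr_le_morrey) auto
      also have "\<dots> = ennreal (r * (c * r powr d) powr (- 1 / q)) * morrey p q g"
        using r by (simp add: ennreal_mult mult.assoc)
      also have "r * (c * r powr d) powr (- 1 / q) = r powr (1 - d / q) * a"
        using r c_pos by (simp add: powr_mult powr_powr powr_diff a_def powr_minus divide_inverse)
      finally show "ennreal (t * 2 ^ k) * epowr (average (\<lambda>y. epowr (g y) p) x (t * 2 ^ k)) (1 / p)
        \<le> ennreal ((t * 2 ^ k) powr (1 - d / q)) * N"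
        using r \<open>0 < a\<close> by (simp add: r_def[symmetric] N_def ennreal_mult mult.assoc)
    qed
    also have "\<dots> \<le> ennreal C * epowr M (1 - 1 / (d / q)) * epowr N (1 / (d / q))"
      by (rule C(2)[OF t])
    also have "\<dots> = ennreal (C * a powr (q / d)) * majorant p q g x"
      using assms \<open>0 < a\<close> C(1) by (simp add: majorant_def M_def N_def epowr_epowr epowr_mult ennreal_mult ac_simps)
    finally show "(\<Sum>k. ennreal (t * 2 ^ k) * epowr (average (\<lambda>y. epowr (g y) p) x (t * 2 ^ k)) (1 / p))
      \<le> ennreal (C * a powr (q / d)) * majorant p q g x" .
  qed
qed

text \<open>Hoelder on each ball. It makes the Morrey factor disappear in the first item of the
  theorem and in the Hardy--Littlewood--Sobolev inequality.\<close>

lemma morrey_le_Lp: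
  assumes "0 < p" "p < q" and [measurable]: "g \<in> borel_measurable borel"
  shows "morrey p q g \<le> epowr (\<integral>\<^sup>+y. epowr (g y) q \<partial>\<nu>) (1 / q)"
  unfolding morrey_le_iff[OF assms(1)]
proof (intro allI impI)
  fix x :: 'a and r :: real assume "0 < r"
  have "(\<integral>\<^sup>+y\<in>ball x r. epowr (g y) p \<partial>\<nu>) = (\<integral>\<^sup>+y. epowr (g y) p \<partial>restrict_space \<nu> (ball x r))"
    by (subst nn_integral_restrict_space) auto
  also have "\<dots> \<le> epowr (\<integral>\<^sup>+y. epowr (g y) q \<partial>restrict_space \<nu> (ball x r)) (p / q) *
      epowr (emeasure (restrict_space \<nu> (ball x r)) (space (restrict_space \<nu> (ball x r)))) (1 - p / q)"
    using assms by (intro nn_integral_holder_finite) (auto intro!: measurable_restrict_space1)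
  also have "\<dots> \<le> epowr (\<integral>\<^sup>+y. epowr (g y) q \<partial>\<nu>) (p / q) * epowr (emeasure \<nu> (ball x r)) (1 - p / q)"
    using assms
    by (intro mult_mono epowr_mono)
      (auto simp: nn_integral_restrict_space space_restrict_space emeasure_restrict_space indicator_def intro!: nn_integral_mono)
  finally show "(\<integral>\<^sup>+y\<in>ball x r. epowr (g y) p \<partial>\<nu>)
    \<le> epowr (epowr (\<integral>\<^sup>+y. epowr (g y) q \<partial>\<nu>) (1 / q)) p * epowr (emeasure \<nu> (ball x r)) (1 - p / q)"
    by (simp add: epowr_epowr)
qed

text \<open>The \<open>r\<close>-th power of the majorant contains the maximal function of
  \<open>g\<close> to the \<open>p\<close> raised to r (1 - q/d) / p. The hypothesis that this
  exponent exceeds 1 is what the strong type theorem requires. \<open>F\<close> may be any function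
  below the majorant, measurable or not.\<close>

lemma Lp_bound_of_maximal_bound:
  assumes "0 < p" "0 < q" "q < d" "1 < r / p * (1 - q / d)" "0 < A" "0 < r"
  obtains C where "0 < C"
    "\<And>g F. g \<in> borel_measurable borel \<Longrightarrow>
      (\<And>x. F x \<le> ennreal A * majorant p q g x) \<Longrightarrow>
      epowr (\<integral>\<^sup>+x. epowr (F x) r \<partial>\<nu>) (1 / r)
      \<le> ennreal C * epowr (epowr (\<integral>\<^sup>+x. epowr (g x) (r * (1 - q / d)) \<partial>\<nu>) (1 / (r * (1 - q / d)))) (1 - q / d)
        * epowr (morrey p q g) (q / d)"
proof -
  define \<theta> where "\<theta> = 1 - q / d"
  have \<theta>: "0 < \<theta>" using assms by (simp add: \<theta>_def)
  have "1 < r * \<theta> / p" using assms by (simp add: \<theta>_def)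
  then obtain K where K: "0 < K" "\<And>g. g \<in> borel_measurable borel \<Longrightarrow>
    (\<integral>\<^sup>+x. epowr (maximal g x) (r * \<theta> / p) \<partial>\<nu>) \<le> ennreal K * (\<integral>\<^sup>+x. epowr (g x) (r * \<theta> / p) \<partial>\<nu>)"
    by (rule maximal_strong_type) blast
  show ?thesis
  proof (rule that)
    show "0 < A * K powr (1 / r)" using assms K(1) by simp
    fix g :: "'a \<Rightarrow> ennreal" and F assume [measurable]: "g \<in> borel_measurable borel"
      and F: "\<And>x. F x \<le> ennreal A * majorant p q g x"
    define N where "N = epowr (morrey p q g) (q / d)"
    have "(\<integral>\<^sup>+x. epowr (F x) r \<partial>\<nu>)
      \<le> (\<integral>\<^sup>+x. epowr (ennreal A * epowr (maximal (\<lambda>y. epowr (g y) p) x) (\<theta> / p) * N) r \<partial>\<nu>)"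
      using F assms by (intro nn_integral_mono epowr_mono) (auto simp: majorant_def \<theta>_def N_def mult.assoc)
    also have "\<dots> = (\<integral>\<^sup>+x. (epowr (ennreal A) r * epowr N r) * epowr (maximal (\<lambda>y. epowr (g y) p) x) (r * \<theta> / p) \<partial>\<nu>)"
      using assms by (intro nn_integral_cong) (simp add: epowr_mult epowr_epowr ac_simps)
    also have "\<dots> = (epowr (ennreal A) r * epowr N r) * (\<integral>\<^sup>+x. epowr (maximal (\<lambda>y. epowr (g y) p) x) (r * \<theta> / p) \<partial>\<nu>)"
      by (rule nn_integral_cmult) measurable
    also have "\<dots> \<le> (epowr (ennreal A) r * epowr N r) * (ennreal K * (\<integral>\<^sup>+x. epowr (epowr (g x) p) (r * \<theta> / p) \<partial>\<nu>))"
      by (intro mult_left_mono K) auto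
    finally have "epowr (\<integral>\<^sup>+x. epowr (F x) r \<partial>\<nu>) (1 / r)
      \<le> epowr ((epowr (ennreal A) r * epowr N r) * (ennreal K * (\<integral>\<^sup>+x. epowr (g x) (r * \<theta>) \<partial>\<nu>))) (1 / r)"
      using assms by (intro epowr_mono) (auto simp: epowr_epowr)
    also have "\<dots> = ennreal (A * K powr (1 / r)) * epowr (epowr (\<integral>\<^sup>+x. epowr (g x) (r * \<theta>) \<partial>\<nu>) (1 / (r * \<theta>))) \<theta> * N"
      using assms K(1) \<theta> by (simp add: epowr_mult epowr_epowr ennreal_mult powr_powr ac_simps)
    finally show "epowr (\<integral>\<^sup>+x. epowr (F x) r \<partial>\<nu>) (1 / r)
      \<le> ennreal (A * K powr (1 / r)) * epowr (epowr (\<integral>\<^sup>+x. epowr (g x) (r * (1 - q / d)) \<partial>\<nu>) (1 / (r * (1 - q / d)))) (1 - q / d)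
        * epowr (morrey p q g) (q / d)"
      by (simp add: \<theta>_def N_def)
  qed
qed

text \<open>Far from \<open>ball x (5 r)\<close> the maximal function is nearly constant on \<open>ball x r\<close>, because every
  ball that meets both has radius at least \<open>r\<close> and its fivefold dilate contains \<open>ball x r\<close>.\<close>

lemma maximal_morrey_bound:
  assumes "1 < p" "p \<le> q"
  obtains K where "0 < K" "\<And>h W x r. h \<in> borel_measurable borel \<Longrightarrow>
    (\<And>x r. 0 < r \<Longrightarrow> (\<integral>\<^sup>+y\<in>ball x r. epowr (h y) p \<partial>\<nu>) \<le> W * epowr (emeasure \<nu> (ball x r)) (1 - p / q)) \<Longrightarrow> 0 < r \<Longrightarrow>
    (\<integral>\<^sup>+y\<in>ball x r. epowr (maximal h y) p \<partial>\<nu>) \<le> ennreal K * W * epowr (emeasure \<nu> (ball x r)) (1 - p / q)"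
proof -
  obtain K where K: "0 < K" "\<And>g. g \<in> borel_measurable borel \<Longrightarrow>
    (\<integral>\<^sup>+x. epowr (maximal g x) p \<partial>\<nu>) \<le> ennreal K * (\<integral>\<^sup>+x. epowr (g x) p \<partial>\<nu>)"
    by (rule maximal_strong_type[OF assms(1)]) blast
  define e where "e = 1 - p / q"
  have e: "0 \<le> e" "e < 1" using assms by (auto simp: e_def)
  have "0 < q" using assms by simp
  show ?thesis
  proof (rule that)
    show "0 < 2 powr p * (K * D powr e + D powr (1 - e))" using K(1) D_pos by (intro mult_pos_pos add_pos_pos) auto
    fix h W and x :: 'a and r :: real assume h [measurable]: "h \<in> borel_measurable borel"
      and W: "\<And>x r. 0 < r \<Longrightarrow> (\<integral>\<^sup>+y\<in>ball x r. epowr (h y) p \<partial>\<nu>) \<le> W * epowr (emeasure \<nu> (ball x r)) (1 - p / q)"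
      and r: "0 < r"
    obtain m where m: "emeasure \<nu> (ball x r) = ennreal m" "0 < m"
      using emeasure_ball_cases[OF r] .
    define h1 where "h1 y = h y * indicator (ball x (5 * r)) y" for y
    define h2 where "h2 y = h y * indicator (- ball x (5 * r)) y" for y
    have h1 [measurable]: "h1 \<in> borel_measurable borel" and h2 [measurable]: "h2 \<in> borel_measurable borel"
      unfolding h1_def h2_def by measurable
    \<comment> \<open>The bound for far averages: a ball of measure \<open>n\<close> gives W times n
      to the power e - 1, and a relevant one has n at least m / D.\<close>
    define L where "L = W * ennreal (D powr (1 - e)) * ennreal (m powr (e - 1))"
    have far: "epowr (maximal h2 y) p \<le> L" if y: "y \<in> ball x r" for y
    proof -
      have "maximal h2 y \<le> epowr L (1 / p)"
      proof (rule maximal_le)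
        fix z \<rho> assume \<rho>: "0 < \<rho>" "y \<in> ball z \<rho>"
        obtain n where n: "emeasure \<nu> (ball z \<rho>) = ennreal n" "0 < n"
          using emeasure_ball_cases[OF \<rho>(1)] .
        show "average h2 z \<rho> \<le> epowr L (1 / p)"
        proof (cases "ball z \<rho> \<subseteq> ball x (5 * r)")
          case True
          then have "(\<integral>\<^sup>+y\<in>ball z \<rho>. h2 y \<partial>\<nu>) = (\<integral>\<^sup>+y. 0 \<partial>\<nu>)"
            by (intro nn_integral_cong) (auto simp: h2_def indicator_def)
          then show ?thesis by (simp add: average_def)
        next
          case False
          then obtain u where "u \<in> ball z \<rho>" "u \<notin> ball x (5 * r)" by blast
          then have u: "dist z u < \<rho>" "5 * r \<le> dist x u" by auto
          have "dist x u \<le> dist x y + dist z y + dist z u"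
            by (metis add.commute add_left_mono dist_commute dist_triangle dist_triangle2 order_trans)
          \<comment> \<open>The points \<open>y\<close> and \<open>u\<close> lie in the same ball of
            radius \<rho> but are more than 4 r apart, so its diameter forces \<rho> > 2 r.\<close>
          then have "r < \<rho>" using u \<rho> y by auto
          have "ball x r \<subseteq> ball z (5 * \<rho>)"
          proof
            fix v assume v: "v \<in> ball x r"
            have "dist z v \<le> dist z y + dist x y + dist x v"
              by (metis add.commute add_left_mono dist_commute dist_triangle dist_triangle2 order_trans)
            then show "v \<in> ball z (5 * \<rho>)" using v \<rho> y \<open>r < \<rho>\<close> by auto
          qed
          then have "ennreal m \<le> emeasure \<nu> (ball z (5 * \<rho>))"
            unfolding m(1)[symmetric] by (intro emeasure_mono) auto
          also have "\<dots> \<le> ennreal (D * n)"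
            using doubling[OF \<rho>(1), of z] n D_pos by (simp add: ennreal_mult)
          finally have mn: "m \<le> D * n" using n D_pos by simp
          have "(\<integral>\<^sup>+y\<in>ball z \<rho>. h2 y \<partial>\<nu>) \<le> (\<integral>\<^sup>+y\<in>ball z \<rho>. epowr (h y) 1 \<partial>\<nu>)"
            by (intro nn_integral_mono) (auto simp: h2_def indicator_def)
          also have "\<dots> = (\<integral>\<^sup>+y. epowr (h y) 1 \<partial>restrict_space \<nu> (ball z \<rho>))"
            by (subst nn_integral_restrict_space) auto
          also have "\<dots> \<le> epowr (\<integral>\<^sup>+y. epowr (h y) p \<partial>restrict_space \<nu> (ball z \<rho>)) (1 / p) *
              epowr (emeasure (restrict_space \<nu> (ball z \<rho>)) (space (restrict_space \<nu> (ball z \<rho>)))) (1 - 1 / p)"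
            using assms by (intro nn_integral_holder_finite) (auto intro!: measurable_restrict_space1)
          also have "\<dots> = epowr (\<integral>\<^sup>+y\<in>ball z \<rho>. epowr (h y) p \<partial>\<nu>) (1 / p) * epowr (ennreal n) (1 - 1 / p)"
            by (simp add: nn_integral_restrict_space space_restrict_space emeasure_restrict_space n)
          also have "\<dots> \<le> epowr (W * epowr (ennreal n) e) (1 / p) * epowr (ennreal n) (1 - 1 / p)"
            using assms W[OF \<rho>(1), of z] n by (intro mult_right_mono epowr_mono) (auto simp: e_def)
          finally have "average h2 z \<rho> \<le> epowr (W * epowr (ennreal n) e) (1 / p) * epowr (ennreal n) (1 - 1 / p) / ennreal n"
            unfolding average_def n(1) by (rule divide_right_mono_ennreal)
          also have "\<dots> = epowr (W * ennreal (n powr (e - 1))) (1 / p)"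
          proof -
            have "epowr (ennreal n) (e / p) * epowr (ennreal n) (1 - 1 / p) / ennreal n
                = ennreal (n powr (e / p) * n powr (1 - 1 / p) / n)"
              using n by (simp add: ennreal_mult[symmetric] divide_ennreal)
            also have "n powr (e / p) * n powr (1 - 1 / p) / n = n powr ((e - 1) / p)"
              using n by (simp add: powr_diff diff_divide_distrib)
            finally have "epowr (ennreal n) (e / p) * epowr (ennreal n) (1 - 1 / p) / ennreal n
                = epowr (ennreal n) ((e - 1) / p)"
              using n by simp
            then show ?thesis
              using assms n by (simp add: epowr_mult epowr_epowr powr_powr ennreal_times_divide[symmetric] mult.assoc)
          qed
          also have "\<dots> \<le> epowr L (1 / p)"
          proof (intro epowr_mono)
            \<comment> \<open>Since e < 1 the power is decreasing, so the lower bound for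
              \<open>n\<close> is used here.\<close>
            have "n powr (e - 1) \<le> (m / D) powr (e - 1)"
              using mn m n D_pos e by (intro powr_mono2') (auto simp: field_simps)
            also have "\<dots> = D powr (1 - e) * m powr (e - 1)"
              using m D_pos by (simp add: powr_divide powr_diff field_simps)
            finally have "ennreal (n powr (e - 1)) \<le> ennreal (D powr (1 - e)) * ennreal (m powr (e - 1))"
              by (simp add: ennreal_mult[symmetric] ennreal_leI)
            then show "W * ennreal (n powr (e - 1)) \<le> L"
              unfolding L_def mult.assoc by (intro mult_left_mono) auto
          qed (use assms in auto)
          finally show ?thesis .
        qed
      qed
      then have "epowr (maximal h2 y) p \<le> epowr (epowr L (1 / p)) p"
        using assms by (intro epowr_mono) auto
      then show ?thesis using assms by (simp add: epowr_epowr)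
    qed
    have split: "epowr (maximal h y) p \<le> ennreal (2 powr p) * (epowr (maximal h1 y) p + epowr (maximal h2 y) p)" for y
    proof -
      have "maximal h y \<le> maximal (\<lambda>y. h1 y + h2 y) y"
        by (rule maximal_mono) (auto simp: h1_def h2_def indicator_def)
      also have "\<dots> \<le> maximal h1 y + maximal h2 y" by (rule maximal_add_le) auto
      finally have "epowr (maximal h y) p \<le> epowr (maximal h1 y + maximal h2 y) p"
        using assms by (intro epowr_mono) auto
      also have "\<dots> \<le> ennreal (2 powr p) * (epowr (maximal h1 y) p + epowr (maximal h2 y) p)"
        using assms by (intro epowr_add_le) auto
      finally show ?thesis .
    qed
    have "(\<integral>\<^sup>+y. epowr (maximal h1 y) p \<partial>\<nu>) \<le> ennreal K * (\<integral>\<^sup>+y. epowr (h1 y) p \<partial>\<nu>)"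
      by (rule K(2)[OF h1])
    also have "(\<integral>\<^sup>+y. epowr (h1 y) p \<partial>\<nu>) = (\<integral>\<^sup>+y\<in>ball x (5 * r). epowr (h y) p \<partial>\<nu>)"
      by (intro nn_integral_cong) (auto simp: h1_def indicator_def)
    also have "ennreal K * \<dots> \<le> ennreal K * (W * epowr (emeasure \<nu> (ball x (5 * r))) e)"
      using W[of "5 * r" x] r by (intro mult_left_mono) (auto simp: e_def)
    also have "\<dots> \<le> ennreal K * (W * epowr (ennreal (D * m)) e)"
      using doubling[OF r, of x] m D_pos e by (intro mult_left_mono epowr_mono) (auto simp: ennreal_mult)
    also have "epowr (ennreal (D * m)) e = ennreal (D powr e) * ennreal (m powr e)"
      using D_pos m by (simp add: powr_mult ennreal_mult'[symmetric])
    also have "ennreal K * (W * (ennreal (D powr e) * ennreal (m powr e))) = ennreal (K * D powr e) * (W * ennreal (m powr e))"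
      using K(1) by (simp add: ennreal_mult ac_simps)
    finally have near: "(\<integral>\<^sup>+y. epowr (maximal h1 y) p \<partial>\<nu>) \<le> ennreal (K * D powr e) * (W * ennreal (m powr e))" .
    have "(\<integral>\<^sup>+y\<in>ball x r. epowr (maximal h y) p \<partial>\<nu>)
      \<le> (\<integral>\<^sup>+y. ennreal (2 powr p) * (epowr (maximal h1 y) p + L * indicator (ball x r) y) \<partial>\<nu>)"
    proof (rule nn_integral_mono)
      fix y
      show "epowr (maximal h y) p * indicator (ball x r) y
        \<le> ennreal (2 powr p) * (epowr (maximal h1 y) p + L * indicator (ball x r) y)"
      proof (cases "y \<in> ball x r")
        case True
        have "epowr (maximal h y) p \<le> ennreal (2 powr p) * (epowr (maximal h1 y) p + L)"
          using split[of y] far[OF True] by (meson add_left_mono mult_left_mono order_trans zero_le)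
        with True show ?thesis by simp
      qed simp
    qed
    also have "\<dots> = ennreal (2 powr p) * ((\<integral>\<^sup>+y. epowr (maximal h1 y) p \<partial>\<nu>) + L * ennreal m)"
      by (subst nn_integral_cmult) (auto simp: nn_integral_add nn_integral_cmult_indicator m)
    also have "L * ennreal m = ennreal (D powr (1 - e)) * (W * ennreal (m powr e))"
    proof -
      have "ennreal (m powr (e - 1)) * ennreal m = ennreal (m powr e)"
        using m by (simp add: ennreal_mult[symmetric] powr_diff)
      then show ?thesis unfolding L_def mult.assoc by (simp only: mult.left_commute)
    qed
    also have "ennreal (2 powr p) * ((\<integral>\<^sup>+y. epowr (maximal h1 y) p \<partial>\<nu>) + \<dots>)
      \<le> ennreal (2 powr p) * (ennreal (K * D powr e) * (W * ennreal (m powr e)) + ennreal (D powr (1 - e)) * (W * ennreal (m powr e)))"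
      by (intro mult_left_mono add_right_mono near) auto
    also have "\<dots> = ennreal (2 powr p * (K * D powr e + D powr (1 - e))) * W * epowr (emeasure \<nu> (ball x r)) (1 - p / q)"
    proof -
      have "ennreal (K * D powr e) * X + ennreal (D powr (1 - e)) * X = ennreal (K * D powr e + D powr (1 - e)) * X" for X
        using K(1) by (simp add: distrib_right)
      moreover have "ennreal (2 powr p * (K * D powr e + D powr (1 - e)))
          = ennreal (2 powr p) * ennreal (K * D powr e + D powr (1 - e))"
        by (rule ennreal_mult') simp
      ultimately show ?thesis using m by (simp only: e_def mult.assoc) simp
    qed
    finally show "(\<integral>\<^sup>+y\<in>ball x r. epowr (maximal h y) p \<partial>\<nu>)
      \<le> ennreal (2 powr p * (K * D powr e + D powr (1 - e))) * W * epowr (emeasure \<nu> (ball x r)) (1 - p / q)" .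
  qed
qed

text \<open>The Morrey bound of the maximal function is applied to \<open>g\<close> to the
  \<open>p\<close> with both exponents multiplied by (1 - q/d) / p. Their ratio stays a / b, so the
  powers of the ball measure match.\<close>

lemma morrey_bound_of_maximal_bound:
  assumes "0 < p" "0 < q" "q < d" "0 < a" "a \<le> b" "1 < a / p * (1 - q / d)" "0 < A"
  obtains C where "0 < C"
    "\<And>g F. g \<in> borel_measurable borel \<Longrightarrow>
      (\<And>x. F x \<le> ennreal A * majorant p q g x) \<Longrightarrow>
      morrey a b F \<le> ennreal C * epowr (morrey (a * (1 - q / d)) (b * (1 - q / d)) g) (1 - q / d)
        * epowr (morrey p q g) (q / d)"
proof -
  define \<theta> where "\<theta> = 1 - q / d"
  have \<theta>: "0 < \<theta>" using assms by (simp add: \<theta>_def)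
  define P where "P = a * \<theta> / p"
  define Q where "Q = b * \<theta> / p"
  have PQ: "1 < P" "P \<le> Q" "P / Q = a / b" "p * P = a * \<theta>"
    using assms \<theta> by (auto simp: P_def Q_def \<theta>_def[symmetric] divide_right_mono)
  obtain K where K: "0 < K" "\<And>h W x r. h \<in> borel_measurable borel \<Longrightarrow>
    (\<And>x r. 0 < r \<Longrightarrow> (\<integral>\<^sup>+y\<in>ball x r. epowr (h y) P \<partial>\<nu>) \<le> W * epowr (emeasure \<nu> (ball x r)) (1 - P / Q)) \<Longrightarrow> 0 < r \<Longrightarrow>
    (\<integral>\<^sup>+y\<in>ball x r. epowr (maximal h y) P \<partial>\<nu>) \<le> ennreal K * W * epowr (emeasure \<nu> (ball x r)) (1 - P / Q)"
    by (rule maximal_morrey_bound[OF PQ(1,2)]) blast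
  show ?thesis
  proof (rule that)
    show "0 < A * K powr (1 / a)" using assms K(1) by simp
    fix g :: "'a \<Rightarrow> ennreal" and F assume g [measurable]: "g \<in> borel_measurable borel"
      and F: "\<And>x. F x \<le> ennreal A * majorant p q g x"
    define N where "N = epowr (morrey p q g) (q / d)"
    define R where "R = morrey (a * \<theta>) (b * \<theta>) g"
    have "morrey a b F \<le> ennreal (A * K powr (1 / a)) * epowr R \<theta> * N"
      unfolding morrey_le_iff[OF \<open>0 < a\<close>]
    proof (intro allI impI)
      fix x :: 'a and r :: real assume r: "0 < r"
      have "(\<integral>\<^sup>+y\<in>ball x r. epowr (F y) a \<partial>\<nu>)
        \<le> (\<integral>\<^sup>+y\<in>ball x r. epowr (ennreal A * epowr (maximal (\<lambda>y. epowr (g y) p) y) (\<theta> / p) * N) a \<partial>\<nu>)"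
        using F assms by (intro nn_integral_mono mult_right_mono epowr_mono) (auto simp: majorant_def \<theta>_def N_def mult.assoc)
      also have "\<dots> = (\<integral>\<^sup>+y. (epowr (ennreal A) a * epowr N a) * (epowr (maximal (\<lambda>y. epowr (g y) p) y) P * indicator (ball x r) y) \<partial>\<nu>)"
        using assms by (intro nn_integral_cong) (simp add: epowr_mult epowr_epowr P_def ac_simps)
      also have "\<dots> = (epowr (ennreal A) a * epowr N a) * (\<integral>\<^sup>+y\<in>ball x r. epowr (maximal (\<lambda>y. epowr (g y) p) y) P \<partial>\<nu>)"
        by (rule nn_integral_cmult) measurable
      also have "\<dots> \<le> (epowr (ennreal A) a * epowr N a) *
          (ennreal K * epowr R (a * \<theta>) * epowr (emeasure \<nu> (ball x r)) (1 - P / Q))"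
      proof (intro mult_left_mono K(2) r)
        fix z :: 'a and \<rho> :: real assume "0 < \<rho>"
        then show "(\<integral>\<^sup>+y\<in>ball z \<rho>. epowr (epowr (g y) p) P \<partial>\<nu>) \<le> epowr R (a * \<theta>) * epowr (emeasure \<nu> (ball z \<rho>)) (1 - P / Q)"
          using morreyD[of "a * \<theta>" \<rho> g z "b * \<theta>"] assms \<theta> by (simp add: epowr_epowr PQ R_def)
      qed auto
      also have "\<dots> = epowr (ennreal (A * K powr (1 / a)) * epowr R \<theta> * N) a * epowr (emeasure \<nu> (ball x r)) (1 - a / b)"
        using assms K(1) by (simp add: epowr_mult epowr_epowr PQ powr_mult powr_powr ennreal_mult ac_simps)
      finally show "(\<integral>\<^sup>+y\<in>ball x r. epowr (F y) a \<partial>\<nu>)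
        \<le> epowr (ennreal (A * K powr (1 / a)) * epowr R \<theta> * N) a * epowr (emeasure \<nu> (ball x r)) (1 - a / b)" .
    qed
    then show "morrey a b F \<le> ennreal (A * K powr (1 / a)) * epowr (morrey (a * (1 - q / d)) (b * (1 - q / d)) g) (1 - q / d)
        * epowr (morrey p q g) (q / d)"
      by (simp add: R_def N_def \<theta>_def)
  qed
qed

end

subsection \<open>Lebesgue measure: dilations, polar averages, Riesz potentials\<close>

lemma nn_integral_lborel_affine:
  fixes f :: "'a::euclidean_space \<Rightarrow> ennreal" and t :: 'a
  assumes [measurable]: "f \<in> borel_measurable borel" and "a \<noteq> 0"
  shows "(\<integral>\<^sup>+x. f x \<partial>lborel) = ennreal (\<bar>a\<bar> ^ DIM('a)) * (\<integral>\<^sup>+x. f (t + a *\<^sub>R x) \<partial>lborel)"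
proof -
  have "(\<integral>\<^sup>+x. f x \<partial>lborel)
      = (\<integral>\<^sup>+x. f x \<partial>density (distr lborel borel (\<lambda>x. t + a *\<^sub>R x)) (\<lambda>_. \<bar>a\<bar> ^ DIM('a)))"
    using lborel_affine[OF \<open>a \<noteq> 0\<close>, of t] by simp
  also have "\<dots> = (\<integral>\<^sup>+x. ennreal (\<bar>a\<bar> ^ DIM('a)) * f (t + a *\<^sub>R x) \<partial>lborel)"
    by (simp add: nn_integral_density nn_integral_distr)
  finally show ?thesis by (simp add: nn_integral_cmult)
qed

lemma integral_lborel_affine:
  fixes f :: "'a::euclidean_space \<Rightarrow> real" and t :: 'a
  assumes [measurable]: "f \<in> borel_measurable borel" and "a \<noteq> 0"
  shows "integral\<^sup>L lborel f = \<bar>a\<bar> ^ DIM('a) * (LINT x|lborel. f (t + a *\<^sub>R x))"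
    and "integrable lborel f \<longleftrightarrow> integrable lborel (\<lambda>x. f (t + a *\<^sub>R x))"
proof -
  let ?M = "density (distr lborel borel (\<lambda>x. t + a *\<^sub>R x)) (\<lambda>_. \<bar>a\<bar> ^ DIM('a))"
  have "integral\<^sup>L lborel f = integral\<^sup>L ?M f"
    using lborel_affine[OF \<open>a \<noteq> 0\<close>, of t] by simp
  also have "\<dots> = \<bar>a\<bar> ^ DIM('a) * (LINT x|lborel. f (t + a *\<^sub>R x))"
    by (subst integral_density) (auto simp: integral_distr)
  finally show "integral\<^sup>L lborel f = \<bar>a\<bar> ^ DIM('a) * (LINT x|lborel. f (t + a *\<^sub>R x))" .
  have "integrable lborel f \<longleftrightarrow> integrable ?M f"
    using lborel_affine[OF \<open>a \<noteq> 0\<close>, of t] by simp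
  also have "\<dots> \<longleftrightarrow> integrable lborel (\<lambda>x. f (t + a *\<^sub>R x))"
    using \<open>a \<noteq> 0\<close> by (subst integrable_density) (auto simp: integrable_distr_eq)
  finally show "integrable lborel f \<longleftrightarrow> integrable lborel (\<lambda>x. f (t + a *\<^sub>R x))" .
qed

lemma borel_measurable_sgn [measurable]: "(sgn :: 'a::euclidean_space \<Rightarrow> 'a) \<in> borel_measurable borel"
  unfolding sgn_div_norm by measurable

lemma nn_integral_powr_atLeast:
  fixes n b :: real
  assumes "0 < n" "0 < b"
  shows "(\<integral>\<^sup>+t\<in>{b..}. ennreal (t powr (- n - 1)) \<partial>lborel) = ennreal (b powr (- n) / n)"
proof -
  have "(\<integral>\<^sup>+t. ennreal (t powr (- n - 1)) * indicator {b..} t \<partial>lborel) = 0 - (- (b powr (- n) / n))"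
  proof (rule nn_integral_FTC_atLeast)
    show "((\<lambda>t. - (t powr (- n) / n)) \<longlongrightarrow> 0) at_top"
      using assms by real_asymp
    fix t assume "b \<le> t"
    then show "((\<lambda>t. - (t powr (- n) / n)) has_real_derivative t powr (- n - 1)) (at t)"
      using assms by (auto intro!: derivative_eq_intros)
  qed auto
  then show ?thesis by simp
qed

lemma nn_integral_inverse_Icc:
  fixes a b :: real
  assumes "0 < a" "a \<le> b"
  shows "(\<integral>\<^sup>+t\<in>{a..b}. ennreal (1 / t) \<partial>lborel) = ennreal (ln b - ln a)"
proof (rule nn_integral_has_integral_lebesgue')
  show "((\<lambda>t. 1 / t) has_integral (ln b - ln a)) {a..b}"
  proof (rule fundamental_theorem_of_calculus[OF assms(2)])
    fix t assume "t \<in> {a..b}"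
    then have "(ln has_real_derivative 1 / t) (at t within {a..b})"
      using assms by (auto intro!: derivative_eq_intros)
    then show "(ln has_vector_derivative 1 / t) (at t within {a..b})"
      by (simp add: has_real_derivative_iff_has_vector_derivative)
  qed
qed (use assms in auto)

text \<open>A substitute for polar coordinates: both sides are the integral of
  \<open>\<phi> (sgn y) / t\<close> over the pairs \<open>(t, y)\<close> with \<open>|y| < 1 < t |y| \<le> 2\<close>, one with the inner
  integral over \<open>t\<close>, the other after substituting \<open>w = t y\<close>.\<close>

lemma nn_integral_shell:
  fixes \<phi> :: "'a::euclidean_space \<Rightarrow> ennreal"
  assumes [measurable]: "\<phi> \<in> borel_measurable borel"
  shows "(\<integral>\<^sup>+w\<in>{w. 1 < norm w \<and> norm w \<le> 2}. ennreal (norm w powr - real DIM('a)) * \<phi> (sgn w) \<partial>lborel)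
    = ennreal (real DIM('a) * ln 2) * (\<integral>\<^sup>+y\<in>ball 0 1 - {0}. \<phi> (sgn y) \<partial>lborel)"
proof -
  define n where "n = real DIM('a)"
  have n: "0 < n" by (simp add: n_def)
  let ?P = "\<lambda>t (y::'a). 0 < t \<and> 0 < norm y \<and> norm y < 1 \<and> 1 < t * norm y \<and> t * norm y \<le> 2"
  let ?Q = "\<lambda>t (w::'a). norm w < t \<and> 1 < norm w \<and> norm w \<le> 2"
  let ?J = "\<lambda>t y. if ?P t y then ennreal (1 / t) * \<phi> (sgn y) else 0"
  let ?I = "\<lambda>t w. if ?Q t w then ennreal (t powr (- n - 1)) * \<phi> (sgn w) else 0"
  \<comment> \<open>For fixed \<open>y\<close> the variable \<open>t\<close> runs from 1/|y| to
    2/|y|, an interval on which 1/t integrates to \<open>ln 2\<close> independently of |y|.\<close>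
  have 1: "(\<integral>\<^sup>+t. ?J t y \<partial>lborel) = ennreal (ln 2) * (\<phi> (sgn y) * indicator (ball 0 1 - {0}) y)" for y :: 'a
  proof (cases "y \<in> ball 0 1 - {0}")
    case True
    define b where "b = norm y"
    have b: "0 < b" "b < 1" using True by (auto simp: b_def)
    have "(\<integral>\<^sup>+t. ?J t y \<partial>lborel) = (\<integral>\<^sup>+t. \<phi> (sgn y) * (ennreal (1 / t) * indicator {1 / b..2 / b} t) \<partial>lborel)"
    proof (rule nn_integral_cong_AE)
      have "AE t in lborel. t \<noteq> 1 / b" by (rule AE_lborel_singleton)
      then show "AE t in lborel. ?J t y = \<phi> (sgn y) * (ennreal (1 / t) * indicator {1 / b..2 / b} t)"
      proof eventually_elim
        case (elim t)
        have "1 < t * b \<longleftrightarrow> 1 / b < t" "t * b \<le> 2 \<longleftrightarrow> t \<le> 2 / b" "0 < 1 / b"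
          using b by (simp_all add: divide_less_eq le_divide_eq)
        then have "?P t y \<longleftrightarrow> t \<in> {1 / b..2 / b}"
          unfolding b_def[symmetric] using b elim by auto
        then show ?case by (simp only: indicator_def) (simp add: mult.commute)
      qed
    qed
    also have "\<dots> = \<phi> (sgn y) * ennreal (ln (2 / b) - ln (1 / b))"
      using b by (subst nn_integral_cmult) (auto simp: nn_integral_inverse_Icc divide_right_mono)
    also have "ln (2 / b) - ln (1 / b) = ln 2"
      using b by (simp add: ln_div)
    finally show ?thesis using True by (simp add: mult.commute)
  next
    case False
    then have "?J t y = 0" for t by auto
    with False show ?thesis by simp
  qed
  \<comment> \<open>Dilation by \<open>t\<close> preserves \<open>sgn\<close>, and its Jacobian
    turns 1/t into \<open>t powr (- n - 1)\<close>.\<close>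
  have 2: "(\<integral>\<^sup>+y. ?J t y \<partial>lborel) = (\<integral>\<^sup>+w. ?I t w \<partial>lborel)" for t :: real
  proof (cases "0 < t")
    case True
    have sgn: "sgn (inverse t *\<^sub>R w) = sgn w" for w :: 'a
      using True by (simp add: sgn_scaleR)
    have P: "?P t (inverse t *\<^sub>R w) \<longleftrightarrow> ?Q t w" for w :: 'a
    proof -
      have "norm (inverse t *\<^sub>R w) = norm w / t"
        using True by (simp add: divide_inverse_commute)
      moreover have "norm w / t < 1 \<longleftrightarrow> norm w < t" "t * (norm w / t) = norm w"
        using True by (simp_all add: divide_less_eq)
      moreover have "0 < norm w / t" if "1 < norm w"
        using True that by (intro divide_pos_pos) auto
      ultimately show ?thesis using True by (auto simp del: norm_scaleR)
    qed
    have "(\<integral>\<^sup>+y. ?J t y \<partial>lborel) = ennreal (\<bar>inverse t\<bar> ^ DIM('a)) * (\<integral>\<^sup>+w. ?J t (0 + inverse t *\<^sub>R w) \<partial>lborel)"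
    proof (rule nn_integral_lborel_affine)
      show "?J t \<in> borel_measurable borel" by measurable
    qed (use True in simp)
    also have "\<dots> = (\<integral>\<^sup>+w. ennreal (\<bar>inverse t\<bar> ^ DIM('a)) * ?J t (0 + inverse t *\<^sub>R w) \<partial>lborel)"
      by (rule nn_integral_cmult[symmetric]) measurable
    also have "\<dots> = (\<integral>\<^sup>+w. ?I t w \<partial>lborel)"
    proof (rule nn_integral_cong)
      fix w :: 'a
      have "\<bar>inverse t\<bar> ^ DIM('a) * (1 / t) = t powr (- n - 1)"
        using True by (simp add: powr_diff powr_minus n_def powr_realpow power_inverse[symmetric] divide_inverse)
      then have "ennreal (\<bar>inverse t\<bar> ^ DIM('a)) * ennreal (1 / t) = ennreal (t powr (- n - 1))"
        using True by (simp add: ennreal_mult[symmetric])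
      then show "ennreal (\<bar>inverse t\<bar> ^ DIM('a)) * ?J t (0 + inverse t *\<^sub>R w) = ?I t w"
        unfolding add_0_left P sgn using True by (simp add: mult.assoc[symmetric])
    qed
    finally show ?thesis .
  next
    case False
    then have "?J t y = 0" "?I t y = 0" for y :: 'a
      by (auto dest: order.strict_trans1[OF norm_ge_zero])
    then show ?thesis by simp
  qed
  \<comment> \<open>The condition |y| < 1 has become t > |w|; integrating over such \<open>t\<close>
    creates the homogeneous kernel.\<close>
  have 3: "(\<integral>\<^sup>+t. ?I t w \<partial>lborel)
    = ennreal (1 / n) * ((ennreal (norm w powr - n) * \<phi> (sgn w)) * indicator {w. 1 < norm w \<and> norm w \<le> 2} w)" for w :: 'a
  proof (cases "1 < norm w \<and> norm w \<le> 2")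
    case True
    have "(\<integral>\<^sup>+t. ?I t w \<partial>lborel)
      = (\<integral>\<^sup>+t. \<phi> (sgn w) * (ennreal (t powr (- n - 1)) * indicator {norm w..} t) \<partial>lborel)"
    proof (rule nn_integral_cong_AE)
      have "AE t in lborel. t \<noteq> norm w" by (rule AE_lborel_singleton)
      then show "AE t in lborel. ?I t w = \<phi> (sgn w) * (ennreal (t powr (- n - 1)) * indicator {norm w..} t)"
        by eventually_elim (use True in \<open>auto simp: indicator_def mult.commute\<close>)
    qed
    also have "\<dots> = \<phi> (sgn w) * ennreal (norm w powr (- n) / n)"
    proof -
      have "0 < norm w" using True by linarith
      then show ?thesis
        by (subst nn_integral_cmult, measurable) (simp only: nn_integral_powr_atLeast[OF n])
    qed
    also have "ennreal (norm w powr (- n) / n) = ennreal (1 / n) * ennreal (norm w powr - n)"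
      using n by (simp add: ennreal_mult'[symmetric])
    finally show ?thesis using True by (simp add: ac_simps)
  next
    case False
    then have "?I t w = 0" for t by auto
    with False show ?thesis by simp
  qed
  have "ennreal (1 / n) * (\<integral>\<^sup>+w\<in>{w. 1 < norm w \<and> norm w \<le> 2}. ennreal (norm w powr - n) * \<phi> (sgn w) \<partial>lborel)
      = (\<integral>\<^sup>+w. \<integral>\<^sup>+t. ?I t w \<partial>lborel \<partial>lborel)"
    unfolding 3 by (rule nn_integral_cmult[symmetric]) measurable
  also have "\<dots> = (\<integral>\<^sup>+t. \<integral>\<^sup>+w. ?I t w \<partial>lborel \<partial>lborel)"
    by (rule lborel_pair.Fubini') measurable
  also have "\<dots> = (\<integral>\<^sup>+t. \<integral>\<^sup>+y. ?J t y \<partial>lborel \<partial>lborel)" unfolding 2 ..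
  also have "\<dots> = (\<integral>\<^sup>+y. \<integral>\<^sup>+t. ?J t y \<partial>lborel \<partial>lborel)"
    by (rule lborel_pair.Fubini'[symmetric]) measurable
  also have "\<dots> = ennreal (ln 2) * (\<integral>\<^sup>+y\<in>ball 0 1 - {0}. \<phi> (sgn y) \<partial>lborel)"
    unfolding 1 by (intro nn_integral_cmult) measurable
  finally have "ennreal n * (ennreal (1 / n) * (\<integral>\<^sup>+w\<in>{w. 1 < norm w \<and> norm w \<le> 2}. ennreal (norm w powr - n) * \<phi> (sgn w) \<partial>lborel))
      = ennreal n * (ennreal (ln 2) * (\<integral>\<^sup>+y\<in>ball 0 1 - {0}. \<phi> (sgn y) \<partial>lborel))" by simp
  moreover have "ennreal n * (ennreal (1 / n) * X) = X" for X
    using n by (simp add: mult.assoc[symmetric] ennreal_mult[symmetric])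
  moreover have "ennreal n * (ennreal (ln 2) * X) = ennreal (n * ln 2) * X" for X
    using n by (simp add: mult.assoc[symmetric] ennreal_mult[symmetric])
  ultimately show ?thesis by (simp add: n_def)
qed

section \<open>Riesz potentials and the Hardy--Littlewood--Sobolev inequality\<close>

lemma doubling_measure_lborel:
  "doubling_measure (lborel :: 'a::euclidean_space measure) (5 ^ DIM('a)) (real DIM('a)) (unit_ball_vol (real DIM('a)))"
proof
  fix x :: 'a and r :: real
  show "emeasure lborel (ball x r) < top"
    using emeasure_lborel_ball_finite[of x r] by simp
  assume r: "0 < r"
  show "emeasure lborel (ball x (5 * r)) \<le> ennreal (5 ^ DIM('a)) * emeasure lborel (ball x r)"
    using r by (simp add: emeasure_ball power_mult_distrib ennreal_mult[symmetric] ac_simps)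
  show "ennreal (unit_ball_vol (real DIM('a)) * r powr real DIM('a)) \<le> emeasure lborel (ball x r)"
    using r by (simp add: emeasure_ball powr_realpow)
qed auto

text \<open>The Riesz potential of order 1 without its normalising constant. At y = u the kernel
  takes the value 0 by the convention for \<open>powr\<close>, which affects only a null
  set.\<close>

definition riesz :: "('a::euclidean_space \<Rightarrow> ennreal) \<Rightarrow> 'a \<Rightarrow> ennreal" where
  "riesz g u = (\<integral>\<^sup>+y. g y * ennreal (norm (u - y) powr (1 - real DIM('a))) \<partial>lborel)"

text \<open>On the shell where |u - y| lies between t 2^k and twice that radius, the kernel is at
  most its value at the inner radius, and enlarging the shell to the ball of the outer radius turns
  the integral into an average. The volume of that ball leaves one factor of the radius and the
  constant shown.\<close>

lemma riesz_truncated_le: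
  fixes g :: "'a::euclidean_space \<Rightarrow> ennreal"
  assumes [measurable]: "g \<in> borel_measurable borel" and "0 < t"
  shows "(\<integral>\<^sup>+y\<in>{y. t \<le> norm (u - y)}. g y * ennreal (norm (u - y) powr (1 - real DIM('a))) \<partial>lborel)
    \<le> ennreal (unit_ball_vol (real DIM('a)) * 2 ^ (DIM('a) - 1)) *
      (\<Sum>k. ennreal (2 * t * 2 ^ k) * doubling_measure.average lborel g u (2 * t * 2 ^ k))"
proof -
  interpret doubling_measure "lborel :: 'a measure" "5 ^ DIM('a)" "real DIM('a)" "unit_ball_vol (real DIM('a))"
    by (rule doubling_measure_lborel)
  have n: "1 \<le> DIM('a)" by (simp add: Suc_le_eq)
  let ?e = "1 - real DIM('a)"
  have "(\<integral>\<^sup>+y\<in>{y. t \<le> norm (u - y)}. g y * ennreal (norm (u - y) powr ?e) \<partial>lborel)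
    \<le> (\<integral>\<^sup>+y. (\<Sum>k. ennreal ((t * 2 ^ k) powr ?e) * (g y * indicator (ball u (2 * t * 2 ^ k)) y)) \<partial>lborel)"
  proof (rule nn_integral_mono)
    fix y
    show "g y * ennreal (norm (u - y) powr ?e) * indicator {y. t \<le> norm (u - y)} y
      \<le> (\<Sum>k. ennreal ((t * 2 ^ k) powr ?e) * (g y * indicator (ball u (2 * t * 2 ^ k)) y))"
    proof (cases "t \<le> norm (u - y)")
      case True
      obtain j where "norm (u - y) / t < 2 ^ j" using real_arch_pow[of 2] by auto
      then have "norm (u - y) < t * 2 ^ j" using \<open>0 < t\<close> by (simp add: divide_less_eq mult.commute)
      then obtain k where k: "\<not> norm (u - y) < t * 2 ^ k" and upper: "norm (u - y) < t * 2 ^ Suc k"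
        using ex_least_nat_less[of "\<lambda>k. norm (u - y) < t * 2 ^ k" j] True by auto
      then have lower: "t * 2 ^ k \<le> norm (u - y)" by simp
      have "g y * ennreal (norm (u - y) powr ?e) \<le> g y * ennreal ((t * 2 ^ k) powr ?e)"
        using lower \<open>0 < t\<close> n by (intro mult_left_mono ennreal_leI powr_mono2') auto
      also have "\<dots> = ennreal ((t * 2 ^ k) powr ?e) * (g y * indicator (ball u (2 * t * 2 ^ k)) y)"
        using upper by (simp add: dist_norm mult.commute mult.assoc)
      also have "\<dots> \<le> (\<Sum>k. ennreal ((t * 2 ^ k) powr ?e) * (g y * indicator (ball u (2 * t * 2 ^ k)) y))"
        using sum_le_suminf[of "\<lambda>k. ennreal ((t * 2 ^ k) powr ?e) * (g y * indicator (ball u (2 * t * 2 ^ k)) y)" "{k}"]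
        by (simp add: summableI)
      finally show ?thesis using True by simp
    qed simp
  qed
  also have "\<dots> = (\<Sum>k. ennreal ((t * 2 ^ k) powr ?e) * (\<integral>\<^sup>+y\<in>ball u (2 * t * 2 ^ k). g y \<partial>lborel))"
  proof (subst nn_integral_suminf)
    show "(\<lambda>y. ennreal ((t * 2 ^ k) powr ?e) * (g y * indicator (ball u (2 * t * 2 ^ k)) y)) \<in> borel_measurable lborel" for k
      by measurable
    show "(\<Sum>k. \<integral>\<^sup>+y. ennreal ((t * 2 ^ k) powr ?e) * (g y * indicator (ball u (2 * t * 2 ^ k)) y) \<partial>lborel)
      = (\<Sum>k. ennreal ((t * 2 ^ k) powr ?e) * (\<integral>\<^sup>+y\<in>ball u (2 * t * 2 ^ k). g y \<partial>lborel))"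
      by (intro suminf_cong nn_integral_cmult) measurable
  qed
  also have "\<dots> = (\<Sum>k. ennreal (unit_ball_vol (real DIM('a)) * 2 ^ (DIM('a) - 1)) *
      (ennreal (2 * t * 2 ^ k) * average g u (2 * t * 2 ^ k)))"
  proof (rule suminf_cong)
    fix k
    define r where "r = t * 2 ^ k"
    have r: "0 < r" using \<open>0 < t\<close> by (simp add: r_def)
    have "ennreal (r powr ?e) * (\<integral>\<^sup>+y\<in>ball u (2 * r). g y \<partial>lborel)
        = ennreal (r powr ?e) * (average g u (2 * r) * ennreal (unit_ball_vol (real DIM('a)) * (2 * r) ^ DIM('a)))"
      using r by (simp add: average_times_emeasure[symmetric] emeasure_ball)
    also have "\<dots> = ennreal (r powr ?e * (unit_ball_vol (real DIM('a)) * (2 * r) ^ DIM('a))) * average g u (2 * r)"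
      using r by (simp add: ennreal_mult' ac_simps)
    also have "r powr ?e * (unit_ball_vol (real DIM('a)) * (2 * r) ^ DIM('a))
        = unit_ball_vol (real DIM('a)) * 2 ^ (DIM('a) - 1) * (2 * r)"
      using r n by (simp add: powr_diff powr_realpow power_mult_distrib power_eq_if[of 2 "DIM('a)"])
    also have "ennreal \<dots> = ennreal (unit_ball_vol (real DIM('a)) * 2 ^ (DIM('a) - 1)) * ennreal (2 * r)"
      using r by (intro ennreal_mult) auto
    finally show "ennreal ((t * 2 ^ k) powr ?e) * (\<integral>\<^sup>+y\<in>ball u (2 * t * 2 ^ k). g y \<partial>lborel)
      = ennreal (unit_ball_vol (real DIM('a)) * 2 ^ (DIM('a) - 1)) *
      (ennreal (2 * t * 2 ^ k) * average g u (2 * t * 2 ^ k))"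
      by (simp only: r_def mult.assoc)
  qed
  finally show ?thesis by simp
qed

text \<open>Monotone convergence along the truncation radii 1 / (j + 1); the point y = u contributes
  0 on both sides.\<close>

lemma riesz_le:
  fixes g :: "'a::euclidean_space \<Rightarrow> ennreal"
  assumes [measurable]: "g \<in> borel_measurable borel"
    and B: "\<And>t. 0 < t \<Longrightarrow> (\<integral>\<^sup>+y\<in>{y. t \<le> norm (u - y)}. g y * ennreal (norm (u - y) powr (1 - real DIM('a))) \<partial>lborel) \<le> B"
  shows "riesz g u \<le> B"
proof -
  let ?f = "\<lambda>y. g y * ennreal (norm (u - y) powr (1 - real DIM('a)))"
  let ?S = "\<lambda>j::nat. {y. 1 / real (Suc j) \<le> norm (u - y)}"
  have "?f y = (SUP j. ?f y * indicator (?S j) y)" for y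
  proof (cases "y = u")
    case True
    then show ?thesis by simp
  next
    case False
    then obtain j where "inverse (real (Suc j)) < norm (u - y)"
      using reals_Archimedean[of "norm (u - y)"] by auto
    then have "?f y \<le> (SUP j. ?f y * indicator (?S j) y)"
      by (intro SUP_upper2[of j]) (auto simp: inverse_eq_divide)
    moreover have "(SUP j. ?f y * indicator (?S j) y) \<le> ?f y"
      by (intro SUP_least) (auto simp: indicator_def)
    ultimately show ?thesis by (rule antisym)
  qed
  then have "riesz g u = (\<integral>\<^sup>+y. (SUP j. ?f y * indicator (?S j) y) \<partial>lborel)"
    unfolding riesz_def by (intro nn_integral_cong) auto
  also have "\<dots> = (SUP j. \<integral>\<^sup>+y. ?f y * indicator (?S j) y \<partial>lborel)"
  proof (rule nn_integral_monotone_convergence_SUP)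
    show "incseq (\<lambda>j y. ?f y * indicator (?S j) y)"
    proof (intro incseq_SucI le_funI mult_left_mono)
      fix j y
      have "1 / real (Suc (Suc j)) \<le> 1 / real (Suc j)" by (simp add: field_simps)
      then show "indicator (?S j) y \<le> (indicator (?S (Suc j)) y :: ennreal)"
        by (auto simp: indicator_def)
    qed auto
  qed measurable
  also have "\<dots> \<le> B"
    by (intro SUP_least B) auto
  finally show ?thesis .
qed

text \<open>Lebesgue measure is lower regular with index n, so the dyadic potential bound applies
  with p = 1 and q = \<rho>. The relation between the exponents says r (1 - \<rho>/n) = \<rho>, so
  the maximal theorem is used exactly at exponent \<rho>.\<close>

lemma hardy_littlewood_sobolev:
  fixes g :: "'a::euclidean_space \<Rightarrow> ennreal"
  assumes g [measurable]: "g \<in> borel_measurable borel"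
    and \<rho>: "1 < \<rho>" "\<rho> < real DIM('a)" and r: "1 / r = 1 / \<rho> - 1 / real DIM('a)"
    and fin: "(\<integral>\<^sup>+y. epowr (g y) \<rho> \<partial>lborel) < top"
  shows "(\<integral>\<^sup>+u. epowr (riesz g u) r \<partial>lborel) < top"
proof -
  interpret doubling_measure "lborel :: 'a measure" "5 ^ DIM('a)" "real DIM('a)" "unit_ball_vol (real DIM('a))"
    by (rule doubling_measure_lborel)
  let ?n = "real DIM('a)"
  have "1 / ?n < 1 / \<rho>" using \<rho> by (simp add: frac_less2)
  then have r0: "0 < r" using r by (metis diff_gt_0_iff_gt zero_less_divide_1_iff)
  have r\<rho>: "r * (1 - \<rho> / ?n) = \<rho>"
  proof -
    have "1 = r * (1 / \<rho> - 1 / ?n)" using r r0 by (simp add: field_simps)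
    then have "\<rho> = r * ((1 / \<rho> - 1 / ?n) * \<rho>)" by (metis mult.assoc mult_1)
    also have "(1 / \<rho> - 1 / ?n) * \<rho> = 1 - \<rho> / ?n" using \<rho> by (simp add: left_diff_distrib)
    finally show ?thesis by simp
  qed
  obtain C0 where C0: "0 < C0"
    "\<And>g x t. 0 < t \<Longrightarrow> (\<Sum>k. ennreal (t * 2 ^ k) * epowr (average (\<lambda>y. epowr (g y) 1) x (t * 2 ^ k)) (1 / 1))
      \<le> ennreal C0 * majorant 1 \<rho> g x"
    by (rule dyadic_potential_le[of 1 \<rho>]) (use \<rho> in \<open>simp, simp, simp, blast\<close>)
  define A where "A = unit_ball_vol ?n * 2 ^ (DIM('a) - 1) * C0"
  have A: "0 < A" using C0(1) by (simp add: A_def)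
  have bound: "riesz g u \<le> ennreal A * majorant 1 \<rho> g u" for u
  proof (rule riesz_le[OF g])
    fix t :: real assume t: "0 < t"
    have "(\<integral>\<^sup>+y\<in>{y. t \<le> norm (u - y)}. g y * ennreal (norm (u - y) powr (1 - real DIM('a))) \<partial>lborel)
      \<le> ennreal (unit_ball_vol (real DIM('a)) * 2 ^ (DIM('a) - 1)) * (\<Sum>k. ennreal (2 * t * 2 ^ k) * average g u (2 * t * 2 ^ k))"
      using t by (intro riesz_truncated_le g) (simp_all add: Suc_le_eq)
    also have "\<dots> \<le> ennreal (unit_ball_vol (real DIM('a)) * 2 ^ (DIM('a) - 1)) *
        (ennreal C0 * majorant 1 \<rho> g u)"
      using C0(2)[of "2 * t" g u] t by (intro mult_left_mono) auto
    also have "\<dots> = ennreal A * majorant 1 \<rho> g u"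
      using C0(1) by (simp add: A_def ennreal_mult mult.assoc)
    finally show "(\<integral>\<^sup>+y\<in>{y. t \<le> norm (u - y)}. g y * ennreal (norm (u - y) powr (1 - real DIM('a))) \<partial>lborel)
      \<le> ennreal A * majorant 1 \<rho> g u" .
  qed
  have "0 < 1 - \<rho> / ?n" using \<rho> by simp
  have "1 < r / 1 * (1 - \<rho> / ?n)" using \<rho> r\<rho> by simp
  then obtain C where C: "0 < C"
    "\<And>g F. g \<in> borel_measurable borel \<Longrightarrow>
      (\<And>x. F x \<le> ennreal A * majorant 1 \<rho> g x) \<Longrightarrow>
      epowr (\<integral>\<^sup>+x. epowr (F x) r \<partial>lborel) (1 / r)
      \<le> ennreal C * epowr (epowr (\<integral>\<^sup>+x. epowr (g x) (r * (1 - \<rho> / ?n)) \<partial>lborel) (1 / (r * (1 - \<rho> / ?n)))) (1 - \<rho> / ?n)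
        * epowr (morrey 1 \<rho> g) (\<rho> / ?n)"
    by (rule Lp_bound_of_maximal_bound[of 1 \<rho> r A, rotated 3])
      (use \<rho> r0 A in \<open>simp, simp, blast, simp, simp, simp\<close>)
  \<comment> \<open>Both factors of the bound are thus controlled by the single assumption
    \<open>fin\<close>.\<close>
  have "morrey 1 \<rho> g < top"
  proof (rule le_less_trans[OF morrey_le_Lp])
    show "epowr (\<integral>\<^sup>+y. epowr (g y) \<rho> \<partial>lborel) (1 / \<rho>) < top"
      using fin by (simp add: less_top[symmetric])
  qed (use \<rho> in auto)
  then have "ennreal C * epowr (epowr (\<integral>\<^sup>+x. epowr (g x) (r * (1 - \<rho> / ?n)) \<partial>lborel) (1 / (r * (1 - \<rho> / ?n)))) (1 - \<rho> / ?n)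
        * epowr (morrey 1 \<rho> g) (\<rho> / ?n) < top"
    using fin by (simp add: r\<rho> less_top[symmetric] ennreal_mult_eq_top_iff)
  from le_less_trans[OF C(2)[OF g bound] this] show ?thesis
    by (simp add: less_top[symmetric])
qed

section \<open>Poincare inequality in Riesz potential form\<close>

lemma abs_diff_le_segment_integral:
  fixes h :: "'a::euclidean_space \<Rightarrow> real" and Dh :: "'a \<Rightarrow> 'a"
  assumes der: "\<And>x. (h has_derivative (\<lambda>v. Dh x \<bullet> v)) (at x)"
    and cont: "continuous_on UNIV Dh"
  shows "ennreal \<bar>h w - h y\<bar>
    \<le> (\<integral>\<^sup>+\<tau>\<in>{0..1}. ennreal (norm (Dh (y + \<tau> *\<^sub>R (w - y))) * norm (w - y)) \<partial>lborel)"
proof -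
  let ?\<gamma> = "\<lambda>\<tau>. y + \<tau> *\<^sub>R (w - y)"
  have \<gamma>: "continuous_on {0..1} (\<lambda>\<tau>. Dh (?\<gamma> \<tau>))"
    by (rule continuous_on_compose2[OF cont]) (auto intro!: continuous_intros)
  have "((\<lambda>\<tau>. h (?\<gamma> \<tau>)) has_vector_derivative (Dh (?\<gamma> \<tau>) \<bullet> (w - y))) (at \<tau> within {0..1})" for \<tau>
  proof -
    have "(?\<gamma> has_derivative (\<lambda>s. s *\<^sub>R (w - y))) (at \<tau> within {0..1})"
      by (auto intro!: derivative_eq_intros)
    from has_derivative_compose[OF this der] show ?thesis
      by (simp add: has_vector_derivative_def)
  qed
  then have FTC: "((\<lambda>\<tau>. Dh (?\<gamma> \<tau>) \<bullet> (w - y)) has_integral (h (?\<gamma> 1) - h (?\<gamma> 0))) {0..1}"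
    by (intro fundamental_theorem_of_calculus) auto
  have int: "(\<lambda>\<tau>. norm (Dh (?\<gamma> \<tau>)) * norm (w - y)) integrable_on {0..1}"
    by (intro integrable_continuous_real continuous_intros \<gamma>)
  have "norm (integral {0..1} (\<lambda>\<tau>. Dh (?\<gamma> \<tau>) \<bullet> (w - y))) \<le> integral {0..1} (\<lambda>\<tau>. norm (Dh (?\<gamma> \<tau>)) * norm (w - y))"
    by (intro integral_norm_bound_integral has_integral_integrable[OF FTC] int) (simp add: Cauchy_Schwarz_ineq2)
  then have "ennreal \<bar>h w - h y\<bar> \<le> ennreal (integral {0..1} (\<lambda>\<tau>. norm (Dh (?\<gamma> \<tau>)) * norm (w - y)))"
    using integral_unique[OF FTC] by (intro ennreal_leI) simp
  also have "\<dots> = (\<integral>\<^sup>+\<tau>\<in>{0..1}. ennreal (norm (Dh (?\<gamma> \<tau>)) * norm (w - y)) \<partial>lborel)"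
    by (rule nn_integral_has_integral_lebesgue'[symmetric, OF _ integrable_integral[OF int]]) auto
  finally show ?thesis .
qed

text \<open>Integrate the gradient along the segment from \<open>y\<close> to \<open>w\<close> and
  substitute u = y + \<tau> (w - y) for \<open>w\<close>, with Jacobian \<tau> to the power -n. By
  convexity \<open>u\<close> stays in the ball. Integrating out \<tau> then yields the Riesz
  kernel.\<close>

lemma poincare_riesz:
  fixes h :: "'a::euclidean_space \<Rightarrow> real" and Dh :: "'a \<Rightarrow> 'a"
  assumes der: "\<And>x. (h has_derivative (\<lambda>v. Dh x \<bullet> v)) (at x)"
    and cont: "continuous_on UNIV Dh" and y: "norm y < R"
  shows "(\<integral>\<^sup>+w\<in>ball 0 R. ennreal \<bar>h w - h y\<bar> \<partial>lborel)
    \<le> ennreal ((2 * R) ^ DIM('a) / real DIM('a)) *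
      (\<integral>\<^sup>+u\<in>ball 0 R. ennreal (norm (Dh u)) * ennreal (norm (u - y) powr (1 - real DIM('a))) \<partial>lborel)"
proof -
  let ?n = "real DIM('a)"
  have [measurable]: "Dh \<in> borel_measurable borel"
    by (rule borel_measurable_continuous_onI[OF cont])
  have R: "0 < R" using y by (metis norm_ge_zero order_le_less_trans)
  let ?H = "\<lambda>\<tau> w. if norm w < R \<and> 0 \<le> \<tau> \<and> \<tau> \<le> 1 then ennreal (norm (Dh (y + \<tau> *\<^sub>R (w - y))) * norm (w - y)) else 0"
  \<comment> \<open>Of the constraints on \<open>w\<close> only |u - y| = \<tau> |w - y| at most 2 R
    \<tau> is kept, and \<tau> may exceed 1. This loses only a constant and makes the integral over
    \<tau> explicit.\<close>
  let ?G = "\<lambda>\<tau> u. if norm u < R \<and> norm (u - y) \<le> 2 * R * \<tau>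
    then ennreal (norm (Dh u) * norm (u - y)) * ennreal (\<tau> powr (- ?n - 1)) else 0"
  have 1: "(\<integral>\<^sup>+w. ?H \<tau> w \<partial>lborel) \<le> (\<integral>\<^sup>+u. ?G \<tau> u \<partial>lborel)" if "\<tau> \<noteq> 0" for \<tau>
  proof (cases "0 < \<tau> \<and> \<tau> \<le> 1")
    case True
    let ?w = "\<lambda>u. (y - (1 / \<tau>) *\<^sub>R y) + (1 / \<tau>) *\<^sub>R u"
    have w: "?w u - y = (1 / \<tau>) *\<^sub>R (u - y)" for u by (simp add: algebra_simps)
    have "(\<integral>\<^sup>+w. ?H \<tau> w \<partial>lborel) = ennreal (\<bar>1 / \<tau>\<bar> ^ DIM('a)) * (\<integral>\<^sup>+u. ?H \<tau> (?w u) \<partial>lborel)"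
    proof (rule nn_integral_lborel_affine)
      show "?H \<tau> \<in> borel_measurable borel" by measurable
    qed (use True in simp)
    also have "\<dots> = (\<integral>\<^sup>+u. ennreal (\<bar>1 / \<tau>\<bar> ^ DIM('a)) * ?H \<tau> (?w u) \<partial>lborel)"
      by (rule nn_integral_cmult[symmetric]) measurable
    also have "\<dots> \<le> (\<integral>\<^sup>+u. ?G \<tau> u \<partial>lborel)"
    proof (rule nn_integral_mono)
      fix u
      show "ennreal (\<bar>1 / \<tau>\<bar> ^ DIM('a)) * ?H \<tau> (?w u) \<le> ?G \<tau> u"
      proof (cases "norm (?w u) < R")
        case wR: True
        have u: "y + \<tau> *\<^sub>R (?w u - y) = u"
        proof -
          have "\<tau> \<noteq> 0" using True by simp
          then show ?thesis by (simp add: w)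
        qed
        have "u = (1 - \<tau>) *\<^sub>R y + \<tau> *\<^sub>R ?w u"
        proof -
          have "(1 - \<tau>) *\<^sub>R a + \<tau> *\<^sub>R b = a + \<tau> *\<^sub>R (b - a)" for a b :: 'a
            by (simp add: algebra_simps)
          then show ?thesis using u by simp
        qed
        moreover have "(1 - \<tau>) *\<^sub>R y + \<tau> *\<^sub>R ?w u \<in> ball 0 R"
          using convexD_alt[OF convex_ball, of y 0 R "?w u" \<tau>] wR y True by simp
        ultimately have uR: "norm u < R" by simp
        have nw: "norm (?w u - y) = norm (u - y) / \<tau>"
          unfolding w using True by simp
        have "norm (?w u - y) \<le> 2 * R"
          using norm_triangle_ineq4[of "?w u" y] wR y by linarith
        then have le: "norm (u - y) \<le> 2 * R * \<tau>"
          unfolding nw using True by (simp add: divide_le_eq)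
        have "\<bar>1 / \<tau>\<bar> ^ DIM('a) * (norm (Dh u) * (norm (u - y) / \<tau>))
            = (norm (Dh u) * norm (u - y)) * \<tau> powr (- ?n - 1)"
          using True by (simp add: powr_diff powr_minus powr_realpow power_one_over power_inverse divide_inverse)
        then have "ennreal (\<bar>1 / \<tau>\<bar> ^ DIM('a)) * ennreal (norm (Dh u) * (norm (u - y) / \<tau>))
            = ennreal (norm (Dh u) * norm (u - y)) * ennreal (\<tau> powr (- ?n - 1))"
          using True by (simp add: ennreal_mult[symmetric])
        then show ?thesis
          using wR uR le True unfolding u nw by simp
      qed simp
    qed
    finally show ?thesis .
  next
    case False
    then have "?H \<tau> w = 0" for w using that by auto
    then show ?thesis by simp
  qed
  have 2: "(\<integral>\<^sup>+\<tau>. ?G \<tau> u \<partial>lborel) \<le> ennreal ((2 * R) ^ DIM('a) / ?n) *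
      (ennreal (norm (Dh u)) * ennreal (norm (u - y) powr (1 - ?n)) * indicator (ball 0 R) u)" for u
  proof (cases "norm u < R \<and> u \<noteq> y")
    case True
    \<comment> \<open>The smallest \<tau> for which \<open>u\<close> is still reached; b to the
      power -n is the source of the factor \<open>(2 * R) ^ DIM('a)\<close>.\<close>
    define b where "b = norm (u - y) / (2 * R)"
    have b: "0 < b" "norm (u - y) = 2 * R * b" using True R by (auto simp: b_def)
    have "(\<integral>\<^sup>+\<tau>. ?G \<tau> u \<partial>lborel)
      = (\<integral>\<^sup>+\<tau>. ennreal (norm (Dh u) * norm (u - y)) * (ennreal (\<tau> powr (- ?n - 1)) * indicator {b..} \<tau>) \<partial>lborel)"
      using True R b by (intro nn_integral_cong) (auto simp: indicator_def)
    also have "\<dots> = ennreal (norm (Dh u) * norm (u - y)) * ennreal (b powr (- ?n) / ?n)"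
      by (subst nn_integral_cmult, measurable) (simp add: nn_integral_powr_atLeast b(1))
    also have "\<dots> = ennreal ((2 * R) ^ DIM('a) / ?n) * (ennreal (norm (Dh u)) * ennreal (norm (u - y) powr (1 - ?n)))"
    proof -
      have "norm (Dh u) * norm (u - y) * (b powr (- ?n) / ?n)
          = (2 * R) ^ DIM('a) / ?n * (norm (Dh u) * norm (u - y) powr (1 - ?n))"
        unfolding b(2) using b R
        by (simp add: powr_diff powr_mult powr_minus powr_realpow field_simps)
      then show ?thesis using R b by (simp add: ennreal_mult[symmetric])
    qed
    finally show ?thesis using True by simp
  next
    case False
    then have "?G \<tau> u = 0" for \<tau> by auto
    then show ?thesis by simp
  qed
  have "(\<integral>\<^sup>+w\<in>ball 0 R. ennreal \<bar>h w - h y\<bar> \<partial>lborel) \<le> (\<integral>\<^sup>+w. \<integral>\<^sup>+\<tau>. ?H \<tau> w \<partial>lborel \<partial>lborel)"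
  proof (rule nn_integral_mono)
    fix w
    show "ennreal \<bar>h w - h y\<bar> * indicator (ball 0 R) w \<le> (\<integral>\<^sup>+\<tau>. ?H \<tau> w \<partial>lborel)"
    proof (cases "norm w < R")
      case True
      have "(\<integral>\<^sup>+\<tau>. ?H \<tau> w \<partial>lborel) = (\<integral>\<^sup>+\<tau>\<in>{0..1}. ennreal (norm (Dh (y + \<tau> *\<^sub>R (w - y))) * norm (w - y)) \<partial>lborel)"
        using True by (intro nn_integral_cong) (auto simp: indicator_def)
      then show ?thesis
        using True abs_diff_le_segment_integral[OF der cont, of w y] by simp
    qed simp
  qed
  also have "\<dots> = (\<integral>\<^sup>+\<tau>. \<integral>\<^sup>+w. ?H \<tau> w \<partial>lborel \<partial>lborel)"
    by (rule lborel_pair.Fubini') measurable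
  also have "\<dots> \<le> (\<integral>\<^sup>+\<tau>. \<integral>\<^sup>+u. ?G \<tau> u \<partial>lborel \<partial>lborel)"
  proof (rule nn_integral_mono_AE)
    have "AE \<tau> in lborel. \<tau> \<noteq> (0::real)" by (rule AE_lborel_singleton)
    then show "AE \<tau> in lborel. (\<integral>\<^sup>+w. ?H \<tau> w \<partial>lborel) \<le> (\<integral>\<^sup>+u. ?G \<tau> u \<partial>lborel)"
      by eventually_elim (rule 1)
  qed
  also have "\<dots> = (\<integral>\<^sup>+u. \<integral>\<^sup>+\<tau>. ?G \<tau> u \<partial>lborel \<partial>lborel)"
    by (rule lborel_pair.Fubini') measurable
  also have "\<dots> \<le> (\<integral>\<^sup>+u. ennreal ((2 * R) ^ DIM('a) / ?n) *
      (ennreal (norm (Dh u)) * ennreal (norm (u - y) powr (1 - ?n)) * indicator (ball 0 R) u) \<partial>lborel)"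
    by (intro nn_integral_mono 2)
  also have "\<dots> = ennreal ((2 * R) ^ DIM('a) / ?n) *
      (\<integral>\<^sup>+u\<in>ball 0 R. ennreal (norm (Dh u)) * ennreal (norm (u - y) powr (1 - ?n)) \<partial>lborel)"
    by (intro nn_integral_cmult) measurable
  finally show ?thesis .
qed

subsection \<open>Rough singular integrals\<close>

text \<open>As the kernel has mean zero on the shell, any value \<open>h w\<close> may be subtracted from \<open>h\<close>;
  averaging over \<open>w\<close> brings in the Riesz potential of \<open>|\<Omega>|\<close>, restricted to the shell, tested
  against \<open>|\<nabla>h|\<close>.\<close>

lemma rough_integral_shell_le:
  fixes \<Omega> :: "'a::euclidean_space \<Rightarrow> real"
  defines "S \<equiv> {y. 1 < norm y \<and> norm y \<le> 2}"
  assumes \<Omega> [measurable]: "\<Omega> \<in> borel_measurable borel"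
    and \<rho>: "1 < \<rho>" "\<rho> < real DIM('a)" and s: "1 / s = 1 - 1 / \<rho> + 1 / real DIM('a)"
    and int: "integrable lborel (\<lambda>y. indicator S y * (\<Omega> (sgn y) / norm y ^ DIM('a)))"
    and zero: "(LINT y|lborel. indicator S y * (\<Omega> (sgn y) / norm y ^ DIM('a))) = 0"
    and fin: "(\<integral>\<^sup>+y\<in>S. ennreal (\<bar>\<Omega> (sgn y)\<bar> powr \<rho>) \<partial>lborel) < top"
  obtains C where "0 < C"
    "\<And>h Dh. (\<And>x. (h has_derivative (\<lambda>v. Dh x \<bullet> v)) (at x)) \<Longrightarrow> continuous_on UNIV Dh \<Longrightarrow>
      integrable lborel (\<lambda>y. indicator S y * (\<Omega> (sgn y) / norm y ^ DIM('a)) * h y) \<Longrightarrow>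
      ennreal \<bar>LINT y|lborel. indicator S y * (\<Omega> (sgn y) / norm y ^ DIM('a)) * h y\<bar>
      \<le> ennreal C * epowr (\<integral>\<^sup>+u\<in>ball 0 3. epowr (ennreal (norm (Dh u))) s \<partial>lborel) (1 / s)"
proof -
  let ?n = "real DIM('a)"
  have S [measurable]: "S \<in> sets borel" unfolding S_def by measurable
  define k where "k y = indicator S y * (\<Omega> (sgn y) / norm y ^ DIM('a))" for y
  \<comment> \<open>The factor \<open>norm y ^ DIM('a)\<close> is dropped because it is at least 1
    on the shell.\<close>
  define g where "g y = ennreal (indicator S y * \<bar>\<Omega> (sgn y)\<bar>)" for y
  have [measurable]: "k \<in> borel_measurable borel" "g \<in> borel_measurable borel"
    unfolding k_def g_def by measurable
  \<comment> \<open>The Sobolev exponent of \<rho>. By the relation \<open>s\<close> it is the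
    Hoelder conjugate of \<open>s\<close>.\<close>
  define r where "r = 1 / (1 / \<rho> - 1 / ?n)"
  have "1 / ?n < 1 / \<rho>" "1 / \<rho> < 1" using \<rho> by (auto simp: frac_less2)
  then have "0 < 1 / s" "1 / s < 1" using s \<rho> by (auto simp: add_pos_pos)
  then have s1: "1 < s" by (simp add: divide_less_eq_1 split: if_splits)
  have r: "1 / r = 1 / \<rho> - 1 / ?n" by (simp add: r_def)
  have "(\<integral>\<^sup>+y. epowr (g y) \<rho> \<partial>lborel) = (\<integral>\<^sup>+y\<in>S. ennreal (\<bar>\<Omega> (sgn y)\<bar> powr \<rho>) \<partial>lborel)"
    by (intro nn_integral_cong) (auto simp: g_def indicator_def)
  then have "(\<integral>\<^sup>+u. epowr (riesz g u) r \<partial>lborel) < top"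
    using fin by (intro hardy_littlewood_sobolev[OF _ \<rho> r]) auto
  then have "epowr (\<integral>\<^sup>+u. epowr (riesz g u) r \<partial>lborel) (1 / r) < top"
    by (simp add: less_top[symmetric])
  \<comment> \<open>The only place where \<rho>-integrability of \<Omega> enters; \<open>E\<close>
    depends on \<Omega> but not on \<open>h\<close>.\<close>
  then obtain E where E: "epowr (\<integral>\<^sup>+u. epowr (riesz g u) r \<partial>lborel) (1 / r) = ennreal E" "0 \<le> E"
    by (cases "epowr (\<integral>\<^sup>+u. epowr (riesz g u) r \<partial>lborel) (1 / r)") auto
  define V where "V = unit_ball_vol ?n * 3 ^ DIM('a)"
  have V: "0 < V" "emeasure lborel (ball 0 3 :: 'a set) = ennreal V"
    by (simp_all add: V_def emeasure_ball)
  define c where "c = (2 * 3) ^ DIM('a) / ?n"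
  have c: "0 < c" by (simp add: c_def)
  show ?thesis
  proof (rule that)
    \<comment> \<open>\<open>E\<close> vanishes when \<Omega> does, so 1 is added to keep the
      constant positive.\<close>
    show "0 < c * E / V + 1" using c E V by (intro add_nonneg_pos) auto
    fix h :: "'a \<Rightarrow> real" and Dh
    assume der: "\<And>x. (h has_derivative (\<lambda>v. Dh x \<bullet> v)) (at x)"
      and cont: "continuous_on UNIV Dh"
      and kh: "integrable lborel (\<lambda>y. indicator S y * (\<Omega> (sgn y) / norm y ^ DIM('a)) * h y)"
    have [measurable]: "Dh \<in> borel_measurable borel"
      by (rule borel_measurable_continuous_onI[OF cont])
    have "continuous_on UNIV h"
      using der by (auto intro!: continuous_at_imp_continuous_on has_derivative_continuous)
    then have [measurable]: "h \<in> borel_measurable borel" by (rule borel_measurable_continuous_onI)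
    define I where "I = (LINT y|lborel. k y * h y)"
    define X where "X = epowr (\<integral>\<^sup>+u\<in>ball 0 3. epowr (ennreal (norm (Dh u))) s \<partial>lborel) (1 / s)"
    have 1: "ennreal \<bar>I\<bar> \<le> (\<integral>\<^sup>+y. g y * ennreal \<bar>h w - h y\<bar> \<partial>lborel)" for w
    proof -
      have kint: "integrable lborel (\<lambda>y. k y * h y)" "integrable lborel (\<lambda>y. k y * h w)"
        using kh integrable_mult_left[OF int, of "h w"] by (simp_all only: k_def)
      have "I = (LINT y|lborel. k y * h y - k y * h w)"
      proof -
        have "(LINT y|lborel. k y * h w) = 0"
          using zero by (simp only: k_def integral_mult_left_zero)
        then show ?thesis
          unfolding I_def by (subst Bochner_Integration.integral_diff[OF kint]) simp
      qed
      then have "ennreal \<bar>I\<bar> = ennreal (norm (LINT y|lborel. k y * h y - k y * h w))" by simp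
      also have "\<dots> \<le> (\<integral>\<^sup>+y. ennreal (norm (k y * h y - k y * h w)) \<partial>lborel)"
        by (intro integral_norm_bound_ennreal Bochner_Integration.integrable_diff kint)
      also have "\<dots> \<le> (\<integral>\<^sup>+y. g y * ennreal \<bar>h w - h y\<bar> \<partial>lborel)"
      proof (rule nn_integral_mono)
        fix y
        have "\<bar>k y\<bar> \<le> indicator S y * \<bar>\<Omega> (sgn y)\<bar>"
        proof (cases "y \<in> S")
          case True
          then have "1 \<le> norm y ^ DIM('a)" by (auto simp: S_def)
          then have "\<bar>\<Omega> (sgn y)\<bar> / norm y ^ DIM('a) \<le> \<bar>\<Omega> (sgn y)\<bar> / 1"
            by (intro divide_left_mono) auto
          with True show ?thesis by (simp add: k_def)
        qed (simp add: k_def)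
        then have "\<bar>k y\<bar> * \<bar>h w - h y\<bar> \<le> indicator S y * \<bar>\<Omega> (sgn y)\<bar> * \<bar>h w - h y\<bar>"
          by (rule mult_right_mono) simp
        moreover have "norm (k y * h y - k y * h w) = \<bar>k y\<bar> * \<bar>h w - h y\<bar>"
          by (simp add: right_diff_distrib[symmetric] abs_mult abs_minus_commute)
        ultimately show "ennreal (norm (k y * h y - k y * h w)) \<le> g y * ennreal \<bar>h w - h y\<bar>"
          by (simp add: g_def ennreal_mult'[symmetric] ennreal_leI)
      qed
      finally show ?thesis .
    qed
    \<comment> \<open>The bound \<open>1\<close> holds for every \<open>w\<close>; integrating it
      over the ball of radius 3, which contains the shell, makes the Poincare inequality applicable
      for each fixed \<open>y\<close> with \<open>g y\<close> nonzero.\<close>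
    have "ennreal V * ennreal \<bar>I\<bar> = (\<integral>\<^sup>+w. ennreal \<bar>I\<bar> * indicator (ball 0 3) (w::'a) \<partial>lborel)"
      by (subst nn_integral_cmult_indicator) (auto simp: V mult.commute)
    also have "\<dots> = (\<integral>\<^sup>+w. (if norm (w::'a) < 3 then ennreal \<bar>I\<bar> else 0) \<partial>lborel)"
      by (intro nn_integral_cong) auto
    also have "\<dots> \<le> (\<integral>\<^sup>+w. \<integral>\<^sup>+y. (if norm w < 3 then g y * ennreal \<bar>h w - h y\<bar> else 0) \<partial>lborel \<partial>lborel)"
      using 1 by (intro nn_integral_mono) auto
    also have "\<dots> = (\<integral>\<^sup>+y. \<integral>\<^sup>+w. (if norm w < 3 then g y * ennreal \<bar>h w - h y\<bar> else 0) \<partial>lborel \<partial>lborel)"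
      by (rule lborel_pair.Fubini') measurable
    also have "\<dots> \<le> (\<integral>\<^sup>+y. \<integral>\<^sup>+u. ennreal c *
        (if norm u < 3 then ennreal (norm (Dh u)) * (g y * ennreal (norm (u - y) powr (1 - ?n))) else 0) \<partial>lborel \<partial>lborel)"
    proof (rule nn_integral_mono)
      fix y :: 'a
      have "(\<integral>\<^sup>+w. (if norm w < 3 then g y * ennreal \<bar>h w - h y\<bar> else 0) \<partial>lborel)
        = (\<integral>\<^sup>+w. g y * (ennreal \<bar>h w - h y\<bar> * indicator (ball 0 3) w) \<partial>lborel)"
        by (intro nn_integral_cong) auto
      also have "\<dots> = g y * (\<integral>\<^sup>+w\<in>ball 0 3. ennreal \<bar>h w - h y\<bar> \<partial>lborel)"
        by (intro nn_integral_cmult) measurable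
      also have "\<dots> \<le> g y * (ennreal c *
        (\<integral>\<^sup>+u\<in>ball 0 3. ennreal (norm (Dh u)) * ennreal (norm (u - y) powr (1 - ?n)) \<partial>lborel))"
      proof (cases "y \<in> S")
        case True
        then have "norm y < 3" by (simp add: S_def)
        then show ?thesis
          unfolding c_def by (intro mult_left_mono poincare_riesz der cont) auto
      qed (simp add: g_def)
      also have "\<dots> = (\<integral>\<^sup>+u. (g y * ennreal c) *
          (ennreal (norm (Dh u)) * ennreal (norm (u - y) powr (1 - ?n)) * indicator (ball 0 3) u) \<partial>lborel)"
        unfolding mult.assoc[symmetric, of "g y"]
        by (intro nn_integral_cmult[symmetric]) measurable
      also have "\<dots> = (\<integral>\<^sup>+u. ennreal c *
          (if norm u < 3 then ennreal (norm (Dh u)) * (g y * ennreal (norm (u - y) powr (1 - ?n))) else 0) \<partial>lborel)"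
        by (intro nn_integral_cong) (auto simp: ac_simps)
      finally show "(\<integral>\<^sup>+w. (if norm w < 3 then g y * ennreal \<bar>h w - h y\<bar> else 0) \<partial>lborel) \<le> \<dots>" .
    qed
    also have "\<dots> = (\<integral>\<^sup>+u. \<integral>\<^sup>+y. ennreal c *
        (if norm u < 3 then ennreal (norm (Dh u)) * (g y * ennreal (norm (u - y) powr (1 - ?n))) else 0) \<partial>lborel \<partial>lborel)"
      by (rule lborel_pair.Fubini') measurable
    also have "\<dots> = (\<integral>\<^sup>+u. ennreal c * ((ennreal (norm (Dh u)) * indicator (ball 0 3) u) * riesz g u) \<partial>lborel)"
    proof (rule nn_integral_cong)
      fix u :: 'a
      show "(\<integral>\<^sup>+y. ennreal c * (if norm u < 3 then ennreal (norm (Dh u)) * (g y * ennreal (norm (u - y) powr (1 - ?n))) else 0) \<partial>lborel)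
        = ennreal c * ((ennreal (norm (Dh u)) * indicator (ball 0 3) u) * riesz g u)"
        by (cases "norm u < 3") (simp_all add: nn_integral_cmult riesz_def)
    qed
    also have "\<dots> = ennreal c * (\<integral>\<^sup>+u. (ennreal (norm (Dh u)) * indicator (ball 0 3) u) * riesz g u \<partial>lborel)"
      unfolding riesz_def
      by (intro nn_integral_cmult) measurable
    also have "\<dots> \<le> ennreal c * (epowr (\<integral>\<^sup>+u. epowr (ennreal (norm (Dh u)) * indicator (ball 0 3) u) s \<partial>lborel) (1 / s) *
        epowr (\<integral>\<^sup>+u. epowr (riesz g u) r \<partial>lborel) (1 / r))"
    proof (intro mult_left_mono nn_integral_holder s1)
      show "1 / s + 1 / r = 1" using s r by simp
      show "riesz g \<in> borel_measurable lborel" unfolding riesz_def by measurable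
      show "(\<lambda>u. ennreal (norm (Dh u)) * indicator (ball 0 3) u) \<in> borel_measurable lborel"
        by (intro borel_measurable_times_ennreal borel_measurable_indicator) auto
    qed auto
    also have "(\<integral>\<^sup>+u. epowr (ennreal (norm (Dh u)) * indicator (ball 0 3) u) s \<partial>lborel)
        = (\<integral>\<^sup>+u\<in>ball 0 3. epowr (ennreal (norm (Dh u))) s \<partial>lborel)"
      by (intro nn_integral_cong) (auto simp: indicator_def)
    finally have "ennreal V * ennreal \<bar>I\<bar> \<le> ennreal c * (X * ennreal E)"
      by (simp add: E X_def)
    then have "ennreal (1 / V) * (ennreal V * ennreal \<bar>I\<bar>) \<le> ennreal (1 / V) * (ennreal c * (X * ennreal E))"
      by (rule mult_left_mono) simp
    also have "ennreal (1 / V) * (ennreal V * ennreal \<bar>I\<bar>) = ennreal \<bar>I\<bar>"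
      using V by (simp add: ennreal_mult[symmetric])
    also have "ennreal (1 / V) * (ennreal c * (X * ennreal E)) = ennreal (c * E / V) * X"
    proof -
      have "ennreal (c * E / V) = ennreal (1 / V) * (ennreal c * ennreal E)"
        using V c E by (simp add: ennreal_mult'[symmetric])
      then show ?thesis by (simp only: ac_simps)
    qed
    also have "\<dots> \<le> ennreal (c * E / V + 1) * X"
      by (intro mult_right_mono ennreal_leI) auto
    finally show "ennreal \<bar>LINT y|lborel. indicator S y * (\<Omega> (sgn y) / norm y ^ DIM('a)) * h y\<bar>
      \<le> ennreal (c * E / V + 1) * epowr (\<integral>\<^sup>+u\<in>ball 0 3. epowr (ennreal (norm (Dh u))) s \<partial>lborel) (1 / s)"
      by (simp add: I_def k_def X_def)
  qed
qed

subsection \<open>Muckenhoupt weights\<close>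

text \<open>Local integrability gives only Lebesgue measurability, as a pointwise limit of
  restrictions to growing balls. A Borel representative that is positive everywhere allows the
  weighted measure to live on the Borel sets.\<close>

lemma weight_borel_version:
  fixes \<omega> :: "real ^ 'n \<Rightarrow> real"
  assumes "weight \<omega>"
  obtains w where "w \<in> borel_measurable borel" "\<And>x. 0 < w x" "AE x in lborel. \<omega> x = w x"
proof -
  have "\<omega> \<in> borel_measurable lebesgue"
  proof (rule borel_measurable_LIMSEQ_real)
    fix x :: "real ^ 'n"
    obtain k :: nat where "norm x \<le> real k" using real_arch_simple by blast
    then have "\<forall>\<^sub>F i in sequentially. indicator (cball 0 (real i)) x *\<^sub>R \<omega> x = \<omega> x"
      by (intro eventually_sequentiallyI[of k]) auto
    then show "(\<lambda>i. indicator (cball 0 (real i)) x *\<^sub>R \<omega> x) \<longlonglongrightarrow> \<omega> x"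
      by (rule tendsto_eventually)
  next
    fix i :: nat
    have "\<omega> absolutely_integrable_on cball 0 (real i)"
      using assms by (simp add: weight_def)
    then show "(\<lambda>x. indicator (cball 0 (real i)) x *\<^sub>R \<omega> x) \<in> borel_measurable lebesgue"
      unfolding set_integrable_def by (rule borel_measurable_integrable)
  qed
  then obtain w0 where w0: "w0 \<in> borel_measurable lborel" "AE x in lborel. \<omega> x = w0 x"
    using completion_ex_borel_measurable_real by blast
  show ?thesis
  \<comment> \<open>Where \<open>w0\<close> fails to be positive it cannot equal \<omega>, so
    resetting it to 1 there changes it only on a null set.\<close>
  proof (rule that[of "\<lambda>x. if 0 < w0 x then w0 x else 1"])
    show "(\<lambda>x. if 0 < w0 x then w0 x else 1) \<in> borel_measurable borel"
      using w0(1) by simp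
    show "AE x in lborel. \<omega> x = (if 0 < w0 x then w0 x else 1)"
      using w0(2)
    proof eventually_elim
      case (elim x)
      then show ?case using assms by (metis weight_def)
    qed
  qed simp
qed

lemma nn_integral_lebesgue_cong_lborel:
  assumes "AE x in lborel. f x = g x"
  shows "(\<integral>\<^sup>+x. f x \<partial>lebesgue) = (\<integral>\<^sup>+x. g x \<partial>lborel)"
  unfolding nn_integral_completion by (rule nn_integral_cong_AE[OF assms])

locale borel_weight =
  fixes \<omega> w :: "real ^ 'n \<Rightarrow> real"
  assumes weight: "weight \<omega>"
    and w_meas [measurable]: "w \<in> borel_measurable borel"
    and w_pos: "0 < w x"
    and AE_eq: "AE x in lborel. \<omega> x = w x"
begin

definition \<nu> :: "(real ^ 'n) measure" where
  "\<nu> = density lborel (\<lambda>x. ennreal (w x))"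

lemma sets_\<nu> [measurable_cong, simp]: "sets \<nu> = sets borel"
  by (simp add: \<nu>_def)

lemma nn_integral_\<nu>:
  assumes [measurable]: "g \<in> borel_measurable borel"
  shows "(\<integral>\<^sup>+y. g y \<partial>\<nu>) = (\<integral>\<^sup>+y. g y * ennreal (w y) \<partial>lborel)"
  by (simp add: \<nu>_def nn_integral_density mult.commute)

lemma nn_integral_\<omega>:
  assumes "g \<in> borel_measurable borel"
  shows "(\<integral>\<^sup>+y. g y * ennreal (\<omega> y) \<partial>lebesgue) = (\<integral>\<^sup>+y. g y \<partial>\<nu>)"
  unfolding nn_integral_\<nu>[OF assms]
  by (rule nn_integral_lebesgue_cong_lborel) (use AE_eq in \<open>eventually_elim, simp\<close>)

lemma wmeas_eq: "A \<in> sets borel \<Longrightarrow> wmeas \<omega> A = emeasure \<nu> A"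
  unfolding wmeas_def using nn_integral_\<omega>[of "indicator A"]
  by (simp add: mult.commute)

lemma emeasure_\<nu>_ball_finite: "emeasure \<nu> (ball x r) < top"
proof -
  have "\<omega> absolutely_integrable_on cball x r" using weight by (simp add: weight_def)
  then have "integrable lebesgue (\<lambda>y. indicator (cball x r) y *\<^sub>R \<omega> y)"
    by (simp add: set_integrable_def)
  then have fin: "(\<integral>\<^sup>+y. ennreal (norm (indicator (cball x r) y *\<^sub>R \<omega> y)) \<partial>lebesgue) < \<infinity>"
    by (simp add: integrable_iff_bounded)
  have "emeasure \<nu> (ball x r) = (\<integral>\<^sup>+y\<in>ball x r. ennreal (\<omega> y) \<partial>lebesgue)"
    using wmeas_eq[of "ball x r"] by (simp add: wmeas_def)
  also have "\<dots> \<le> (\<integral>\<^sup>+y. ennreal (norm (indicator (cball x r) y *\<^sub>R \<omega> y)) \<partial>lebesgue)"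
    by (intro nn_integral_mono) (auto simp: indicator_def intro!: ennreal_leI)
  finally show ?thesis using fin by (simp add: order_le_less_trans)
qed

lemma emeasure_\<nu>_ball_pos:
  assumes "0 < r"
  shows "0 < emeasure \<nu> (ball x r)"
proof (rule ccontr)
  assume "\<not> ?thesis"
  then have "(\<integral>\<^sup>+y\<in>ball x r. ennreal (w y) \<partial>lborel) = 0"
    by (simp add: \<nu>_def emeasure_density)
  then have "AE y in lborel. ennreal (w y) * indicator (ball x r) y = 0"
    by (subst (asm) nn_integral_0_iff_AE) (auto intro!: borel_measurable_times_ennreal borel_measurable_indicator)
  then have "AE y in lborel. y \<notin> ball x r"
  proof eventually_elim
    case (elim y)
    then show ?case using w_pos[of y] by (auto simp: indicator_def ennreal_eq_0_iff)
  qed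
  then have "emeasure lborel (ball x r) = 0"
    by (subst (asm) AE_iff_measurable[of "ball x r"]) auto
  then show False
    using assms unit_ball_vol_pos[of "real CARD('n)"] by (simp add: emeasure_ball)
qed

lemma emeasure_\<nu>_ball_cases:
  assumes "0 < r"
  obtains m where "emeasure \<nu> (ball x r) = ennreal m" "0 < m"
  using emeasure_\<nu>_ball_pos[OF assms, of x] emeasure_\<nu>_ball_finite[of x r]
  by (cases "emeasure \<nu> (ball x r)") auto

lemma ball_avg_\<omega>: "ball_avg \<omega> x r = emeasure \<nu> (ball x r) / emeasure lborel (ball x r)"
  using wmeas_eq[of "ball x r"] by (simp add: ball_avg_def wmeas_def)

text \<open>Inserting 1 = (1/w) w under the integral bounds it by the essential supremum
  \<open>E\<close> of 1/\<omega> times the integral with respect to \<nu>; the condition with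
  \<delta> = 1 says that \<open>E\<close> is at most a constant times the ratio of the Lebesgue to
  the weighted measure of the ball.\<close>

lemma muckenhoupt_1_bound:
  assumes A: "muckenhoupt_const 1 \<omega> \<le> ennreal a" and r: "0 < r"
    and [measurable]: "h \<in> borel_measurable borel"
  shows "(\<integral>\<^sup>+y\<in>ball x r. h y \<partial>lborel)
    \<le> ennreal a * emeasure lborel (ball x r) * ((\<integral>\<^sup>+y\<in>ball x r. h y \<partial>\<nu>) / emeasure \<nu> (ball x r))"
proof -
  let ?B = "ball x r"
  define E where "E = esssup (restrict_space lebesgue ?B) (\<lambda>y. ennreal (inverse (\<omega> y)))"
  obtain m where m: "emeasure \<nu> ?B = ennreal m" "0 < m"
      using emeasure_\<nu>_ball_cases[OF r] .
  obtain v where v: "emeasure lborel ?B = ennreal v" "0 < v"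
    using r by (simp add: emeasure_ball)
  have "ball_avg \<omega> x r * E \<le> muckenhoupt_const 1 \<omega>"
    unfolding muckenhoupt_const_def E_def using r by (intro SUP_upper2[of x] SUP_upper2[of r]) auto
  then have "ennreal (m / v) * E \<le> ennreal a"
    using A m v by (simp add: ball_avg_\<omega> divide_ennreal)
  then have "ennreal (v / m) * (ennreal (m / v) * E) \<le> ennreal (v / m) * ennreal a"
    by (rule mult_left_mono) simp
  moreover have "ennreal (v / m) * (ennreal (m / v) * E) = E"
    using m v by (simp add: mult.assoc[symmetric] ennreal_mult[symmetric])
  ultimately have E: "E \<le> ennreal (v / m) * ennreal a" by simp
  have "AE y in restrict_space lebesgue ?B. ennreal (inverse (\<omega> y)) \<le> E"
    unfolding E_def by (rule esssup_AE)
  then have "AE y in lebesgue. y \<in> ?B \<longrightarrow> ennreal (inverse (\<omega> y)) \<le> E"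
    by (subst (asm) AE_restrict_space_iff) auto
  moreover have "AE y in lebesgue. \<omega> y = w y" using AE_eq by (rule AE_completion)
  ultimately have "AE y in lebesgue. h y * indicator ?B y \<le> E * ((h y * indicator ?B y) * ennreal (w y))"
  proof eventually_elim
    case (elim y)
    show ?case
    proof (cases "y \<in> ?B")
      case True
      have "1 = ennreal (inverse (w y)) * ennreal (w y)"
        using w_pos[of y] by (simp add: ennreal_mult[symmetric])
      also have "\<dots> \<le> E * ennreal (w y)"
        using elim True by (intro mult_right_mono) auto
      finally have "h y * 1 \<le> h y * (E * ennreal (w y))" by (rule mult_left_mono) simp
      with True show ?thesis by (simp add: ac_simps)
    qed simp
  qed
  then have "(\<integral>\<^sup>+y. h y * indicator ?B y \<partial>lebesgue) \<le> (\<integral>\<^sup>+y. E * ((h y * indicator ?B y) * ennreal (w y)) \<partial>lebesgue)"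
    by (rule nn_integral_mono_AE)
  then have "(\<integral>\<^sup>+y\<in>?B. h y \<partial>lborel) \<le> (\<integral>\<^sup>+y. E * ((h y * indicator ?B y) * ennreal (w y)) \<partial>lborel)"
    by (simp add: nn_integral_completion)
  also have "\<dots> = E * (\<integral>\<^sup>+y\<in>?B. h y \<partial>\<nu>)"
    by (subst nn_integral_\<nu>, measurable, rule nn_integral_cmult, measurable)
  also have "\<dots> \<le> ennreal (v / m) * ennreal a * (\<integral>\<^sup>+y\<in>?B. h y \<partial>\<nu>)"
    by (rule mult_right_mono[OF E]) simp
  also have "\<dots> = ennreal a * ennreal v * ((\<integral>\<^sup>+y\<in>?B. h y \<partial>\<nu>) / ennreal m)"
    using m v by (simp add: divide_ennreal_def inverse_ennreal ennreal_mult divide_inverse ac_simps)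
  finally show ?thesis using m v by simp
qed

text \<open>Hoelder with exponents \<delta> and \<delta>/(\<delta> - 1) after splitting
  \<open>h\<close> into h w^(1/\<delta>) and w^(-1/\<delta>). The conjugate power of the second
  factor is w^(-1/(\<delta> - 1)), the one whose averages the Muckenhoupt constant controls.\<close>

lemma muckenhoupt_gt1_bound:
  assumes A: "muckenhoupt_const \<delta> \<omega> \<le> ennreal a" and r: "0 < r" and \<delta>: "1 < \<delta>" and a: "0 \<le> a"
    and [measurable]: "h \<in> borel_measurable borel"
  shows "(\<integral>\<^sup>+y\<in>ball x r. h y \<partial>lborel)
    \<le> ennreal (a powr (1 / \<delta>)) * emeasure lborel (ball x r) *
      epowr ((\<integral>\<^sup>+y\<in>ball x r. epowr (h y) \<delta> \<partial>\<nu>) / emeasure \<nu> (ball x r)) (1 / \<delta>)"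
proof -
  let ?B = "ball x r"
  obtain m where m: "emeasure \<nu> ?B = ennreal m" "0 < m"
      using emeasure_\<nu>_ball_cases[OF r] .
  obtain v where v: "emeasure lborel ?B = ennreal v" "0 < v"
    using r by (simp add: emeasure_ball)
  define e where "e = - 1 / (\<delta> - 1)"
  define J where "J = (\<integral>\<^sup>+y\<in>?B. ennreal (w y powr e) \<partial>lborel)"
  define H where "H = (\<integral>\<^sup>+y\<in>?B. epowr (h y) \<delta> \<partial>\<nu>)"
  have "(\<integral>\<^sup>+y\<in>?B. ennreal (\<omega> y powr e) \<partial>lebesgue) = J"
    unfolding J_def by (rule nn_integral_lebesgue_cong_lborel) (use AE_eq in \<open>eventually_elim, simp\<close>)
  then have "ball_avg (\<lambda>y. \<omega> y powr e) x r = J / ennreal v"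
    using v by (simp add: ball_avg_def)
  moreover have "ball_avg \<omega> x r * epowr (ball_avg (\<lambda>y. \<omega> y powr e) x r) (\<delta> - 1) \<le> muckenhoupt_const \<delta> \<omega>"
    unfolding muckenhoupt_const_def e_def using r \<delta> by (intro SUP_upper2[of x] SUP_upper2[of r]) auto
  ultimately have "ennreal (m / v) * epowr (J / ennreal v) (\<delta> - 1) \<le> ennreal a"
    using A m v by (simp add: ball_avg_\<omega> divide_ennreal)
  then have "ennreal (v / m) * (ennreal (m / v) * epowr (J / ennreal v) (\<delta> - 1)) \<le> ennreal (v / m) * ennreal a"
    by (rule mult_left_mono) simp
  moreover have "ennreal (v / m) * (ennreal (m / v) * X) = X" for X
    using m v by (simp add: mult.assoc[symmetric] ennreal_mult[symmetric])
  ultimately have "epowr (J / ennreal v) (\<delta> - 1) \<le> ennreal (v / m) * ennreal a" by simp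
  then have "epowr (epowr (J / ennreal v) (\<delta> - 1)) (1 / \<delta>) \<le> epowr (ennreal (v / m) * ennreal a) (1 / \<delta>)"
    using \<delta> by (intro epowr_mono) auto
  then have J: "epowr (J / ennreal v) ((\<delta> - 1) / \<delta>) \<le> ennreal ((v * a / m) powr (1 / \<delta>))"
    using m v a \<delta> by (simp add: epowr_epowr ennreal_mult[symmetric])
  \<comment> \<open>Hoelder produces a power of the integral \<open>J\<close>, whereas the
    Muckenhoupt condition bounds the average J/v.\<close>
  have vJ: "epowr J ((\<delta> - 1) / \<delta>) = ennreal (v powr ((\<delta> - 1) / \<delta>)) * epowr (J / ennreal v) ((\<delta> - 1) / \<delta>)"
  proof -
    have "J = ennreal v * (J / ennreal v)"
      using v by (simp add: ennreal_times_divide mult.commute[of "ennreal v"] mult_divide_eq_ennreal)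
    then have "epowr J ((\<delta> - 1) / \<delta>) = epowr (ennreal v * (J / ennreal v)) ((\<delta> - 1) / \<delta>)" by simp
    also have "\<dots> = ennreal (v powr ((\<delta> - 1) / \<delta>)) * epowr (J / ennreal v) ((\<delta> - 1) / \<delta>)"
      using v \<delta> by (subst epowr_mult) auto
    finally show ?thesis .
  qed
  have split: "h y * indicator ?B y = (h y * ennreal (w y powr (1 / \<delta>)) * indicator ?B y) * (ennreal (w y powr (- 1 / \<delta>)) * indicator ?B y)" for y
  proof -
    have "ennreal (w y powr (1 / \<delta>)) * ennreal (w y powr (- 1 / \<delta>)) = 1"
      using w_pos[of y] by (simp add: ennreal_mult[symmetric] powr_add[symmetric])
    then show ?thesis by (auto simp: indicator_def mult.assoc)
  qed
  have "(\<integral>\<^sup>+y\<in>?B. h y \<partial>lborel)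
    \<le> epowr (\<integral>\<^sup>+y. epowr (h y * ennreal (w y powr (1 / \<delta>)) * indicator ?B y) \<delta> \<partial>lborel) (1 / \<delta>) *
      epowr (\<integral>\<^sup>+y. epowr (ennreal (w y powr (- 1 / \<delta>)) * indicator ?B y) (\<delta> / (\<delta> - 1)) \<partial>lborel) (1 / (\<delta> / (\<delta> - 1)))"
    unfolding split using \<delta> by (intro nn_integral_holder) (auto simp: field_simps)
  also have "(\<integral>\<^sup>+y. epowr (h y * ennreal (w y powr (1 / \<delta>)) * indicator ?B y) \<delta> \<partial>lborel) = H"
    unfolding H_def
  proof (subst nn_integral_\<nu>)
    show "(\<integral>\<^sup>+y. epowr (h y * ennreal (w y powr (1 / \<delta>)) * indicator ?B y) \<delta> \<partial>lborel)
      = (\<integral>\<^sup>+y. epowr (h y) \<delta> * indicator ?B y * ennreal (w y) \<partial>lborel)"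
      using \<delta> w_pos by (intro nn_integral_cong) (auto simp: indicator_def epowr_mult powr_powr less_imp_le)
  qed measurable
  also have "(\<integral>\<^sup>+y. epowr (ennreal (w y powr (- 1 / \<delta>)) * indicator ?B y) (\<delta> / (\<delta> - 1)) \<partial>lborel) = J"
    unfolding J_def e_def using \<delta> by (intro nn_integral_cong) (auto simp: indicator_def powr_powr)
  also have "epowr J (1 / (\<delta> / (\<delta> - 1))) \<le> ennreal (v powr ((\<delta> - 1) / \<delta>)) * ennreal ((v * a / m) powr (1 / \<delta>))"
    using mult_left_mono[OF J, of "ennreal (v powr ((\<delta> - 1) / \<delta>))"] by (simp add: vJ)
  also have "\<dots> = ennreal (a powr (1 / \<delta>)) * ennreal v * ennreal ((1 / m) powr (1 / \<delta>))"
  proof -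
    have "v powr ((\<delta> - 1) / \<delta>) * v powr (1 / \<delta>) = v"
      using v \<delta> by (simp add: powr_add[symmetric] diff_divide_distrib)
    moreover have "(v * a / m) powr (1 / \<delta>) = v powr (1 / \<delta>) * (a powr (1 / \<delta>) * (1 / m) powr (1 / \<delta>))"
      using v a m by (simp add: powr_mult powr_divide)
    ultimately have "v powr ((\<delta> - 1) / \<delta>) * (v * a / m) powr (1 / \<delta>) = a powr (1 / \<delta>) * v * (1 / m) powr (1 / \<delta>)"
      by (metis mult.assoc mult.commute)
    then show ?thesis using v by (simp add: ennreal_mult'[symmetric])
  qed
  finally have "(\<integral>\<^sup>+y\<in>?B. h y \<partial>lborel)
    \<le> epowr H (1 / \<delta>) * (ennreal (a powr (1 / \<delta>)) * ennreal v * ennreal ((1 / m) powr (1 / \<delta>)))"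
    by (simp add: mult_left_mono)
  also have "\<dots> = ennreal (a powr (1 / \<delta>)) * ennreal v * epowr (H / ennreal m) (1 / \<delta>)"
  proof -
    have "epowr (H / ennreal m) (1 / \<delta>) = epowr H (1 / \<delta>) * ennreal ((1 / m) powr (1 / \<delta>))"
      using m \<delta> by (simp add: divide_ennreal_def inverse_ennreal epowr_mult divide_inverse)
    then show ?thesis by (simp only: ac_simps)
  qed
  finally show ?thesis using m v by (simp add: H_def)
qed

lemma muckenhoupt_bound:
  assumes "A_weight \<delta> \<omega>" "1 \<le> \<delta>"
  obtains K where "0 < K" "\<And>h x r. h \<in> borel_measurable borel \<Longrightarrow> 0 < r \<Longrightarrow> (\<integral>\<^sup>+y\<in>ball x r. h y \<partial>lborel)
    \<le> ennreal K * emeasure lborel (ball x r) *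
      epowr ((\<integral>\<^sup>+y\<in>ball x r. epowr (h y) \<delta> \<partial>\<nu>) / emeasure \<nu> (ball x r)) (1 / \<delta>)"
proof -
  \<comment> \<open>The maximum with 1 guarantees that the constant obtained is positive.\<close>
  define a where "a = max 1 (enn2real (muckenhoupt_const \<delta> \<omega>))"
  have a: "0 < a" by (simp add: a_def)
  have "muckenhoupt_const \<delta> \<omega> < top" using assms(1) by (simp add: A_weight_def)
  then have A: "muckenhoupt_const \<delta> \<omega> \<le> ennreal a"
    by (cases "muckenhoupt_const \<delta> \<omega>") (auto simp: a_def intro!: ennreal_leI)
  show ?thesis
  proof (rule that[of "a powr (1 / \<delta>)"])
    fix h :: "real ^ 'n \<Rightarrow> ennreal" and x r assume "h \<in> borel_measurable borel" "(0::real) < r"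
    then show "(\<integral>\<^sup>+y\<in>ball x r. h y \<partial>lborel) \<le> ennreal (a powr (1 / \<delta>)) * emeasure lborel (ball x r) *
        epowr ((\<integral>\<^sup>+y\<in>ball x r. epowr (h y) \<delta> \<partial>\<nu>) / emeasure \<nu> (ball x r)) (1 / \<delta>)"
      using muckenhoupt_1_bound[of a r h x] muckenhoupt_gt1_bound[of \<delta> a r h x] A a assms(2)
      by (cases "\<delta> = 1") auto
  qed (use a in simp)
qed

text \<open>Testing the Muckenhoupt bound on the ball of radius 5 r with the indicator of the
  concentric ball of radius r compares the two weighted measures; solving for the larger one gives
  the constant (K 5^n)^\<delta>.\<close>

lemma doubling_measure_\<nu>:
  assumes "A_weight \<delta> \<omega>" "1 \<le> \<delta>" "lower_Ahlfors d \<omega>" "0 < d"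
  obtains D c where "doubling_measure \<nu> D d c"
proof -
  obtain K where K: "0 < K" "\<And>h x r. h \<in> borel_measurable borel \<Longrightarrow> 0 < r \<Longrightarrow> (\<integral>\<^sup>+y\<in>ball x r. h y \<partial>lborel)
    \<le> ennreal K * emeasure lborel (ball x r) *
      epowr ((\<integral>\<^sup>+y\<in>ball x r. epowr (h y) \<delta> \<partial>\<nu>) / emeasure \<nu> (ball x r)) (1 / \<delta>)"
    by (rule muckenhoupt_bound[OF assms(1,2)]) blast
  obtain c where c: "0 < c" "\<And>r x. 0 < r \<Longrightarrow> ennreal (c * r powr d) \<le> emeasure \<nu> (ball x r)"
    using assms(3) by (auto simp: lower_Ahlfors_def wmeas_eq)
  define D where "D = (K * 5 ^ CARD('n)) powr \<delta>"
  have "doubling_measure \<nu> D d c"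
  proof
    fix x :: "real ^ 'n" and r :: real assume r: "0 < r"
    obtain m where m: "emeasure \<nu> (ball x r) = ennreal m" "0 < m"
      using emeasure_\<nu>_ball_cases[OF r] .
    obtain M where M: "emeasure \<nu> (ball x (5 * r)) = ennreal M" "0 < M"
      using emeasure_\<nu>_ball_cases[of "5 * r" x] r by auto
    define v where "v = unit_ball_vol (real CARD('n)) * r ^ CARD('n)"
    have v: "0 < v" using r by (simp add: v_def)
    have "ennreal v = (\<integral>\<^sup>+y\<in>ball x (5 * r). indicator (ball x r) y \<partial>lborel)"
    proof -
      have "(\<integral>\<^sup>+y\<in>ball x (5 * r). indicator (ball x r) y \<partial>lborel) = (\<integral>\<^sup>+y. indicator (ball x r) y \<partial>lborel)"
        using r by (intro nn_integral_cong) (auto simp: indicator_def)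
      then show ?thesis using r by (simp add: v_def emeasure_ball)
    qed
    also have "\<dots> \<le> ennreal K * emeasure lborel (ball x (5 * r)) *
      epowr ((\<integral>\<^sup>+y\<in>ball x (5 * r). epowr (indicator (ball x r) y) \<delta> \<partial>\<nu>) / emeasure \<nu> (ball x (5 * r))) (1 / \<delta>)"
      using r by (intro K(2) borel_measurable_indicator) auto
    also have "(\<integral>\<^sup>+y\<in>ball x (5 * r). epowr (indicator (ball x r) y) \<delta> \<partial>\<nu>) = (\<integral>\<^sup>+y. indicator (ball x r) y \<partial>\<nu>)"
      using r by (intro nn_integral_cong) (auto simp: indicator_def)
    also have "\<dots> = ennreal m" using m by simp
    also have "emeasure lborel (ball x (5 * r)) = ennreal (5 ^ CARD('n) * v)"
      using r by (simp add: emeasure_ball v_def power_mult_distrib ac_simps)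
    also have "ennreal K * ennreal (5 ^ CARD('n) * v) * epowr (ennreal m / emeasure \<nu> (ball x (5 * r))) (1 / \<delta>)
      = ennreal (K * (5 ^ CARD('n) * v) * (m / M) powr (1 / \<delta>))"
      using K(1) v m(2) M by (simp add: divide_ennreal ennreal_mult[symmetric])
    finally have "v \<le> K * (5 ^ CARD('n) * v) * (m / M) powr (1 / \<delta>)"
      using K(1) v by (subst (asm) ennreal_le_iff) auto
    then have "1 \<le> (K * 5 ^ CARD('n)) * (m / M) powr (1 / \<delta>)"
      using v by (simp add: mult.assoc[symmetric] mult.commute[of _ v])
    then have "1 powr \<delta> \<le> ((K * 5 ^ CARD('n)) * (m / M) powr (1 / \<delta>)) powr \<delta>"
      using assms(2) by (intro powr_mono2) auto
    also have "\<dots> = D * (m / M)"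
      using K(1) assms(2) m M by (simp add: powr_mult powr_powr D_def)
    finally have "M \<le> D * m" using M by (simp add: field_simps)
    then show "emeasure \<nu> (ball x (5 * r)) \<le> ennreal D * emeasure \<nu> (ball x r)"
      using m M by (simp add: ennreal_mult'[symmetric] ennreal_leI D_def)
  qed (use c emeasure_\<nu>_ball_finite assms K(1) in \<open>auto simp: D_def\<close>)
  then show ?thesis by (rule that)
qed

end

subsection \<open>Kernels on the sphere\<close>

text \<open>The surface measure before completion. Being defined on the Borel sets of the sphere, it
  integrates Borel functions as an image measure under \<open>sgn\<close>.\<close>

definition cone_measure :: "(real ^ 'n) measure" where
  "cone_measure = scale_measure (of_nat CARD('n))
     (distr (restrict_space lborel (ball 0 1 - {0})) (restrict_space borel (sphere 0 1)) sgn)"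

lemma surface_measure_eq: "surface_measure = completion cone_measure"
  by (simp add: surface_measure_def cone_measure_def)

lemma sets_cone_measure [simp]: "sets cone_measure = sets (restrict_space borel (sphere 0 1))"
  by (simp add: cone_measure_def)

lemma space_cone_measure [simp]: "space cone_measure = sphere 0 1"
  using sets_eq_imp_space_eq[OF sets_cone_measure] by (simp add: space_restrict_space)

lemma nn_integral_cone_measure:
  fixes \<phi> :: "real ^ 'n \<Rightarrow> ennreal"
  assumes [measurable]: "\<phi> \<in> borel_measurable borel"
  shows "(\<integral>\<^sup>+z. \<phi> z \<partial>cone_measure) = of_nat CARD('n) * (\<integral>\<^sup>+y\<in>ball 0 1 - {0}. \<phi> (sgn y) \<partial>lborel)"
proof -
  have sgn: "sgn \<in> measurable (restrict_space lborel (ball 0 1 - {0 :: real ^ 'n})) (restrict_space borel (sphere 0 1))"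
    by (intro measurable_restrict_space2 measurable_restrict_space1)
      (auto simp: space_restrict_space norm_sgn)
  have \<phi>: "\<phi> \<in> borel_measurable (restrict_space borel (sphere 0 1))"
    by (intro measurable_restrict_space1) simp
  show ?thesis
    unfolding cone_measure_def
    by (simp add: nn_integral_scale_measure nn_integral_distr[OF sgn] \<phi> nn_integral_restrict_space)
qed

lemma nn_integral_shell_cone:
  fixes \<phi> :: "real ^ 'n \<Rightarrow> ennreal"
  assumes "\<phi> \<in> borel_measurable borel"
  shows "(\<integral>\<^sup>+w\<in>{w. 1 < norm w \<and> norm w \<le> 2}. ennreal (norm w powr - real CARD('n)) * \<phi> (sgn w) \<partial>lborel)
    = ennreal (ln 2) * (\<integral>\<^sup>+z. \<phi> z \<partial>cone_measure)"
  using nn_integral_shell[OF assms] nn_integral_cone_measure[OF assms]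
  by (simp add: ennreal_mult ennreal_of_nat_eq_real_of_nat ac_simps)

text \<open>The cone over a null set is null inside the unit ball by the definition of the measure.
  Dilations by j + 1 preserve \<open>sgn\<close>, so it is null in every larger ball too, and these
  exhaust the space.\<close>

lemma AE_cone_measure_sgn:
  assumes "AE z in cone_measure. P z"
  shows "AE y in lborel. P (sgn (y :: real ^ 'n))"
proof -
  obtain N where N: "N \<in> sets cone_measure" "emeasure cone_measure N = 0" "{z \<in> sphere 0 1. \<not> P z} \<subseteq> N"
    using AE_E[OF assms] by auto
  have [measurable]: "N \<in> sets borel"
    using N(1) by (auto simp: sets_restrict_space)
  have "(\<integral>\<^sup>+z. indicator N z \<partial>cone_measure) = 0" using N by simp
  then have 0: "(\<integral>\<^sup>+y\<in>ball 0 1 - {0}. indicator N (sgn y) \<partial>lborel) = 0"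
    by (subst (asm) nn_integral_cone_measure) auto
  have null: "AE y in lborel. \<not> (norm y < real (Suc j) \<and> 0 < norm y \<and> sgn y \<in> N)" for j
  proof -
    let ?f = "\<lambda>y. indicator N (sgn y) * (if norm y < real (Suc j) \<and> 0 < norm y then 1 else 0) :: ennreal"
    have "(\<integral>\<^sup>+y. ?f y \<partial>lborel) = ennreal (\<bar>real (Suc j)\<bar> ^ DIM(real ^ 'n)) * (\<integral>\<^sup>+y. ?f (0 + real (Suc j) *\<^sub>R y) \<partial>lborel)"
    proof (rule nn_integral_lborel_affine)
      show "?f \<in> borel_measurable borel" by measurable
    qed simp
    also have "(\<integral>\<^sup>+y. ?f (0 + real (Suc j) *\<^sub>R y) \<partial>lborel) = (\<integral>\<^sup>+y\<in>ball 0 1 - {0}. indicator N (sgn y) \<partial>lborel)"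
    proof (rule nn_integral_cong)
      fix y :: "real ^ 'n"
      have "norm (real (Suc j) *\<^sub>R y) < real (Suc j) \<longleftrightarrow> norm y < 1"
        unfolding norm_scaleR using mult_less_cancel_left_pos[of "real (Suc j)" "norm y" 1] by simp
      moreover have "sgn (real (Suc j) *\<^sub>R y) = sgn y"
        by (simp add: sgn_scaleR del: of_nat_Suc)
      moreover have "0 < norm (real (Suc j) *\<^sub>R y) \<longleftrightarrow> y \<noteq> 0"
        by (simp add: zero_less_mult_iff del: of_nat_Suc)
      ultimately show "?f (0 + real (Suc j) *\<^sub>R y) = indicator N (sgn y) * indicator (ball 0 1 - {0}) y"
        unfolding add_0_left by (simp add: indicator_def del: norm_scaleR)
    qed
    finally have "(\<integral>\<^sup>+y. ?f y \<partial>lborel) = 0" unfolding 0 by simp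
    then have "AE y in lborel. ?f y = 0"
      by (subst (asm) nn_integral_0_iff_AE) auto
    then show ?thesis by eventually_elim (auto split: if_splits)
  qed
  then have "AE y in lborel. \<forall>j. \<not> (norm (y :: real ^ 'n) < real (Suc j) \<and> 0 < norm y \<and> sgn y \<in> N)"
    by (subst AE_all_countable) auto
  moreover have "AE y in lborel. y \<noteq> (0 :: real ^ 'n)" by (rule AE_lborel_singleton)
  ultimately show ?thesis
  proof eventually_elim
    case (elim y)
    obtain j where "norm y < real j" using reals_Archimedean2 by blast
    then have "norm y < real (Suc j)" by simp
    then have "sgn y \<notin> N" using elim by auto
    moreover have "sgn y \<in> sphere 0 1" using elim by (simp add: norm_sgn)
    ultimately show ?case using N(3) by blast
  qed
qed

text \<open>Transfers the hypotheses on the sphere to the shell where the rough integral estimate is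
  stated, replaces \<Omega> by a Borel function, and lowers the integrability exponent.\<close>

lemma sphere_kernel_borel_version:
  fixes \<Omega> :: "real ^ 'n \<Rightarrow> real"
  defines "S \<equiv> {y :: real ^ 'n. 1 < norm y \<and> norm y \<le> 2}"
  assumes int: "integrable surface_measure \<Omega>" and zero: "(LINT z|surface_measure. \<Omega> z) = 0"
    and pow: "integrable surface_measure (\<lambda>z. \<bar>\<Omega> z\<bar> powr \<rho>)" and \<rho>: "1 < \<rho>'" "\<rho>' \<le> \<rho>"
  obtains W where "W \<in> borel_measurable borel" "AE y in lborel. \<Omega> (sgn y) = W (sgn y)"
    "integrable lborel (\<lambda>y. indicator S y * (W (sgn y) / norm y ^ CARD('n)))"
    "(LINT y|lborel. indicator S y * (W (sgn y) / norm y ^ CARD('n))) = 0"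
    "(\<integral>\<^sup>+y\<in>S. ennreal (\<bar>W (sgn y)\<bar> powr \<rho>') \<partial>lborel) < top"
proof -
  let ?\<mu> = "cone_measure :: (real ^ 'n) measure"
  have "\<Omega> \<in> borel_measurable (completion ?\<mu>)"
    using borel_measurable_integrable[OF int] by (simp add: surface_measure_eq)
  then obtain W1 where W1: "W1 \<in> borel_measurable ?\<mu>" "AE z in ?\<mu>. \<Omega> z = W1 z"
    using completion_ex_borel_measurable_real by blast
  define W where "W z = (if z \<in> sphere 0 1 then W1 z else 0)" for z
  have W1': "W1 \<in> borel_measurable (restrict_space borel (sphere 0 1))"
    using W1(1) by (simp cong: measurable_cong_sets)
  have W [measurable]: "W \<in> borel_measurable borel"
    unfolding W_def by (subst measurable_restrict_space_iff[symmetric]) (use W1' in auto)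
  have W\<mu> [measurable]: "W \<in> borel_measurable ?\<mu>"
    using measurable_restrict_space1[OF W, of "sphere 0 1"] by (simp cong: measurable_cong_sets)
  have AE: "AE z in ?\<mu>. \<Omega> z = W z"
    using W1(2) by (rule AE_mp) (auto simp: W_def)
  have AE': "AE z in completion ?\<mu>. \<Omega> z = W z" using AE by (rule AE_completion)
  have W\<mu>c: "W \<in> borel_measurable (completion ?\<mu>)" using W\<mu> by (rule measurable_completion)
  have "integrable (completion ?\<mu>) W"
    using int W\<mu>c AE' unfolding surface_measure_eq by (subst integrable_cong_AE[of _ _ \<Omega>]) auto
  then have Wint: "integrable ?\<mu> W" using W\<mu> by (simp add: integrable_completion)
  have "(LINT z|completion ?\<mu>. \<Omega> z) = (LINT z|completion ?\<mu>. W z)"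
    using int W\<mu>c AE' unfolding surface_measure_eq by (intro integral_cong_AE) auto
  then have Wzero: "(LINT z|?\<mu>. W z) = 0"
    using zero W\<mu> by (simp add: surface_measure_eq integral_completion)
  have "(\<integral>\<^sup>+z. ennreal (\<bar>\<Omega> z\<bar> powr \<rho>) \<partial>completion ?\<mu>) < \<infinity>"
    using pow by (simp add: surface_measure_eq integrable_iff_bounded)
  also have "(\<integral>\<^sup>+z. ennreal (\<bar>\<Omega> z\<bar> powr \<rho>) \<partial>completion ?\<mu>) = (\<integral>\<^sup>+z. ennreal (\<bar>W z\<bar> powr \<rho>) \<partial>?\<mu>)"
    unfolding nn_integral_completion by (rule nn_integral_cong_AE) (use AE in \<open>eventually_elim, simp\<close>)
  finally have Wpow: "(\<integral>\<^sup>+z. ennreal (\<bar>W z\<bar> powr \<rho>) \<partial>?\<mu>) < top" by simp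
  have Wfin: "(\<integral>\<^sup>+z. ennreal \<bar>W z\<bar> \<partial>?\<mu>) < top"
    using Wint by (simp add: integrable_iff_bounded)
  let ?k = "\<lambda>y. indicator S y * (W (sgn y) / norm y ^ CARD('n))"
  have [measurable]: "S \<in> sets borel" unfolding S_def by measurable
  \<comment> \<open>\<open>ennreal\<close> cuts off negative values, so the choices 1 and -1 for
    \<epsilon> give the positive and the negative part.\<close>
  have k: "(\<integral>\<^sup>+y. ennreal (\<epsilon> * ?k y) \<partial>lborel) = ennreal (ln 2) * (\<integral>\<^sup>+z. ennreal (\<epsilon> * W z) \<partial>?\<mu>)" for \<epsilon> :: real
  proof -
    have "(\<integral>\<^sup>+y. ennreal (\<epsilon> * ?k y) \<partial>lborel)
      = (\<integral>\<^sup>+w\<in>{w. 1 < norm w \<and> norm w \<le> 2}. ennreal (norm w powr - real CARD('n)) * ennreal (\<epsilon> * W (sgn w)) \<partial>lborel)"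
    proof (rule nn_integral_cong)
      fix y :: "real ^ 'n"
      show "ennreal (\<epsilon> * ?k y) = ennreal (norm y powr - real CARD('n)) * ennreal (\<epsilon> * W (sgn y)) *
        indicator {w. 1 < norm w \<and> norm w \<le> 2} y"
      proof (cases "y \<in> S")
        case True
        then have "0 < norm y" unfolding S_def by (auto intro: order.strict_trans[of 0 1])
        then have "\<epsilon> * ?k y = norm y powr - real CARD('n) * (\<epsilon> * W (sgn y))"
          using True by (simp add: powr_minus powr_realpow divide_inverse)
        then show ?thesis using True by (simp add: S_def ennreal_mult')
      qed (simp add: S_def)
    qed
    also have "\<dots> = ennreal (ln 2) * (\<integral>\<^sup>+z. ennreal (\<epsilon> * W z) \<partial>?\<mu>)"
      by (rule nn_integral_shell_cone) measurable
    finally show ?thesis .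
  qed
  have fin: "(\<integral>\<^sup>+z. ennreal (\<epsilon> * W z) \<partial>?\<mu>) < top" if "\<bar>\<epsilon>\<bar> = 1" for \<epsilon> :: real
  proof (rule order.strict_trans1[OF nn_integral_mono Wfin])
    fix z
    have "\<epsilon> * W z \<le> \<bar>\<epsilon> * W z\<bar>" by (rule abs_ge_self)
    then show "ennreal (\<epsilon> * W z) \<le> ennreal \<bar>W z\<bar>" using that by (intro ennreal_leI) (simp add: abs_mult)
  qed
  have kint: "integrable lborel ?k"
    unfolding real_integrable_def using k[of 1] k[of "-1"] fin[of 1] fin[of "-1"]
    by (auto simp: ennreal_mult_eq_top_iff less_top[symmetric])
  have kzero: "integral\<^sup>L lborel ?k = 0"
  proof -
    have "integral\<^sup>L lborel ?k = enn2real (\<integral>\<^sup>+y. ennreal (1 * ?k y) \<partial>lborel) - enn2real (\<integral>\<^sup>+y. ennreal (- 1 * ?k y) \<partial>lborel)"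
      using real_lebesgue_integral_def[OF kint] by simp
    also have "\<dots> = ln 2 * (enn2real (\<integral>\<^sup>+z. ennreal (W z) \<partial>?\<mu>) - enn2real (\<integral>\<^sup>+z. ennreal (- W z) \<partial>?\<mu>))"
      unfolding k by (simp add: enn2real_mult right_diff_distrib)
    also have "\<dots> = ln 2 * (LINT z|?\<mu>. W z)"
      using real_lebesgue_integral_def[OF Wint] by simp
    finally show ?thesis using Wzero by simp
  qed
  have "emeasure ?\<mu> (space ?\<mu>) = (\<integral>\<^sup>+z. 1 \<partial>?\<mu>)" by simp
  also have "\<dots> = of_nat CARD('n) * (\<integral>\<^sup>+y\<in>ball 0 1 - {0}. 1 \<partial>(lborel :: (real ^ 'n) measure))"
    by (rule nn_integral_cone_measure) simp
  also have "\<dots> \<le> of_nat CARD('n) * emeasure lborel (ball 0 1 :: (real ^ 'n) set)"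
    by (intro mult_left_mono) (auto intro!: emeasure_mono)
  also have "\<dots> < top"
    using emeasure_lborel_ball_finite[of "0 :: real ^ 'n" 1] by (simp add: ennreal_mult_less_top ennreal_of_nat_eq_real_of_nat)
  finally have total: "emeasure ?\<mu> (space ?\<mu>) < top" .
  \<comment> \<open>The smaller exponent is admissible because the sphere has finite
    measure.\<close>
  have "(\<integral>\<^sup>+z. ennreal (\<bar>W z\<bar> powr \<rho>') \<partial>?\<mu>) \<le> (\<integral>\<^sup>+z. 1 + ennreal (\<bar>W z\<bar> powr \<rho>) \<partial>?\<mu>)"
  proof (rule nn_integral_mono)
    fix z
    have "\<bar>W z\<bar> powr \<rho>' \<le> 1 + \<bar>W z\<bar> powr \<rho>"
    proof (cases "\<bar>W z\<bar> \<le> 1")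
      case True
      then have "\<bar>W z\<bar> powr \<rho>' \<le> 1 powr \<rho>'" using \<rho> by (intro powr_mono2) auto
      then show ?thesis by (simp add: add_increasing2)
    next
      case False
      then have "\<bar>W z\<bar> powr \<rho>' \<le> \<bar>W z\<bar> powr \<rho>" using \<rho> by (intro powr_mono) auto
      then show ?thesis by simp
    qed
    then have "ennreal (\<bar>W z\<bar> powr \<rho>') \<le> ennreal (1 + \<bar>W z\<bar> powr \<rho>)" by (rule ennreal_leI)
    then show "ennreal (\<bar>W z\<bar> powr \<rho>') \<le> 1 + ennreal (\<bar>W z\<bar> powr \<rho>)" by simp
  qed
  also have "\<dots> = emeasure ?\<mu> (space ?\<mu>) + (\<integral>\<^sup>+z. ennreal (\<bar>W z\<bar> powr \<rho>) \<partial>?\<mu>)"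
    by (subst nn_integral_add) auto
  also have "\<dots> < top" using total Wpow by simp
  finally have Wpow': "(\<integral>\<^sup>+z. ennreal (\<bar>W z\<bar> powr \<rho>') \<partial>?\<mu>) < top" .
  \<comment> \<open>On the shell |y|^(-n) is at least 2^(-n), so inserting this weight costs only
    \<open>2 ^ CARD('n)\<close> and makes the polar formula applicable.\<close>
  have "(\<integral>\<^sup>+y\<in>S. ennreal (\<bar>W (sgn y)\<bar> powr \<rho>') \<partial>lborel)
    \<le> (\<integral>\<^sup>+y. ennreal (2 ^ CARD('n)) * ((ennreal (norm y powr - real CARD('n)) * ennreal (\<bar>W (sgn y)\<bar> powr \<rho>')) *
        indicator {w. 1 < norm w \<and> norm w \<le> 2} y) \<partial>lborel)"
  proof (rule nn_integral_mono)
    fix y :: "real ^ 'n"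
    show "ennreal (\<bar>W (sgn y)\<bar> powr \<rho>') * indicator S y \<le> ennreal (2 ^ CARD('n)) *
      ((ennreal (norm y powr - real CARD('n)) * ennreal (\<bar>W (sgn y)\<bar> powr \<rho>')) * indicator {w. 1 < norm w \<and> norm w \<le> 2} y)"
    proof (cases "y \<in> S")
      case True
      then have y: "0 < norm y" "norm y \<le> 2" unfolding S_def by (auto intro: order.strict_trans[of 0 1])
      have "1 \<le> 2 ^ CARD('n) * norm y powr - real CARD('n)"
        using y power_mono[of "norm y" 2 "CARD('n)"] by (simp add: powr_minus powr_realpow field_simps)
      then have "1 * \<bar>W (sgn y)\<bar> powr \<rho>' \<le> (2 ^ CARD('n) * norm y powr - real CARD('n)) * \<bar>W (sgn y)\<bar> powr \<rho>'"
        by (rule mult_right_mono) simp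
      then have "ennreal (\<bar>W (sgn y)\<bar> powr \<rho>') \<le> ennreal ((2 ^ CARD('n) * norm y powr - real CARD('n)) * \<bar>W (sgn y)\<bar> powr \<rho>')"
        by (intro ennreal_leI) simp
      also have "\<dots> = ennreal (2 ^ CARD('n)) * (ennreal (norm y powr - real CARD('n)) * ennreal (\<bar>W (sgn y)\<bar> powr \<rho>'))"
        by (simp add: ennreal_mult mult.assoc del: ennreal_power)
      finally show ?thesis using True by (simp add: S_def)
    qed simp
  qed
  also have "\<dots> = ennreal (2 ^ CARD('n)) * (\<integral>\<^sup>+y\<in>{w. 1 < norm w \<and> norm w \<le> 2}. ennreal (norm y powr - real CARD('n)) * ennreal (\<bar>W (sgn y)\<bar> powr \<rho>') \<partial>lborel)"
    by (rule nn_integral_cmult) measurable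
  also have "\<dots> = ennreal (2 ^ CARD('n)) * (ennreal (ln 2) * (\<integral>\<^sup>+z. ennreal (\<bar>W z\<bar> powr \<rho>') \<partial>?\<mu>))"
    by (subst nn_integral_shell_cone[of "\<lambda>z. ennreal (\<bar>W z\<bar> powr \<rho>')"]) auto
  also have "\<dots> < top"
    using Wpow' by (simp add: ennreal_mult_less_top del: ennreal_power)
  finally have "(\<integral>\<^sup>+y\<in>S. ennreal (\<bar>W (sgn y)\<bar> powr \<rho>') \<partial>lborel) < top" .
  with W AE_cone_measure_sgn[OF AE] kint kzero show ?thesis by (rule that)
qed

lemma regular_function_gradient:
  fixes f :: "real ^ 'n \<Rightarrow> real"
  assumes "regular_function f"
  shows "(f has_derivative (\<lambda>v. grad f x \<bullet> v)) (at x)" and "continuous_on UNIV (grad f)"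
proof -
  have "f differentiable at x"
    using assms by (auto simp: regular_function_def differentiable_on_def)
  then obtain f' where f': "(f has_derivative f') (at x)"
    by (auto simp: differentiable_def)
  define D where "D = (\<Sum>b\<in>Basis. f' b *\<^sub>R b)"
  have "f' v = v \<bullet> D" for v
  proof -
    have "f' v = f' (\<Sum>b\<in>Basis. (v \<bullet> b) *\<^sub>R b)" by (simp add: euclidean_representation)
    also have "\<dots> = (\<Sum>b\<in>Basis. (v \<bullet> b) * f' b)"
      using has_derivative_linear[OF f'] by (simp add: linear_sum linear_scale)
    also have "\<dots> = v \<bullet> D" by (simp add: D_def inner_sum_right mult.commute)
    finally show ?thesis .
  qed
  then have "f' = (\<lambda>v. v \<bullet> D)" by (rule ext)
  then have D: "(f has_derivative (\<lambda>v. v \<bullet> D)) (at x)" using f' by simp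
  have "grad f x = D"
    unfolding grad_def
  proof (rule the_equality)
    show "GDERIV f x :> D" using D by (simp add: gderiv_def)
    fix D' assume "GDERIV f x :> D'"
    then have "(f has_derivative (\<lambda>v. v \<bullet> D')) (at x)" by (simp add: gderiv_def)
    then have "\<forall>v. v \<bullet> D' = v \<bullet> D"
      using has_derivative_unique[OF _ D] by (auto dest: fun_cong)
    then show "D' = D" unfolding vector_eq_ldot .
  qed
  then show "(f has_derivative (\<lambda>v. grad f x \<bullet> v)) (at x)"
    using D by (simp add: inner_commute)
  show "continuous_on UNIV (grad f)"
    using assms by (simp add: regular_function_def)
qed

subsection \<open>The maximal rough operator\<close>

lemma ennreal_abs_suminf_le:
  fixes a :: "nat \<Rightarrow> real"
  shows "ennreal \<bar>suminf a\<bar> \<le> (\<Sum>k. ennreal \<bar>a k\<bar>)"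
proof (cases "(\<Sum>k. ennreal \<bar>a k\<bar>) = top")
  case False
  then have "summable (\<lambda>k. \<bar>a k\<bar>)" by (intro summable_suminf_not_top) auto
  then have "\<bar>suminf a\<bar> \<le> (\<Sum>k. \<bar>a k\<bar>)" by (rule summable_rabs)
  then show ?thesis
    using \<open>summable (\<lambda>k. \<bar>a k\<bar>)\<close> by (simp add: suminf_ennreal2 ennreal_leI)
qed simp

text \<open>The kernel is homogeneous of degree -n, so the dilation y = (t 2^k) z cancels the
  Jacobian and moves every shell to the fixed one; only \<open>f\<close> is rescaled. One constant
  therefore serves all shells.\<close>

lemma truncated_integral_dyadic:
  fixes \<Omega> W f :: "real ^ 'n \<Rightarrow> real"
  defines "S \<equiv> {y :: real ^ 'n. 1 < norm y \<and> norm y \<le> 2}"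
  assumes W [measurable]: "W \<in> borel_measurable borel" and AE: "AE y in lborel. \<Omega> (sgn y) = W (sgn y)"
    and f [measurable]: "f \<in> borel_measurable borel" and t: "0 < t"
    and int: "set_integrable lebesgue {y. norm y > t} (\<lambda>y. \<Omega> (sgn y) / norm y ^ CARD('n) * f (x - y))"
  shows "integrable lborel (\<lambda>z. indicator S z * (W (sgn z) / norm z ^ CARD('n)) * f (x - (t * 2 ^ k) *\<^sub>R z))"
    and "ennreal \<bar>LINT y:{y. norm y > t}|lebesgue. \<Omega> (sgn y) / norm y ^ CARD('n) * f (x - y)\<bar>
      \<le> (\<Sum>k. ennreal \<bar>LINT z|lborel. indicator S z * (W (sgn z) / norm z ^ CARD('n)) * f (x - (t * 2 ^ k) *\<^sub>R z)\<bar>)"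
proof -
  let ?T = "{y :: real ^ 'n. norm y > t}"
  define \<psi> where "\<psi> y = W (sgn y) / norm y ^ CARD('n) * f (x - y)" for y
  have \<psi> [measurable]: "\<psi> \<in> borel_measurable borel" unfolding \<psi>_def by measurable
  have T [measurable]: "?T \<in> sets borel" by measurable
  have \<psi>T: "(\<lambda>y. indicator ?T y *\<^sub>R \<psi> y) \<in> borel_measurable lborel" by measurable
  have \<psi>Tc: "(\<lambda>y. indicator ?T y *\<^sub>R \<psi> y) \<in> borel_measurable lebesgue"
    using \<psi>T by (rule measurable_completion)
  have AE': "AE y in lebesgue. indicator ?T y *\<^sub>R (\<Omega> (sgn y) / norm y ^ CARD('n) * f (x - y)) = indicator ?T y *\<^sub>R \<psi> y"
    by (rule AE_completion) (use AE in \<open>eventually_elim, simp add: \<psi>_def\<close>)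
  have int': "integrable lebesgue (\<lambda>y. indicator ?T y *\<^sub>R (\<Omega> (sgn y) / norm y ^ CARD('n) * f (x - y)))"
    using int by (simp only: set_integrable_def)
  have "integrable lebesgue (\<lambda>y. indicator ?T y *\<^sub>R \<psi> y)"
    by (rule integrable_cong_AE_imp[OF int' \<psi>Tc]) (use AE' in \<open>eventually_elim, simp\<close>)
  then have \<psi>int: "set_integrable lborel ?T \<psi>"
    unfolding set_integrable_def using \<psi>T by (simp only: integrable_completion)
  have eq: "(LINT y:?T|lebesgue. \<Omega> (sgn y) / norm y ^ CARD('n) * f (x - y)) = (LINT y:?T|lborel. \<psi> y)"
    unfolding set_lebesgue_integral_def integral_completion[OF \<psi>T, symmetric]
    by (rule integral_cong_AE[OF borel_measurable_integrable[OF int'] \<psi>Tc AE'])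
  define A where "A k = {y :: real ^ 'n. t * 2 ^ k < norm y \<and> norm y \<le> t * 2 ^ Suc k}" for k
  have A [measurable]: "A k \<in> sets borel" for k unfolding A_def by measurable
  have UA: "(\<Union>k. A k) = ?T"
  proof
    show "(\<Union>k. A k) \<subseteq> ?T"
    proof safe
      fix y k assume "y \<in> A k"
      moreover have "t * 1 \<le> t * 2 ^ k" using t by (intro mult_left_mono) auto
      ultimately show "t < norm y" by (simp add: A_def)
    qed
    show "?T \<subseteq> (\<Union>k. A k)"
    proof
      fix y :: "real ^ 'n" assume y: "y \<in> ?T"
      obtain j where "norm y / t < 2 ^ j" using real_arch_pow[of 2] by auto
      then have "norm y \<le> t * 2 ^ j" using t by (simp add: divide_less_eq mult.commute)
      then obtain k where "\<not> norm y \<le> t * 2 ^ k" "norm y \<le> t * 2 ^ Suc k"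
        using ex_least_nat_less[of "\<lambda>k. norm y \<le> t * 2 ^ k" j] y by auto
      then have "y \<in> A k" by (simp add: A_def)
      then show "y \<in> (\<Union>k. A k)" by blast
    qed
  qed
  have disj: "A i \<inter> A j = {}" if "i < j" for i j
  proof -
    have "(2::real) ^ Suc i \<le> 2 ^ j" using that by (intro power_increasing) auto
    then have "t * 2 ^ Suc i \<le> t * 2 ^ j" using t by (intro mult_left_mono) auto
    then show ?thesis by (auto simp: A_def)
  qed
  have disj': "A i \<inter> A j = {}" if "i \<noteq> j" for i j
    using disj[of i j] disj[of j i] that by (cases "i < j") auto
  let ?F = "\<lambda>k z. indicator S z * (W (sgn z) / norm z ^ CARD('n)) * f (x - (t * 2 ^ k) *\<^sub>R z)"
  let ?G = "\<lambda>k z. indicator (A k) (0 + (t * 2 ^ k) *\<^sub>R z) *\<^sub>R \<psi> (0 + (t * 2 ^ k) *\<^sub>R z)"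
  have scale: "(\<bar>t * 2 ^ k\<bar> ^ DIM(real ^ 'n)) * ?G k z = ?F k z" for k z
  proof -
    define a where "a = t * 2 ^ k"
    have a: "0 < a" using t by (simp add: a_def)
    have "a *\<^sub>R z \<in> A k \<longleftrightarrow> z \<in> S"
    proof -
      have "a < norm (a *\<^sub>R z) \<longleftrightarrow> 1 < norm z"
        using a mult_less_cancel_left_pos[of a 1 "norm z"] by simp
      moreover have "norm (a *\<^sub>R z) \<le> t * 2 ^ Suc k \<longleftrightarrow> norm z \<le> 2"
        using a mult_le_cancel_left_pos[of a "norm z" 2] by (simp add: a_def mult.commute mult.left_commute)
      ultimately show ?thesis by (simp add: A_def S_def a_def)
    qed
    moreover have "a ^ CARD('n) * \<psi> (a *\<^sub>R z) = W (sgn z) / norm z ^ CARD('n) * f (x - a *\<^sub>R z)"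
      using a by (simp add: \<psi>_def sgn_scaleR power_mult_distrib)
    ultimately show ?thesis
      using a by (simp add: a_def[symmetric] indicator_def)
  qed
  have Aint: "integrable lborel (\<lambda>y. indicator (A k) y *\<^sub>R \<psi> y)" for k
  proof -
    have "set_integrable lborel (A k) \<psi>"
      by (rule set_integrable_subset[OF \<psi>int]) (use UA in auto)
    then show ?thesis by (simp only: set_integrable_def)
  qed
  have Ameas: "(\<lambda>y. indicator (A k) y *\<^sub>R \<psi> y) \<in> borel_measurable borel" for k by measurable
  have pos: "t * 2 ^ k \<noteq> 0" for k using t by simp
  have "integrable lborel (\<lambda>z. ?G k z)" for k
    using Aint[of k] integral_lborel_affine(2)[OF Ameas pos, of k 0 k] by blast
  then have "integrable lborel (\<lambda>z. (\<bar>t * 2 ^ k\<bar> ^ DIM(real ^ 'n)) *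
      ?G k z)" for k
    by (rule integrable_mult_right)
  then show "integrable lborel (?F k)" unfolding scale .
  have "(LINT y:A k|lborel. \<psi> y) = (LINT z|lborel. ?F k z)" for k
  proof -
    have "(LINT y:A k|lborel. \<psi> y) = (\<bar>t * 2 ^ k\<bar> ^ DIM(real ^ 'n)) *
        (LINT z|lborel. ?G k z)"
      unfolding set_lebesgue_integral_def by (rule integral_lborel_affine(1)[OF Ameas pos])
    also have "\<dots> = (LINT z|lborel. (\<bar>t * 2 ^ k\<bar> ^ DIM(real ^ 'n)) *
        ?G k z)"
      by (rule integral_mult_right_zero[symmetric])
    finally show ?thesis unfolding scale .
  qed
  moreover have "(LINT y:?T|lborel. \<psi> y) = (\<Sum>k. LINT y:A k|lborel. \<psi> y)"
    unfolding UA[symmetric] by (rule lebesgue_integral_countable_add) (use disj' \<psi>int UA in auto)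
  ultimately show "ennreal \<bar>LINT y:?T|lebesgue. \<Omega> (sgn y) / norm y ^ CARD('n) * f (x - y)\<bar>
      \<le> (\<Sum>k. ennreal \<bar>LINT z|lborel. ?F k z\<bar>)"
    unfolding eq by (simp only: ennreal_abs_suminf_le)
qed

text \<open>A truncated integral that does not converge has the value 0 by convention, so only
  convergent ones need a bound.\<close>

lemma max_rough_op_le:
  assumes "\<And>t. 0 < t \<Longrightarrow> set_integrable lebesgue {y. norm y > t} (\<lambda>y. \<Omega> (sgn y) / norm y ^ CARD('n) * f (x - y)) \<Longrightarrow>
    ennreal \<bar>LINT y:{y. norm y > t}|lebesgue. \<Omega> (sgn y) / norm y ^ CARD('n) * f (x - y)\<bar> \<le> B"
  shows "max_rough_op \<Omega> f (x :: real ^ 'n) \<le> B"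
  unfolding max_rough_op_def
proof (rule SUP_least)
  fix t :: real assume "t \<in> {0<..}"
  then show "ennreal \<bar>LINT y:{y. norm y > t}|lebesgue. \<Omega> (sgn y) / norm y ^ CARD('n) * f (x - y)\<bar> \<le> B"
  proof (cases "set_integrable lebesgue {y. norm y > t} (\<lambda>y. \<Omega> (sgn y) / norm y ^ CARD('n) * f (x - y))")
    case False
    then have "(LINT y:{y. norm y > t}|lebesgue. \<Omega> (sgn y) / norm y ^ CARD('n) * f (x - y)) = 0"
      unfolding set_lebesgue_integral_def set_integrable_def by (rule not_integrable_integral_eq)
    then show ?thesis by simp
  qed (use assms in auto)
qed

context borel_weight
begin

lemma max_rough_op_pointwise:
  fixes \<Omega> :: "real ^ 'n \<Rightarrow> real"
  assumes dbl: "doubling_measure \<nu> D d c"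
    and \<rho>: "1 < \<rho>" "\<rho> < real CARD('n)"
    and \<Omega>: "integrable surface_measure \<Omega>" "(LINT z|surface_measure. \<Omega> z) = 0"
      "integrable surface_measure (\<lambda>z. \<bar>\<Omega> z\<bar> powr \<rho>)"
    and \<delta>: "1 \<le> \<delta>" "A_weight \<delta> \<omega>"
    and s: "1 < \<rho> * real CARD('n) / (\<rho> * real CARD('n) + \<rho> - real CARD('n))"
      "\<rho> * real CARD('n) / (\<rho> * real CARD('n) + \<rho> - real CARD('n)) \<le> s" "s < real CARD('n)"
    and q: "0 < q" "q < d"
  obtains A where "0 < A"
    "\<And>f x. regular_function f \<Longrightarrow> max_rough_op \<Omega> f x
      \<le> ennreal A * doubling_measure.majorant \<nu> d (s * \<delta>) q (grad_size f) x"
proof -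
  interpret doubling_measure \<nu> D d c by (rule dbl)
  let ?n = "real CARD('n)"
  let ?S = "{y :: real ^ 'n. 1 < norm y \<and> norm y \<le> 2}"
  \<comment> \<open>Solved from the endpoint relation so that \<open>s\<close> becomes the exponent
    dual to \<rho>'. The lower bound on \<open>s\<close> gives \<rho>' at most \<rho>, and s < n
    gives \<rho>' > 1.\<close>
  define \<rho>' where "\<rho>' = 1 / (1 + 1 / ?n - 1 / s)"
  have s1: "1 < s" using s by simp
  have inv: "1 / (\<rho> * ?n / (\<rho> * ?n + \<rho> - ?n)) = 1 + 1 / ?n - 1 / \<rho>"
    using \<rho> by (simp add: field_simps)
  have "1 / s \<le> 1 + 1 / ?n - 1 / \<rho>"
    unfolding inv[symmetric] using s by (intro divide_left_mono mult_pos_pos) linarith+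
  then have le: "1 / \<rho> \<le> 1 / \<rho>'" by (simp add: \<rho>'_def)
  have "1 / ?n < 1 / s" using s s1 by (intro divide_strict_left_mono) auto
  then have lt: "1 / \<rho>' < 1" by (simp add: \<rho>'_def)
  have \<rho>'0: "0 < \<rho>'" using le \<rho> by (metis less_le_trans less_trans zero_less_divide_1_iff zero_less_one)
  have \<rho>': "1 < \<rho>'" "\<rho>' \<le> \<rho>" "\<rho>' < ?n"
  proof -
    show "1 < \<rho>'" using lt \<rho>'0 by simp
    show "\<rho>' \<le> \<rho>" using le \<rho>'0 \<rho> by (simp add: divide_le_cancel field_simps)
    then show "\<rho>' < ?n" using \<rho> by simp
  qed
  have s\<rho>': "1 / s = 1 - 1 / \<rho>' + 1 / ?n" by (simp add: \<rho>'_def)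
  obtain W where W: "W \<in> borel_measurable borel" "AE y in lborel. \<Omega> (sgn y) = W (sgn y)"
    "integrable lborel (\<lambda>y. indicator ?S y * (W (sgn y) / norm y ^ CARD('n)))"
    "(LINT y|lborel. indicator ?S y * (W (sgn y) / norm y ^ CARD('n))) = 0"
    "(\<integral>\<^sup>+y\<in>?S. ennreal (\<bar>W (sgn y)\<bar> powr \<rho>') \<partial>lborel) < top"
    by (rule sphere_kernel_borel_version[OF \<Omega> \<rho>'(1,2)]) blast
  obtain C where C: "0 < C"
    "\<And>h Dh. (\<And>x. (h has_derivative (\<lambda>v. Dh x \<bullet> v)) (at x)) \<Longrightarrow> continuous_on UNIV Dh \<Longrightarrow>
      integrable lborel (\<lambda>y. indicator ?S y * (W (sgn y) / norm y ^ CARD('n)) * h y) \<Longrightarrow>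
      ennreal \<bar>LINT y|lborel. indicator ?S y * (W (sgn y) / norm y ^ CARD('n)) * h y\<bar>
      \<le> ennreal C * epowr (\<integral>\<^sup>+u\<in>ball 0 3. epowr (ennreal (norm (Dh u))) s \<partial>lborel) (1 / s)"
    using rough_integral_shell_le[of W \<rho>' s] W(1,3,4,5) \<rho>'(1,3) s\<rho>' by auto
  obtain K where K: "0 < K" "\<And>h x r. h \<in> borel_measurable borel \<Longrightarrow> 0 < r \<Longrightarrow> (\<integral>\<^sup>+y\<in>ball x r. h y \<partial>lborel)
    \<le> ennreal K * emeasure lborel (ball x r) *
      epowr ((\<integral>\<^sup>+y\<in>ball x r. epowr (h y) \<delta> \<partial>\<nu>) / emeasure \<nu> (ball x r)) (1 / \<delta>)"
    by (rule muckenhoupt_bound[OF \<delta>(2,1)]) blast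
  have s\<delta>: "0 < s * \<delta>" using s1 \<delta> by simp
  obtain C0 where C0: "0 < C0"
    "\<And>g x t. 0 < t \<Longrightarrow> (\<Sum>k. ennreal (t * 2 ^ k) * epowr (average (\<lambda>y. epowr (g y) (s * \<delta>)) x (t * 2 ^ k)) (1 / (s * \<delta>)))
      \<le> ennreal C0 * majorant (s * \<delta>) q g x"
    by (rule dyadic_potential_le[OF s\<delta> q]) blast
  define V where "V = unit_ball_vol ?n * 3 ^ CARD('n)"
  have V: "0 < V" by (simp add: V_def)
  \<comment> \<open>\<open>K * V\<close> comes from the Muckenhoupt bound on a ball of radius 3 a,
    whose volume is \<open>V * a ^ CARD('n)\<close>. The division by 3 is there because the gradient
    supplies a factor a, while the dyadic potential pairs the mean over that ball with its full
    radius 3 a.\<close>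
  define B where "B = C * (K * V) powr (1 / s) / 3"
  have B: "0 < B" using C(1) K(1) V by (simp add: B_def)
  show ?thesis
  proof (rule that)
    show "0 < B * C0" using B C0(1) by simp
    fix f :: "real ^ 'n \<Rightarrow> real" and x assume f: "regular_function f"
    note der = regular_function_gradient(1)[OF f] and cont = regular_function_gradient(2)[OF f]
    have grad_meas [measurable]: "grad f \<in> borel_measurable borel" by (rule borel_measurable_continuous_onI[OF cont])
    have "continuous_on UNIV f"
      using der by (auto intro!: continuous_at_imp_continuous_on has_derivative_continuous)
    then have f_meas: "f \<in> borel_measurable borel" by (rule borel_measurable_continuous_onI)
    let ?g = "grad_size f"
    let ?av = "average (\<lambda>y. epowr (?g y) (s * \<delta>)) x"
    show "max_rough_op \<Omega> f x \<le> ennreal (B * C0) * majorant (s * \<delta>) q ?g x"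
    proof (rule max_rough_op_le)
      fix t :: real assume t: "0 < t"
        and int: "set_integrable lebesgue {y. norm y > t} (\<lambda>y. \<Omega> (sgn y) / norm y ^ CARD('n) * f (x - y))"
      let ?I = "\<lambda>k. LINT z|lborel. indicator ?S z * (W (sgn z) / norm z ^ CARD('n)) * f (x - (t * 2 ^ k) *\<^sub>R z)"
      have shell: "ennreal \<bar>?I k\<bar> \<le> ennreal B *
          (ennreal (3 * t * 2 ^ k) * epowr (?av (3 * t * 2 ^ k)) (1 / (s * \<delta>)))" for k
      proof -
        define a where "a = t * 2 ^ k"
        have a: "0 < a" using t by (simp add: a_def)
        \<comment> \<open>The gradient of the rescaled function; its factor \<open>a\<close> is the
          radius in front of the mean.\<close>
        let ?D = "\<lambda>z. - a *\<^sub>R grad f (x - a *\<^sub>R z)"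
        have "((\<lambda>z. f (x - a *\<^sub>R z)) has_derivative (\<lambda>v. ?D z \<bullet> v)) (at z)" for z
        proof -
          have "((\<lambda>z. x - a *\<^sub>R z) has_derivative (\<lambda>v. - a *\<^sub>R v)) (at z)"
            by (auto intro!: derivative_eq_intros)
          from has_derivative_compose[OF this der] show ?thesis by simp
        qed
        moreover have "continuous_on UNIV ?D"
          by (intro continuous_intros continuous_on_compose2[OF cont]) auto
        moreover have "integrable lborel (\<lambda>z. indicator ?S z * (W (sgn z) / norm z ^ CARD('n)) * f (x - a *\<^sub>R z))"
          unfolding a_def by (rule truncated_integral_dyadic(1)[OF W(1,2) f_meas t int])
        ultimately have "ennreal \<bar>?I k\<bar> \<le> ennreal C * epowr (\<integral>\<^sup>+u\<in>ball 0 3. epowr (ennreal (norm (?D u))) s \<partial>lborel) (1 / s)"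
          using C(2)[of "\<lambda>z. f (x - a *\<^sub>R z)" ?D] by (simp only: a_def)
        also have "(\<integral>\<^sup>+u\<in>ball 0 3. epowr (ennreal (norm (?D u))) s \<partial>lborel)
          = ennreal (a powr s) * (\<integral>\<^sup>+u\<in>ball 0 3. epowr (?g (x - a *\<^sub>R u)) s \<partial>lborel)"
        proof -
          have "(\<integral>\<^sup>+u\<in>ball 0 3. epowr (ennreal (norm (?D u))) s \<partial>lborel)
            = (\<integral>\<^sup>+u. ennreal (a powr s) * (epowr (?g (x - a *\<^sub>R u)) s * indicator (ball 0 3) u) \<partial>lborel)"
            using a s1 by (intro nn_integral_cong) (simp add: epowr_mult ennreal_mult mult.assoc)
          also have "\<dots> = ennreal (a powr s) * (\<integral>\<^sup>+u\<in>ball 0 3. epowr (?g (x - a *\<^sub>R u)) s \<partial>lborel)"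
            by (intro nn_integral_cmult) measurable
          finally show ?thesis .
        qed
        also have "(\<integral>\<^sup>+u\<in>ball 0 3. epowr (?g (x - a *\<^sub>R u)) s \<partial>lborel)
          \<le> ennreal (K * V) * epowr (?av (3 * a)) (1 / \<delta>)"
        proof -
          have "(\<integral>\<^sup>+y\<in>ball x (3 * a). epowr (?g y) s \<partial>lborel)
            = ennreal (\<bar>- a\<bar> ^ DIM(real ^ 'n)) * (\<integral>\<^sup>+u. epowr (?g (x + (- a) *\<^sub>R u)) s * indicator (ball x (3 * a)) (x + (- a) *\<^sub>R u) \<partial>lborel)"
            using a by (intro nn_integral_lborel_affine borel_measurable_times_ennreal borel_measurable_indicator) auto
          also have "(\<integral>\<^sup>+u. epowr (?g (x + (- a) *\<^sub>R u)) s * indicator (ball x (3 * a)) (x + (- a) *\<^sub>R u) \<partial>lborel)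
            = (\<integral>\<^sup>+u\<in>ball 0 3. epowr (?g (x - a *\<^sub>R u)) s \<partial>lborel)"
          proof (rule nn_integral_cong)
            fix u :: "real ^ 'n"
            have "x + (- a) *\<^sub>R u \<in> ball x (3 * a) \<longleftrightarrow> u \<in> ball 0 3"
              using a by (simp add: dist_norm mult.commute[of 3 a])
            then show "epowr (?g (x + (- a) *\<^sub>R u)) s * indicator (ball x (3 * a)) (x + (- a) *\<^sub>R u)
              = epowr (?g (x - a *\<^sub>R u)) s * indicator (ball 0 3) u"
              by (simp add: indicator_def)
          qed
          finally have "ennreal (1 / a ^ CARD('n)) * (\<integral>\<^sup>+y\<in>ball x (3 * a). epowr (?g y) s \<partial>lborel)
            = (\<integral>\<^sup>+u\<in>ball 0 3. epowr (?g (x - a *\<^sub>R u)) s \<partial>lborel)"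
            using a by (simp add: mult.assoc[symmetric] ennreal_mult[symmetric] del: ennreal_power)
          moreover have "ennreal (1 / a ^ CARD('n)) * (\<integral>\<^sup>+y\<in>ball x (3 * a). epowr (?g y) s \<partial>lborel)
            \<le> ennreal (1 / a ^ CARD('n)) * (ennreal K * emeasure lborel (ball x (3 * a)) *
              epowr ((\<integral>\<^sup>+y\<in>ball x (3 * a). epowr (epowr (?g y) s) \<delta> \<partial>\<nu>) / emeasure \<nu> (ball x (3 * a))) (1 / \<delta>))"
            using a by (intro mult_left_mono K(2)) auto
          moreover have "(\<integral>\<^sup>+y\<in>ball x (3 * a). epowr (epowr (?g y) s) \<delta> \<partial>\<nu>) / emeasure \<nu> (ball x (3 * a))
              = ?av (3 * a)"
            unfolding average_def epowr_epowr ..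
          moreover have "ennreal (1 / a ^ CARD('n)) * (ennreal K * emeasure lborel (ball x (3 * a)) * X) = ennreal (K * V) * X" for X
          proof -
            have "emeasure lborel (ball x (3 * a)) = ennreal (V * a ^ CARD('n))"
              using a by (simp add: emeasure_ball V_def power_mult_distrib)
            moreover have "1 / a ^ CARD('n) * (K * (V * a ^ CARD('n))) = K * V" using a by simp
            ultimately have "ennreal (1 / a ^ CARD('n)) * (ennreal K * emeasure lborel (ball x (3 * a))) = ennreal (K * V)"
              using a K(1) V by (simp add: ennreal_mult[symmetric] del: ennreal_power)
            then show ?thesis by (simp only: mult.assoc[symmetric])
          qed
          ultimately show ?thesis by simp
        qed
        finally have "ennreal \<bar>?I k\<bar> \<le> ennreal C * epowr (ennreal (a powr s) *
            (ennreal (K * V) * epowr (?av (3 * a)) (1 / \<delta>))) (1 / s)"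
          using s1 by (simp add: mult_left_mono epowr_mono)
        also have "\<dots> = ennreal C * (ennreal a * (ennreal ((K * V) powr (1 / s)) *
            epowr (?av (3 * a)) (1 / (s * \<delta>))))"
          using s1 a K(1) V by (simp add: epowr_mult epowr_epowr powr_powr mult.commute[of s])
        also have "\<dots> = ennreal B * (ennreal (3 * a) * epowr (?av (3 * a)) (1 / (s * \<delta>)))"
        proof -
          have "C * (a * (K * V) powr (1 / s)) = B * (3 * a)" by (simp add: B_def)
          then have "ennreal C * (ennreal a * ennreal ((K * V) powr (1 / s))) = ennreal B * ennreal (3 * a)"
            using C(1) a B by (simp add: ennreal_mult[symmetric])
          then show ?thesis by (simp only: mult.assoc[symmetric])
        qed
        finally show ?thesis by (simp add: a_def mult.assoc)
      qed
      have "ennreal \<bar>LINT y:{y. norm y > t}|lebesgue. \<Omega> (sgn y) / norm y ^ CARD('n) * f (x - y)\<bar> \<le> (\<Sum>k. ennreal \<bar>?I k\<bar>)"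
        by (rule truncated_integral_dyadic(2)[OF W(1,2) f_meas t int])
      also have "\<dots> \<le> (\<Sum>k. ennreal B *
          (ennreal (3 * t * 2 ^ k) * epowr (?av (3 * t * 2 ^ k)) (1 / (s * \<delta>))))"
        by (intro suminf_le summableI shell)
      also have "\<dots> = ennreal B * (\<Sum>k. ennreal (3 * t * 2 ^ k) * epowr (?av (3 * t * 2 ^ k)) (1 / (s * \<delta>)))"
        by simp
      \<comment> \<open>The potential estimate is used with starting radius 3 t.\<close>
      also have "\<dots> \<le> ennreal B * (ennreal C0 * majorant (s * \<delta>) q ?g x)"
        using t by (intro mult_left_mono C0(2)) auto
      also have "\<dots> = ennreal (B * C0) * majorant (s * \<delta>) q ?g x"
        using B C0(1) by (simp add: ennreal_mult mult.assoc)
      finally show "ennreal \<bar>LINT y:{y. norm y > t}|lebesgue. \<Omega> (sgn y) / norm y ^ CARD('n) * f (x - y)\<bar> \<le> \<dots>" .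
    qed
  qed
qed

section \<open>From weighted norms to norms of the density measure\<close>

lemma Lp_norm_eq:
  assumes [measurable]: "g \<in> borel_measurable borel"
  shows "Lp_norm p \<omega> g = epowr (\<integral>\<^sup>+y. epowr (g y) p \<partial>\<nu>) (1 / p)"
  unfolding Lp_norm_def by (subst nn_integral_\<omega>) auto

lemma morrey_norm_eq:
  assumes dbl: "doubling_measure \<nu> D d c" and [measurable]: "g \<in> borel_measurable borel"
  shows "morrey_norm p q \<omega> g = doubling_measure.morrey \<nu> p q g"
proof -
  interpret doubling_measure \<nu> D d c by (rule dbl)
  have "(\<integral>\<^sup>+y\<in>ball x r. epowr (g y) p * ennreal (\<omega> y) \<partial>lebesgue) = (\<integral>\<^sup>+y\<in>ball x r. epowr (g y) p \<partial>\<nu>)" for x r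
  proof -
    have "(\<lambda>y. epowr (g y) p * indicator (ball x r) y) \<in> borel_measurable borel"
      by (intro borel_measurable_times_ennreal borel_measurable_indicator) auto
    from nn_integral_\<omega>[OF this] show ?thesis by (simp add: mult.commute mult.left_commute)
  qed
  then show ?thesis
    by (simp add: morrey_norm_def morrey_def wmeas_eq)
qed

end

text \<open>Monotonicity asks for no measurability, so it applies with the maximal operator on the
  left.\<close>

lemma Lp_norm_mono: "0 < p \<Longrightarrow> (\<And>x. F x \<le> G x) \<Longrightarrow> Lp_norm p \<omega> F \<le> Lp_norm p \<omega> G"
  unfolding Lp_norm_def by (intro epowr_mono nn_integral_mono mult_right_mono) auto

lemma morrey_norm_mono: "0 < p \<Longrightarrow> (\<And>x. F x \<le> G x) \<Longrightarrow> morrey_norm p q \<omega> F \<le> morrey_norm p q \<omega> G"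
  unfolding morrey_norm_def
  by (intro SUP_mono' epowr_mono divide_right_mono_ennreal nn_integral_mono mult_right_mono) auto

theorem corollary1p1:
  fixes \<Omega> \<omega> :: "real ^ 'n \<Rightarrow> real" and \<rho> \<delta> d s :: real
  assumes "CARD('n) \<ge> 2"
    and "1 < \<rho>" and "\<rho> < real CARD('n)"
    and "integrable surface_measure \<Omega>"
    and "(LINT z|surface_measure. \<Omega> z) = 0"
    and "integrable surface_measure (\<lambda>z. \<bar>\<Omega> z\<bar> powr \<rho>)"
    and "1 \<le> \<delta>" and "A_weight \<delta> \<omega>"
    and "1 < d" and "lower_Ahlfors d \<omega>"
    and "1 < \<rho> * real CARD('n) / (\<rho> * real CARD('n) + \<rho> - real CARD('n))"
    and "\<rho> * real CARD('n) / (\<rho> * real CARD('n) + \<rho> - real CARD('n)) \<le> s"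
    and "s < real CARD('n)"
    and "1 < s * \<delta>" and "s * \<delta> < d"
  shows
    "(\<forall>q r. 1 < q \<longrightarrow> 1 < r \<longrightarrow> 1 < r / (s * \<delta>) * (1 - q / d) \<longrightarrow> r * (1 - q / d) = q \<longrightarrow>
        (\<exists>C>0. \<forall>f. regular_function f \<longrightarrow> Lp_norm q \<omega> (grad_size f) < \<infinity> \<longrightarrow>
           Lp_norm r \<omega> (max_rough_op \<Omega> f) \<le> ennreal C * Lp_norm q \<omega> (grad_size f)))
     \<and>
     (\<forall>\<sigma> q r. 1 < \<sigma> \<longrightarrow> s * \<delta> \<le> q \<longrightarrow> q < d \<longrightarrow> 1 < r \<longrightarrow>
        1 < r / (s * \<delta>) * (1 - q / d) \<longrightarrow> r * (1 - q / d) = \<sigma> \<longrightarrow>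
        (\<exists>C>0. \<forall>f. regular_function f \<longrightarrow> Lp_norm \<sigma> \<omega> (grad_size f) < \<infinity> \<longrightarrow>
           morrey_norm (s * \<delta>) q \<omega> (grad_size f) < \<infinity> \<longrightarrow>
           Lp_norm r \<omega> (max_rough_op \<Omega> f)
             \<le> ennreal C * epowr (Lp_norm \<sigma> \<omega> (grad_size f)) (1 - q / d)
                 * epowr (morrey_norm (s * \<delta>) q \<omega> (grad_size f)) (q / d)))
     \<and>
     (\<forall>q a b. 1 < q \<longrightarrow> s * \<delta> \<le> q \<longrightarrow> q < d \<longrightarrow> 1 < a \<longrightarrow> a \<le> b \<longrightarrow>
        1 < a / (s * \<delta>) * (1 - q / d) \<longrightarrow>
        a / (s * \<delta>) * (1 - q / d) \<le> b / (s * \<delta>) * (1 - q / d) \<longrightarrow>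
        (\<exists>C>0. \<forall>f. regular_function f \<longrightarrow>
           morrey_norm (a * (1 - q / d)) (b * (1 - q / d)) \<omega> (grad_size f) < \<infinity> \<longrightarrow>
           morrey_norm (s * \<delta>) q \<omega> (grad_size f) < \<infinity> \<longrightarrow>
           morrey_norm a b \<omega> (max_rough_op \<Omega> f)
             \<le> ennreal C
                 * epowr (morrey_norm (a * (1 - q / d)) (b * (1 - q / d)) \<omega> (grad_size f)) (1 - q / d)
                 * epowr (morrey_norm (s * \<delta>) q \<omega> (grad_size f)) (q / d)))"
proof -
  have "weight \<omega>" using assms(8) by (simp add: A_weight_def)
  then obtain w where "w \<in> borel_measurable borel" "\<And>x. 0 < w x" "AE x in lborel. \<omega> x = w x"
    by (rule weight_borel_version) blast
  with \<open>weight \<omega>\<close> interpret borel_weight \<omega> w by unfold_locales auto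
  have d: "0 < d" using assms(9) by simp
  obtain D c where dbl: "doubling_measure \<nu> D d c"
    by (rule doubling_measure_\<nu>[OF assms(8,7,10) d])
  interpret doubling_measure \<nu> D d c by (rule dbl)
  define p where "p = s * \<delta>"
  have p: "0 < p" using assms(14) by (simp add: p_def)
  have grad_meas: "grad_size f \<in> borel_measurable borel" if "regular_function f" for f :: "real ^ 'n \<Rightarrow> real"
  proof -
    have [measurable]: "grad f \<in> borel_measurable borel"
      by (rule borel_measurable_continuous_onI[OF regular_function_gradient(2)[OF that]])
    show ?thesis by measurable
  qed
  \<comment> \<open>A Borel function between the operator and its norm bounds: the passage from
    \<omega> to \<nu> is available for Borel functions only, so norms are compared with those of
    \<open>G A q f\<close> first.\<close>
  define G where "G A q f x = ennreal A * majorant p q (grad_size f) x" for A q and f :: "real ^ 'n \<Rightarrow> real" and x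
  have G_meas: "G A q f \<in> borel_measurable borel" for A q f
    unfolding G_def majorant_def by measurable
  let ?T = "max_rough_op \<Omega>" and ?N = "\<lambda>q f. epowr (morrey_norm p q \<omega> (grad_size f)) (q / d)"
  have pointwise: "\<exists>A>0. \<forall>f x. regular_function f \<longrightarrow> ?T f x \<le> G A q f x" if q: "0 < q" "q < d" for q
  proof -
    obtain A where "0 < A" "\<And>f x. regular_function f \<Longrightarrow> ?T f x \<le> G A q f x"
      unfolding G_def p_def
      by (rule max_rough_op_pointwise[OF dbl assms(2,3,4,5,6,7,8,11,12,13) q]) blast
    then show ?thesis by blast
  qed
  have Lp: "\<exists>C>0. \<forall>f. regular_function f \<longrightarrow>
      Lp_norm r \<omega> (?T f) \<le> ennreal C * epowr (Lp_norm (r * (1 - q / d)) \<omega> (grad_size f)) (1 - q / d)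
        * ?N q f"
    if q: "0 < q" "q < d" and r: "0 < r" "1 < r / p * (1 - q / d)" for q r
  proof -
    obtain A where A: "0 < A" "\<And>f x. regular_function f \<Longrightarrow> ?T f x \<le> G A q f x"
      using pointwise[OF q] by blast
    obtain C where C: "0 < C"
      "\<And>g F. g \<in> borel_measurable borel \<Longrightarrow>
        (\<And>x. F x \<le> ennreal A * majorant p q g x) \<Longrightarrow>
        epowr (\<integral>\<^sup>+x. epowr (F x) r \<partial>\<nu>) (1 / r)
        \<le> ennreal C * epowr (epowr (\<integral>\<^sup>+x. epowr (g x) (r * (1 - q / d)) \<partial>\<nu>) (1 / (r * (1 - q / d)))) (1 - q / d)
          * epowr (morrey p q g) (q / d)"
      by (rule Lp_bound_of_maximal_bound[OF p q r(2) A(1) r(1)]) blast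
    have "Lp_norm r \<omega> (?T f) \<le> ennreal C * epowr (Lp_norm (r * (1 - q / d)) \<omega> (grad_size f)) (1 - q / d)
        * ?N q f" if f: "regular_function f" for f
    proof -
      have "Lp_norm r \<omega> (?T f) \<le> Lp_norm r \<omega> (G A q f)"
        using A(2)[OF f] r(1) by (intro Lp_norm_mono)
      also have "\<dots> \<le> ennreal C * epowr (Lp_norm (r * (1 - q / d)) \<omega> (grad_size f)) (1 - q / d)
        * ?N q f"
        unfolding Lp_norm_eq[OF G_meas] Lp_norm_eq[OF grad_meas[OF f]] morrey_norm_eq[OF dbl grad_meas[OF f]]
        by (rule C(2)[OF grad_meas[OF f]]) (simp add: G_def)
      finally show ?thesis .
    qed
    with C(1) show ?thesis by blast
  qed
  have morrey: "\<exists>C>0. \<forall>f. regular_function f \<longrightarrow>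
      morrey_norm a b \<omega> (?T f) \<le> ennreal C * epowr (morrey_norm (a * (1 - q / d)) (b * (1 - q / d)) \<omega> (grad_size f)) (1 - q / d)
        * ?N q f"
    if q: "0 < q" "q < d" and a: "0 < a" "a \<le> b" "1 < a / p * (1 - q / d)" for q a b
  proof -
    obtain A where A: "0 < A" "\<And>f x. regular_function f \<Longrightarrow> ?T f x \<le> G A q f x"
      using pointwise[OF q] by blast
    obtain C where C: "0 < C"
      "\<And>g F. g \<in> borel_measurable borel \<Longrightarrow>
        (\<And>x. F x \<le> ennreal A * majorant p q g x) \<Longrightarrow>
        morrey a b F \<le> ennreal C * epowr (morrey (a * (1 - q / d)) (b * (1 - q / d)) g) (1 - q / d)
          * epowr (morrey p q g) (q / d)"
      by (rule morrey_bound_of_maximal_bound[OF p q a A(1)]) blast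
    have "morrey_norm a b \<omega> (?T f) \<le> ennreal C * epowr (morrey_norm (a * (1 - q / d)) (b * (1 - q / d)) \<omega> (grad_size f)) (1 - q / d)
        * ?N q f" if f: "regular_function f" for f
    proof -
      have "morrey_norm a b \<omega> (?T f) \<le> morrey_norm a b \<omega> (G A q f)"
        using A(2)[OF f] a(1) by (intro morrey_norm_mono)
      also have "\<dots> \<le> ennreal C * epowr (morrey_norm (a * (1 - q / d)) (b * (1 - q / d)) \<omega> (grad_size f)) (1 - q / d)
        * ?N q f"
        unfolding morrey_norm_eq[OF dbl G_meas] morrey_norm_eq[OF dbl grad_meas[OF f]]
        by (rule C(2)[OF grad_meas[OF f]]) (simp add: G_def)
      finally show ?thesis .
    qed
    with C(1) show ?thesis by blast
  qed
  show ?thesis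
  proof (intro conjI allI impI, goal_cases)
    case (1 q r)
    note q = 1(1) and r = 1(2,3) and eq = 1(4)
    \<comment> \<open>In this item q < d is not assumed; it follows from r (1 - q/d) = q with both
      \<open>q\<close> and \<open>r\<close> positive.\<close>
    have "0 < 1 - q / d" using eq q r by (metis less_trans zero_less_mult_pos zero_less_one)
    then have "q < d" using d by simp
    \<comment> \<open>Substituting r (1 - q/d) = q into the strict inequality gives 1 < q/p. Hence
      the Morrey norm is at most the Lebesgue norm of the same \<open>q\<close>, and the two powers,
      whose exponents add to 1, combine.\<close>
    have "p < q" using r(2) eq p by (simp add: p_def[symmetric])
    obtain C where C: "0 < C" "\<And>f. regular_function f \<Longrightarrow>
      Lp_norm r \<omega> (?T f) \<le> ennreal C * epowr (Lp_norm q \<omega> (grad_size f)) (1 - q / d)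
        * ?N q f"
      using Lp[of q r] q r \<open>q < d\<close> unfolding p_def[symmetric] eq by auto
    have "Lp_norm r \<omega> (?T f) \<le> ennreal C * Lp_norm q \<omega> (grad_size f)" if f: "regular_function f" for f
    proof -
      have "morrey_norm p q \<omega> (grad_size f) \<le> Lp_norm q \<omega> (grad_size f)"
        unfolding morrey_norm_eq[OF dbl grad_meas[OF f]] Lp_norm_eq[OF grad_meas[OF f]]
        by (rule morrey_le_Lp[OF p \<open>p < q\<close> grad_meas[OF f]])
      then have "?N q f \<le> epowr (Lp_norm q \<omega> (grad_size f)) (q / d)"
        using q d by (intro epowr_mono) auto
      then have "ennreal C * epowr (Lp_norm q \<omega> (grad_size f)) (1 - q / d) * ?N q f
        \<le> ennreal C * epowr (Lp_norm q \<omega> (grad_size f)) (1 - q / d) * epowr (Lp_norm q \<omega> (grad_size f)) (q / d)"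
        by (rule mult_left_mono) simp
      also have "\<dots> = ennreal C * Lp_norm q \<omega> (grad_size f)"
        by (simp add: mult.assoc epowr_add[symmetric])
      finally show ?thesis using C(2)[OF f] by (rule order_trans[rotated])
    qed
    with C(1) show ?case by blast
  next
    case (2 \<sigma> q r)
    then have "0 < q" "0 < r" using p by (simp_all add: p_def)
    from Lp[OF this(1) 2(3) this(2)] 2(5,6) show ?case
      unfolding p_def by blast
  next
    case (3 q a b)
    then have "0 < q" "0 < a" by simp_all
    from morrey[OF this(1) 3(3) this(2) 3(5)] 3(6) show ?case
      unfolding p_def by blast
  qed
qed

end
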